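(* For every $x \in [0,1]$, $$n^{-\beta^{\ast}}\, \mathbb{E}\big[\mathcal{N}_{n}(x)\big] \underset{n\to\infty}{\longrightarrow} K_{0}\,\big(x(1-x)\big)^{\beta^\ast/2},$$ where $$\beta^{\ast} = \frac{\sqrt{17}-3}{2}, \qquad K_{0}=\frac{\Gamma(2\beta^{\ast}+2)\, \Gamma(\beta^{\ast}+2)}{2\, \Gamma(\beta^{\ast}+1)^3\, \Gamma\left(\frac{\beta^{\ast}}{2}+1\right)^2}.$$
   Context: Let $P_1, P_2, \dots$ be independent random variables uniformly distributed over $(0,1)^2$ (almost surely they have pairwise distinct $x$-coordinates and pairwise distinct $y$-coordinates). The covering $\mathrm{Quad}(P_1,\dots,P_n)$ of $[0,1]^2$ by $3n+1$ closed rectangles with disjoint interiors is built iteratively: start with the single rectangle $[0,1]^2$; the first point $P_1$ divides $[0,1]^2$ into four closed quadrants by the vertical and horizontal lines through $P_1$; inductively, $P_k$ divides the rectangle of the current covering in whose interior it falls into four closed rectangles by the vertical and horizontal lines through $P_k$ (restricted to that rectangle), these four replacing the divided rectangle. For $x\in[0,1]$, $S_x$ denotes the vertical segment $[(x,0),(x,1)]$, and $\mathcal{N}_n(x)$ is the number of rectangles of $\mathrm{Quad}(P_1,\dots,P_n)$ that intersect $S_x$, minus $1$; by convention $\mathcal{N}_0(x)=0$. $\Gamma$ is the Euler gamma function. *)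

theory Defs
  imports "HOL-Probability.Probability"
begin

text \<open>
  Rectangles are represented as subsets of the plane, so that a covering is a set of sets.
\<close>

definition quadrants :: "real \<times> real \<Rightarrow> (real \<times> real) set \<Rightarrow> (real \<times> real) set set" where
  "quadrants p R =
    {R \<inter> {z. fst z \<le> fst p \<and> snd z \<le> snd p},
     R \<inter> {z. fst z \<ge> fst p \<and> snd z \<le> snd p},
     R \<inter> {z. fst z \<le> fst p \<and> snd z \<ge> snd p},
     R \<inter> {z. fst z \<ge> fst p \<and> snd z \<ge> snd p}}"

text \<open>
  \<open>Quad p n\<close> is the covering built from the points \<open>p 1, \<dots>, p n\<close> (the value \<open>p 0\<close> is not
  used).  A point lying in the interior of no rectangle, which for independent uniform points
  happens with probability 0, leaves the covering unchanged.
\<close>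

fun Quad :: "(nat \<Rightarrow> real \<times> real) \<Rightarrow> nat \<Rightarrow> (real \<times> real) set set" where
  "Quad p 0 = {{0..1} \<times> {0..1}}"
| "Quad p (Suc n) =
    (\<Union>R\<in>Quad p n. if p (Suc n) \<in> interior R then quadrants (p (Suc n)) R else {R})"

definition vsegment :: "real \<Rightarrow> (real \<times> real) set" where
  "vsegment x = closed_segment (x, 0) (x, 1)"

definition num_crossed :: "(nat \<Rightarrow> real \<times> real) \<Rightarrow> nat \<Rightarrow> real \<Rightarrow> real" where
  "num_crossed p n x = real (card {R \<in> Quad p n. R \<inter> vsegment x \<noteq> {}}) - 1"

definition beta_star :: real where
  "beta_star = (sqrt 17 - 3) / 2"

definition K0 :: real where
  "K0 = (Gamma (2 * beta_star + 2) * Gamma (beta_star + 2)) /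
        (2 * Gamma (beta_star + 1) ^ 3 * Gamma (beta_star / 2 + 1) ^ 2)"

end

theory Submission
  imports Defs
begin

text \<open>
  Unrolling the covering from its first point shows that one plus the expected number of crossings
  equals \<open>a\<^sub>n x = (\<Sum>k\<le>n. (n choose k) * d\<^sub>k x)\<close>, where the polynomials \<open>d\<^sub>k\<close> satisfy \<open>d\<^sub>0 = 1\<close> and
  \<open>d\<^sub>k x + d\<^sub>k\<^sub>+\<^sub>1 x = 2 / (k + 1) * (h\<^sub>k x + h\<^sub>k (1 - x))\<close> with \<open>h\<^sub>k x = \<integral>\<^sub>x\<^sup>1 t\<^sup>k d\<^sub>k (x / t) dt\<close>.  So
  \<open>a\<^sub>n\<^sub>+\<^sub>1\<close> is an average of values \<open>a\<^sub>j\<close> with binomial \<open>j\<close>, and \<open>m x = (x * (1 - x)) powr (\<beta> / 2)\<close> is the fixed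
  point of this recursion at growth rate \<open>n powr \<beta>\<close>, because \<open>(\<beta> + 1) * (\<beta> + 2) = 4\<close>.

  The integral of \<open>a\<^sub>n\<close> over \<open>[0, 1]\<close> is an explicit alternating sum.  The Chu--Vandermonde identity
  turns it into a convolution, whose asymptotics follows from the Gauss summation of a hypergeometric
  series; this fixes the constant.  The primitives \<open>\<integral>\<^sub>0\<^sup>y a\<^sub>n\<close> satisfy a recursion of their own, which
  is a contraction in the supremum norm once the error at \<open>y = 1\<close> is under control, so they converge
  uniformly after division by \<open>n powr \<beta>\<close>.  Integration by parts expresses \<open>a\<^sub>n\<^sub>+\<^sub>1 x\<close> for \<open>0 < x < 1\<close>
  through these primitives, which gives pointwise convergence.  For \<open>x = 0\<close> and \<open>x = 1\<close> the bound
  \<open>a\<^sub>n x \<le> 1 + 9 * sqrt n\<close> suffices, since \<open>\<beta> > 1 / 2\<close>.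
\<close>

section \<open>Binomial averages and scaling integrals\<close>

text \<open>The limit equation is linear and homogeneous. Integrated over [0, 1] it yields the
  condition (\<beta> + 1) * (\<beta> + 2) = 4 on the exponent, but it leaves the factor in front of
  \<open>m\<close> free, and since it has a nonzero fixed point, no norm contracts it outright. The
  missing information is a single number, the total integral. It says nothing directly about the
  values at a point, but for the primitives it is the value at y = 1, and the recursion samples
  exactly this value at all scales t <= y. There the error is already known to be small, and the
  remaining weights add up to less than 1.

  Binomial sums are the natural coordinates: given the first point, the number of later points in a
  piece of relative area p is binomial, and averaging over it multiplies the k-th coefficient by p ^
  k. Hence the recursion for the coefficients is exact. Randomness enters the asymptotics only
  through the fluctuation of the binomial index, of order sqrt n, which changes its \<beta>-th power
  by order n powr (\<beta> / 2), a lower-order error.\<close>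

definition bern_mean :: "nat \<Rightarrow> real \<Rightarrow> (nat \<Rightarrow> real) \<Rightarrow> real" where
  "bern_mean n p u = (\<Sum>j\<le>n. Bernstein n j p * u j)"

lemma bern_mean_mono:
  assumes "0 \<le> p" "p \<le> 1" "\<And>j. j \<le> n \<Longrightarrow> u j \<le> w j"
  shows "bern_mean n p u \<le> bern_mean n p w"
  unfolding bern_mean_def by (intro sum_mono mult_left_mono) (use assms in \<open>auto intro: Bernstein_nonneg\<close>)

lemma bern_mean_const [simp]: "bern_mean n p (\<lambda>_. c) = c"
  unfolding bern_mean_def sum_distrib_right[symmetric] by simp

lemma bern_mean_add: "bern_mean n p (\<lambda>j. u j + w j) = bern_mean n p u + bern_mean n p w"
  unfolding bern_mean_def by (simp add: ring_distribs sum.distrib)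

lemma bern_mean_diff: "bern_mean n p (\<lambda>j. u j - w j) = bern_mean n p u - bern_mean n p w"
  unfolding bern_mean_def by (simp add: ring_distribs sum_subtractf)

lemma bern_mean_cmult: "bern_mean n p (\<lambda>j. c * u j) = c * bern_mean n p u"
  unfolding bern_mean_def by (simp add: sum_distrib_left mult_ac)

lemma abs_Bern_le:
  assumes "0 \<le> p" "p \<le> 1"
  shows "\<bar>bern_mean n p u\<bar> \<le> bern_mean n p (\<lambda>j. \<bar>u j\<bar>)"
proof -
  have "\<bar>bern_mean n p u\<bar> \<le> (\<Sum>j\<le>n. \<bar>Bernstein n j p * u j\<bar>)"
    unfolding bern_mean_def by (rule sum_abs)
  also have "\<dots> = bern_mean n p (\<lambda>j. \<bar>u j\<bar>)"
    unfolding bern_mean_def by (intro sum.cong) (use assms in \<open>auto simp: abs_mult Bernstein_nonneg\<close>)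
  finally show ?thesis .
qed

lemma bern_mean_of_nat: "bern_mean n p real = real n * p"
  unfolding bern_mean_def by (subst sum_k_Bernstein[symmetric]) (simp add: mult.commute)

lemma bern_mean_variance: "bern_mean n p (\<lambda>j. (real j - real n * p)\<^sup>2) = real n * p * (1 - p)"
proof -
  have "bern_mean n p (\<lambda>j. (real j - real n * p)\<^sup>2)
      = bern_mean n p (\<lambda>j. (real j * (real j - 1) + (1 - 2 * real n * p) * real j) + (real n * p)\<^sup>2)"
    by (rule arg_cong[where f = "bern_mean n p"]) (auto simp: power2_eq_square algebra_simps)
  also have "\<dots> = bern_mean n p (\<lambda>j. real j * (real j - 1)) + (1 - 2 * real n * p) * (real n * p) + (real n * p)\<^sup>2"
    unfolding bern_mean_add bern_mean_cmult bern_mean_of_nat by simp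
  also have "bern_mean n p (\<lambda>j. real j * (real j - 1)) = real n * (real n - 1) * p\<^sup>2"
    unfolding bern_mean_def by (subst sum_kk_Bernstein[symmetric]) (simp add: mult_ac)
  finally show ?thesis by (simp add: power2_eq_square algebra_simps)
qed

lemma bern_mean_choose: "bern_mean n p (\<lambda>j. real (j choose k)) = real (n choose k) * p ^ k"
proof (cases "k \<le> n")
  case True
  have "bern_mean n p (\<lambda>j. real (j choose k)) = (\<Sum>j\<in>{k..n}. Bernstein n j p * real (j choose k))"
    unfolding bern_mean_def by (rule sum.mono_neutral_right) auto
  also have "\<dots> = (\<Sum>i\<le>n - k. Bernstein n (i + k) p * real ((i + k) choose k))"
    by (rule sum.reindex_bij_witness[of _ "\<lambda>i. i + k" "\<lambda>j. j - k"]) (use True in auto)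
  also have "\<dots> = (\<Sum>i\<le>n - k. real (n choose k) * p ^ k * Bernstein (n - k) i p)"
  proof (intro sum.cong refl)
    fix i assume "i \<in> {..n - k}"
    then have i: "i + k \<le> n" using True by auto
    have "real (n choose (i + k)) * real ((i + k) choose k) = real (n choose k) * real ((n - k) choose i)"
      using choose_mult[of k "i + k" n] i by (metis of_nat_mult add_diff_cancel_right' le_add2)
    moreover have "n - (i + k) = n - k - i" by simp
    ultimately show "Bernstein n (i + k) p * real ((i + k) choose k) = real (n choose k) * p ^ k * Bernstein (n - k) i p"
      unfolding Bernstein_def by (simp add: power_add mult_ac)
  qed
  also have "\<dots> = real (n choose k) * p ^ k"
    unfolding sum_distrib_left[symmetric] by simp
  finally show ?thesis .
next
  case False
  then show ?thesis unfolding bern_mean_def by (simp add: binomial_eq_0)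
qed

text \<open>Thinning an index multiplies its k-th factorial moment by p ^ k, so it acts diagonally
  on the coefficients of a binomial sum. This is why expectations are expanded in binomial
  coefficients.\<close>

lemma bern_mean_binomial_sum:
  "bern_mean n p (\<lambda>j. \<Sum>k\<le>j. real (j choose k) * c k) = (\<Sum>k\<le>n. real (n choose k) * p ^ k * c k)"
proof -
  have "bern_mean n p (\<lambda>j. \<Sum>k\<le>j. real (j choose k) * c k)
      = (\<Sum>j\<le>n. Bernstein n j p * (\<Sum>k\<le>n. real (j choose k) * c k))"
    unfolding bern_mean_def
    by (intro sum.cong refl arg_cong2[where f="(*)"] sum.mono_neutral_left) (auto simp: binomial_eq_0)
  also have "\<dots> = (\<Sum>k\<le>n. bern_mean n p (\<lambda>j. real (j choose k)) * c k)"
    unfolding bern_mean_def sum_distrib_left sum_distrib_right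
    by (subst sum.swap) (simp add: mult_ac)
  finally show ?thesis by (simp add: bern_mean_choose)
qed

lemma continuous_on_bern_mean: "continuous_on S p \<Longrightarrow> continuous_on S (\<lambda>x. bern_mean n (p x) u)"
  unfolding bern_mean_def Bernstein_def by (intro continuous_intros)

text \<open>If the first point cuts off a piece of relative width t, the relative height v is
  uniform, and each later point falls into the piece with probability t * v.\<close>

definition bern_avg :: "nat \<Rightarrow> real \<Rightarrow> (nat \<Rightarrow> real) \<Rightarrow> real" where
  "bern_avg n t u = integral {0..1} (\<lambda>v. bern_mean n (t * v) u)"

lemma bern_mean_integrable: "(\<lambda>v. bern_mean n (t * v) u) integrable_on {0..1}"
  by (intro integrable_continuous_interval continuous_on_bern_mean continuous_intros)

lemma bern_avg_mono:
  assumes "0 \<le> t" "t \<le> 1" "\<And>j. j \<le> n \<Longrightarrow> u j \<le> w j"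
  shows "bern_avg n t u \<le> bern_avg n t w"
  unfolding bern_avg_def
  by (intro integral_le bern_mean_integrable bern_mean_mono) (use assms in \<open>auto intro: mult_le_one\<close>)

lemma bern_avg_const [simp]: "bern_avg n t (\<lambda>_. c) = c"
  by (simp add: bern_avg_def)

lemma bern_avg_add: "bern_avg n t (\<lambda>j. u j + w j) = bern_avg n t u + bern_avg n t w"
  unfolding bern_avg_def bern_mean_add by (intro integral_add bern_mean_integrable)

lemma bern_avg_cmult: "bern_avg n t (\<lambda>j. c * u j) = c * bern_avg n t u"
  unfolding bern_avg_def bern_mean_cmult by (rule integral_mult_right)

lemma bern_avg_binomial_sum:
  "bern_avg n t (\<lambda>j. \<Sum>k\<le>j. real (j choose k) * c k) = (\<Sum>k\<le>n. real (n choose k) * t ^ k * c k / (real k + 1))"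
proof -
  have "((\<lambda>v. v ^ k) has_integral (1 / (real k + 1))) {0..1::real}" for k :: nat
  proof -
    have "((\<lambda>v. v ^ k) has_integral (1 ^ (k+1) / (k+1) - 0 ^ (k+1) / (k+1))) {0..1::real}"
    proof (rule fundamental_theorem_of_calculus)
      fix v :: real
      have "((\<lambda>v. v ^ (k+1) / (k+1)) has_real_derivative (real (k+1) * v ^ (k+1-1) / (k+1))) (at v within {0..1})"
        using DERIV_pow[of "k + 1" v "{0..1}"] by (intro DERIV_cdivide) simp
      then show "((\<lambda>v. v ^ (k+1) / (k+1)) has_vector_derivative v ^ k) (at v within {0..1})"
        by (simp add: has_real_derivative_iff_has_vector_derivative)
    qed simp
    then show ?thesis by (simp add: add.commute)
  qed
  then have "((\<lambda>v. \<Sum>k\<le>n. real (n choose k) * t ^ k * c k * v ^ k) has_integral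
      (\<Sum>k\<le>n. real (n choose k) * t ^ k * c k * (1 / (real k + 1)))) {0..1}"
    by (intro has_integral_sum has_integral_mult_right) auto
  then show ?thesis
    unfolding bern_avg_def bern_mean_binomial_sum
    by (intro integral_unique) (simp add: power_mult_distrib mult_ac)
qed

section \<open>Powers under binomial averages\<close>

lemma powr_diff_le:
  fixes a b :: real
  assumes "0 \<le> a" "0 \<le> b" "0 < r" "r \<le> 1"
  shows "\<bar>a powr r - b powr r\<bar> \<le> \<bar>a - b\<bar> powr r"
proof -
  have add: "(x + y) powr r \<le> x powr r + y powr r" if "0 \<le> x" "0 \<le> y" for x y :: real
  proof (cases "x + y = 0")
    case False
    then have s: "x + y > 0" using that by linarith
    have le: "z \<le> z powr r" if "0 \<le> z" "z \<le> 1" for z :: real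
      using that assms powr_mono'[of r 1 z] by (cases "z = 0") auto
    \<comment> \<open>Each share of x + y lies in [0, 1] and is therefore at most its r-th power;
      rescaling gives subadditivity.\<close>
    have "1 = x / (x + y) + y / (x + y)" using s by (simp add: add_divide_distrib[symmetric])
    also have "\<dots> \<le> (x / (x + y)) powr r + (y / (x + y)) powr r"
      using that s by (intro add_mono le) auto
    also have "\<dots> = (x powr r + y powr r) / (x + y) powr r"
      using that s by (simp add: powr_divide add_divide_distrib)
    finally show ?thesis using s by (simp add: field_simps)
  qed (use that assms in auto)
  show ?thesis
  proof (cases "a \<le> b")
    case True
    then have "b powr r \<le> a powr r + (b - a) powr r" using add[of a "b - a"] assms by simp
    moreover have "a powr r \<le> b powr r" using True assms by (intro powr_mono2) auto
    ultimately show ?thesis using True by simp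
  next
    case False
    then have "a powr r \<le> b powr r + (a - b) powr r" using add[of b "a - b"] assms by simp
    moreover have "b powr r \<le> a powr r" using False assms by (intro powr_mono2) auto
    ultimately show ?thesis using False by simp
  qed
qed

text \<open>The r-th power is Hoelder continuous with exponent r, and a binomial index deviates from
  its mean by order sqrt n. Uniformity in p is what allows the bound to be integrated.\<close>

lemma bern_mean_powr:
  assumes "0 \<le> p" "p \<le> 1" "0 < r" "r \<le> 1"
  shows "\<bar>bern_mean n p (\<lambda>j. real j powr r) - (real n * p) powr r\<bar> \<le> 2 * real n powr (r / 2)"
proof (cases "n = 0")
  case True
  then show ?thesis by (simp add: bern_mean_def)
next
  case False
  then have n: "real n > 0" by simp
  \<comment> \<open>Reduces the r-th moment of the deviation, measured in units of sqrt n, to the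
    variance.\<close>
  have z: "z powr r \<le> 1 + z\<^sup>2" if "z \<ge> 0" for z :: real
  proof (cases "z \<le> 1")
    case True
    then have "z powr r \<le> 1" using that assms by (intro powr_le1) auto
    then show ?thesis by (simp add: add_increasing2)
  next
    case False
    then have "z powr r \<le> z powr 2" using assms by (intro powr_mono) auto
    then show ?thesis using False by simp
  qed
  have bd: "\<bar>real j powr r - (real n * p) powr r\<bar>
      \<le> real n powr (r / 2) + real n powr (r / 2) / real n * (real j - real n * p)\<^sup>2" for j
  proof -
    let ?d = "\<bar>real j - real n * p\<bar>"
    have "\<bar>real j powr r - (real n * p) powr r\<bar> \<le> ?d powr r"
      using assms n by (intro powr_diff_le) auto
    also have "?d = sqrt n * (?d / sqrt n)" using n by simp
    also have "\<dots> powr r = sqrt n powr r * (?d / sqrt n) powr r"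
      by (rule powr_mult)
    also have "sqrt n powr r = real n powr (r / 2)"
      using n by (simp add: powr_half_sqrt[symmetric] powr_powr)
    also have "(?d / sqrt n) powr r \<le> 1 + (?d / sqrt n)\<^sup>2" by (intro z) auto
    also have "(?d / sqrt n)\<^sup>2 = (real j - real n * p)\<^sup>2 / n" by (simp add: power_divide)
    finally show ?thesis using n by (simp add: field_simps)
  qed
  have "\<bar>bern_mean n p (\<lambda>j. real j powr r) - (real n * p) powr r\<bar>
      = \<bar>bern_mean n p (\<lambda>j. real j powr r - (real n * p) powr r)\<bar>" by (simp add: bern_mean_diff)
  also have "\<dots> \<le> bern_mean n p (\<lambda>j. \<bar>real j powr r - (real n * p) powr r\<bar>)"
    using assms by (intro abs_Bern_le) auto
  also have "\<dots> \<le> bern_mean n p (\<lambda>j. real n powr (r / 2) + real n powr (r / 2) / real n * (real j - real n * p)\<^sup>2)"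
    using assms bd by (intro bern_mean_mono) auto
  also have "\<dots> = real n powr (r / 2) + real n powr (r / 2) * (p * (1 - p))"
    unfolding bern_mean_add bern_mean_cmult bern_mean_variance using n by simp
  also have "\<dots> \<le> real n powr (r / 2) + real n powr (r / 2) * 1"
    using assms by (intro add_mono mult_left_mono mult_le_one) auto
  finally show ?thesis by simp
qed

lemma has_integral_powr_01:
  fixes r y :: real
  assumes "0 \<le> r" "0 \<le> y"
  shows "((\<lambda>v. v powr r) has_integral (y powr (r + 1) / (r + 1))) {0..y}"
proof -
  have "((\<lambda>v. v powr r) has_integral (y powr (r + 1) / (r + 1) - 0 powr (r + 1) / (r + 1))) {0..y}"
  proof (intro fundamental_theorem_of_calculus_interior)
    show "continuous_on {0..y} (\<lambda>v. v powr (r + 1) / (r + 1))"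
      using assms by (intro continuous_intros continuous_on_powr') auto
    fix v assume "v \<in> {0<..<y}"
    then have "((\<lambda>v. v powr (r + 1) / (r + 1)) has_real_derivative ((r + 1) * v powr (r + 1 - 1) / (r + 1))) (at v)"
      by (intro DERIV_cdivide has_real_derivative_powr) auto
    then show "((\<lambda>v. v powr (r + 1) / (r + 1)) has_vector_derivative v powr r) (at v)"
      using assms by (simp add: has_real_derivative_iff_has_vector_derivative)
  qed (use assms in auto)
  then show ?thesis using assms by simp
qed

lemma bern_avg_powr:
  assumes "0 \<le> t" "t \<le> 1" "0 < r" "r \<le> 1"
  shows "\<bar>bern_avg n t (\<lambda>j. real j powr r) - (real n * t) powr r / (r + 1)\<bar> \<le> 2 * real n powr (r / 2)"
proof -
  have i: "((\<lambda>v. (real n * t * v) powr r) has_integral (real n * t) powr r * (1 / (r + 1))) {0..1}"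
    using has_integral_mult_right[OF has_integral_powr_01[of r 1], of "(real n * t) powr r"] assms
    by (subst has_integral_cong[where g = "\<lambda>v. (real n * t) powr r * v powr r"]) (auto intro!: powr_mult)
  have "bern_avg n t (\<lambda>j. real j powr r) - (real n * t) powr r * (1 / (r + 1))
      = integral {0..1} (\<lambda>v. bern_mean n (t * v) (\<lambda>j. real j powr r) - (real n * t * v) powr r)"
    unfolding bern_avg_def using i
    by (subst integral_diff[OF bern_mean_integrable]) (auto dest: integral_unique)
  also have "norm \<dots> \<le> integral {0..1::real} (\<lambda>v. 2 * real n powr (r / 2))"
  proof (rule integral_norm_bound_integral)
    show "(\<lambda>v. bern_mean n (t * v) (\<lambda>j. real j powr r) - (real n * t * v) powr r) integrable_on {0..1}"
      by (intro integrable_diff bern_mean_integrable has_integral_integrable[OF i])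
    fix v :: real assume "v \<in> {0..1}"
    then show "norm (bern_mean n (t * v) (\<lambda>j. real j powr r) - (real n * t * v) powr r) \<le> 2 * real n powr (r / 2)"
      using bern_mean_powr[of "t * v" r n] assms by (auto simp: mult_ac mult_le_one)
  qed auto
  finally show ?thesis by simp
qed

text \<open>The equation \<open>z h' = (k + 1) h - f\<close> characterises \<open>h x = \<integral>\<^sub>x\<^sup>1 t\<^sup>k f (x / t) dt\<close>.\<close>

lemma
  fixes k :: real and f h F :: "real \<Rightarrow> real"
  assumes k: "k \<ge> 0"
    and F: "continuous_on {0..1} F" "\<And>z. z \<in> {0<..<1} \<Longrightarrow> (F has_real_derivative f z) (at z)" "F 0 = 0"
    and h: "continuous_on {0..1} h" "h 1 = 0"
      "\<And>z. z \<in> {0<..<1} \<Longrightarrow> (h has_real_derivative (((k + 1) * h z - f z) / z)) (at z)"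
    and y: "y \<in> {0..1}"
  shows scaling_integral_primitive:
      "((\<lambda>t. t powr (k + 1) * F (min 1 (y / t))) has_integral (y * h y + F y) / (k + 2)) {0..1}"
    and integral_scaling_solution: "(h has_integral (y * h y + F y) / (k + 2)) {0..y}"
proof -
  \<comment> \<open>This is a primitive of h: the equation z * h' = (k + 1) * h - f gives (z * h +
    F)' = (k + 2) * h.\<close>
  define \<Theta> where "\<Theta> z = (z * h z + F z) / (k + 2)" for z
  have d\<Theta>: "(\<Theta> has_real_derivative h z) (at z)" if "z \<in> {0<..<1}" for z
  proof -
    have "(\<Theta> has_real_derivative (1 * h z + ((k + 1) * h z - f z) / z * z + f z) / (k + 2)) (at z)"
      unfolding \<Theta>_def using that
      by (intro DERIV_cdivide DERIV_add DERIV_mult F(2) h(3)) (auto intro: DERIV_ident)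
    also have "((k + 1) * h z - f z) / z * z = (k + 1) * h z - f z"
      using that by simp
    also have "1 * h z + ((k + 1) * h z - f z) + f z = (k + 2) * h z"
      by (simp add: algebra_simps)
    finally show ?thesis using k by simp
  qed
  have c\<Theta>: "continuous_on {0..1} \<Theta>"
    unfolding \<Theta>_def using k by (intro continuous_intros F h) auto
  have "(h has_integral (\<Theta> y - \<Theta> 0)) {0..y}"
    using y d\<Theta> by (intro fundamental_theorem_of_calculus_interior continuous_on_subset[OF c\<Theta>])
       (auto simp: has_real_derivative_iff_has_vector_derivative[symmetric])
  then show "(h has_integral (y * h y + F y) / (k + 2)) {0..y}"
    using F by (simp add: \<Theta>_def)
  show "((\<lambda>t. t powr (k + 1) * F (min 1 (y / t))) has_integral (y * h y + F y) / (k + 2)) {0..1}"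
  proof (cases "y = 0")
    case True
    then show ?thesis using F by simp
  next
    case False
    then have y0: "0 < y" "y \<le> 1" using y by auto
    \<comment> \<open>Below y the argument is clipped to 1 and the integrand is a pure power. Its
      integral cancels the boundary term at t = y of the other half, because h 1 = 0.\<close>
    have 1: "((\<lambda>t. t powr (k + 1) * F (min 1 (y / t))) has_integral (y powr (k + 2) / (k + 2) * F 1)) {0..y}"
    proof -
      have "((\<lambda>t. t powr (k + 1) * F 1) has_integral (y powr (k + 2) / (k + 2) * F 1)) {0..y}"
        using has_integral_mult_left[OF has_integral_powr_01[of "k + 1" y], of "F 1"] k y0
        by (simp add: add.assoc)
      moreover have "t powr (k + 1) * F (min 1 (y / t)) = t powr (k + 1) * F 1" if "t \<in> {0..y}" for t
        using that by (cases "t = 0") (auto simp: min_def field_simps)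
      ultimately show ?thesis by (subst has_integral_cong) auto
    qed
    \<comment> \<open>With z = y / t, the derivative of t powr (k + 2) * \<open>\<Theta> z\<close>
      is t powr (k + 1) * ((k + 2) * \<open>\<Theta> z\<close> - z * h z), and the bracket equals F
      z.\<close>
    have 2: "((\<lambda>t. t powr (k + 1) * F (min 1 (y / t))) has_integral (1 powr (k + 2) * \<Theta> (y / 1) - y powr (k + 2) * \<Theta> (y / y))) {y..1}"
    proof (rule fundamental_theorem_of_calculus_interior)
      show "continuous_on {y..1} (\<lambda>t. t powr (k + 2) * \<Theta> (y / t))"
        using y0 by (intro continuous_intros continuous_on_compose2[OF c\<Theta>]) (auto simp: field_simps)
      fix t assume t: "t \<in> {y<..<1}"
      then have z: "y / t \<in> {0<..<1}" "t > 0" using y0 by (auto simp: field_simps)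
      have "((\<lambda>t. y / t) has_real_derivative (- y / (t * t))) (at t)"
        using z by (auto intro!: derivative_eq_intros simp: field_simps)
      then have ch: "((\<lambda>t. \<Theta> (y / t)) has_real_derivative (h (y / t) * (- y / (t * t)))) (at t)"
        by (rule DERIV_chain2[where f = \<Theta> and g = "\<lambda>t. y / t", OF d\<Theta>[OF z(1)]])
      have "((\<lambda>t. t powr (k + 2) * \<Theta> (y / t)) has_real_derivative
          ((k + 2) * t powr (k + 2 - 1) * \<Theta> (y / t) + (h (y / t) * (- y / (t * t))) * t powr (k + 2))) (at t)"
        by (intro DERIV_mult has_real_derivative_powr ch z)
      also have "k + 2 - 1 = k + 1" by simp
      also have "t powr (k + 2) = t powr (k + 1) * t"
        using z powr_add[of t "k + 1" 1] by (simp add: add.assoc)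
      also have "(k + 2) * t powr (k + 1) * \<Theta> (y / t) + (h (y / t) * (- y / (t * t))) * (t powr (k + 1) * t)
        = t powr (k + 1) * F (min 1 (y / t))"
      proof -
        have "(k + 2) * \<Theta> (y / t) = y / t * h (y / t) + F (y / t)"
          using k by (simp add: \<Theta>_def)
        then have "(k + 2) * t powr (k + 1) * \<Theta> (y / t) = t powr (k + 1) * (y / t * h (y / t) + F (y / t))"
          by (simp add: mult_ac)
        moreover have "min 1 (y / t) = y / t" using z by simp
        ultimately show ?thesis using z by (simp add: field_simps)
      qed
      finally show "((\<lambda>t. t powr (k + 2) * \<Theta> (y / t)) has_vector_derivative t powr (k + 1) * F (min 1 (y / t))) (at t)"
        by (simp add: has_real_derivative_iff_has_vector_derivative)
    qed (use y0 in auto)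
    have "((\<lambda>t. t powr (k + 1) * F (min 1 (y / t))) has_integral
       (y powr (k + 2) / (k + 2) * F 1 + (1 powr (k + 2) * \<Theta> (y / 1) - y powr (k + 2) * \<Theta> (y / y)))) {0..1}"
      by (rule has_integral_combine[OF _ _ 1 2]) (use y0 in auto)
    then show ?thesis using y0 h k by (simp add: \<Theta>_def)
  qed
qed

section \<open>A hypergeometric sum\<close>

text \<open>Terms of the hypergeometric series 2F1(a, b; c; 1).\<close>

definition gauss_term :: "real \<Rightarrow> real \<Rightarrow> real \<Rightarrow> nat \<Rightarrow> real" where
  "gauss_term a b c i = pochhammer a i * pochhammer b i / (pochhammer c i * fact i)"

text \<open>A contiguous relation in c, written termwise: the right-hand side is a difference of
  consecutive values of c * i * \<open>gauss_term a b c i\<close>, so it disappears on summation as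
  soon as that quantity tends to 0.\<close>

lemma gauss_term_telescope:
  assumes "c > 0"
  shows "c * (c - a - b) * gauss_term a b c i - (c - a) * (c - b) * gauss_term a b (c + 1) i
       = c * real i * gauss_term a b c i - c * real (Suc i) * gauss_term a b c (Suc i)"
proof -
  define p where "p = pochhammer a i * pochhammer b i / fact i"
  define q where "q = pochhammer (c + 1) i"
  have q: "q > 0" unfolding q_def using assms by (intro pochhammer_pos) auto
  have pc: "pochhammer c i > 0" using assms by (intro pochhammer_pos) auto
  have ci: "c + real i > 0" using assms by simp
  have cq: "pochhammer c i * (c + real i) = c * q"
    using pochhammer_Suc[of c i] pochhammer_rec[of c i] unfolding q_def by simp
  then have pci: "pochhammer c i = c * q / (c + real i)" using ci by (simp add: field_simps)
  have t1: "gauss_term a b c i = p * (c + real i) / (c * q)"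
    unfolding gauss_term_def p_def pci using ci by simp
  have t2: "gauss_term a b (c + 1) i = p / q"
    unfolding gauss_term_def p_def q_def by simp
  have "gauss_term a b c (Suc i) = pochhammer a i * (a + i) * (pochhammer b i * (b + i)) / (c * q * (real (Suc i) * fact i))"
    unfolding gauss_term_def pochhammer_Suc cq by simp
  also have "\<dots> = p * (a + i) * (b + i) / (c * q * real (Suc i))"
    unfolding p_def by (simp add: mult_ac)
  finally have t3: "c * real (Suc i) * gauss_term a b c (Suc i) = p * (a + i) * (b + i) / q"
    using assms q nonzero_mult_divide_mult_cancel_left[of "c * real (Suc i)" "p * (a + i) * (b + i)" q]
    by (simp add: mult_ac del: of_nat_Suc)
  have "c * (c - a - b) * gauss_term a b c i - (c - a) * (c - b) * gauss_term a b (c + 1) i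
      = p * ((c - a - b) * (c + real i) - (c - a) * (c - b)) / q"
    unfolding t1 t2 using assms q by (simp add: field_simps)
  also have "(c - a - b) * (c + real i) - (c - a) * (c - b) = real i * (c + real i) - (a + i) * (b + i)"
    by (simp add: algebra_simps)
  also have "p * (real i * (c + real i) - (a + i) * (b + i)) / q
     = c * real i * gauss_term a b c i - c * real (Suc i) * gauss_term a b c (Suc i)"
    unfolding t1 t3 using assms q by (simp add: field_simps)
  finally show ?thesis .
qed

context
  fixes s :: real
  assumes s: "0 < s" "s < 1"
begin

abbreviation "\<tau> \<equiv> gauss_term (- s) (- 1 - s)"

lemma abs_pochhammer_minus: "\<bar>pochhammer (- s) i\<bar> \<le> fact i"
proof (induction i)
  case (Suc i)
  have "\<bar>- s + real i\<bar> \<le> real (Suc i)" using s by auto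
  with Suc have "\<bar>pochhammer (- s) i\<bar> * \<bar>- s + real i\<bar> \<le> fact i * real (Suc i)"
    by (intro mult_mono) auto
  then show ?case by (simp add: pochhammer_Suc abs_mult mult_ac)
qed simp

lemma abs_pochhammer_minus': "\<bar>pochhammer (- 1 - s) (i + 2)\<bar> \<le> 2 * fact i"
proof (induction i)
  case 0
  have "(s + 1) * s \<le> 2 * 1" using s by (intro mult_mono) auto
  then show ?case using s by (simp add: pochhammer_rec numeral_2_eq_2 abs_mult)
next
  case (Suc i)
  have "\<bar>- 1 - s + real (i + 2)\<bar> \<le> real (Suc i)" using s by auto
  with Suc have "\<bar>pochhammer (- 1 - s) (i + 2)\<bar> * \<bar>- 1 - s + real (i + 2)\<bar> \<le> 2 * fact i * real (Suc i)"
    by (intro mult_mono) auto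
  then show ?case by (simp add: pochhammer_Suc abs_mult mult_ac)
qed

text \<open>The first two factors of \<open>pochhammer (- 1 - s)\<close> cost only a constant; the
  later ones match a factorial that lags by two, which yields cubic decay. This gives absolute
  convergence and, after multiplication by i, a vanishing boundary term in the telescoping
  sum.\<close>

lemma abs_gauss_term:
  assumes "c \<ge> 2"
  shows "\<bar>\<tau> c (i + 2)\<bar> \<le> 2 / (real (i + 1) * real (i + 2) * real (i + 3))"
proof -
  have c: "pochhammer c k \<ge> fact (Suc k)" for k
  proof (induction k)
    case (Suc k)
    have "fact (Suc k) * real (Suc (Suc k)) \<le> pochhammer c k * (c + real k)"
      using Suc assms by (intro mult_mono pochhammer_nonneg) auto
    then show ?case by (simp add: pochhammer_Suc mult_ac)
  qed simp
  have "\<bar>\<tau> c (i + 2)\<bar> = \<bar>pochhammer (- s) (i + 2)\<bar> * \<bar>pochhammer (- 1 - s) (i + 2)\<bar> / (pochhammer c (i + 2) * fact (i + 2))"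
    using pochhammer_nonneg[of c "i + 2"] assms unfolding gauss_term_def by (simp add: abs_mult)
  also have "\<dots> \<le> fact (i + 2) * (2 * fact i) / (fact (Suc (i + 2)) * fact (i + 2))"
    using c[of "i + 2"] pochhammer_nonneg[of c "i + 2"] assms
    by (intro frac_le mult_mono abs_pochhammer_minus abs_pochhammer_minus' mult_nonneg_nonneg mult_pos_pos)
       (auto simp del: fact_Suc)
  also have "\<dots> = 2 * (fact i / fact (Suc (i + 2)))" by simp
  also have "fact (Suc (i + 2)) = (real (i + 1) * real (i + 2) * real (i + 3)) * fact i"
    by (simp add: numeral_2_eq_2 numeral_3_eq_3 algebra_simps)
  finally show ?thesis by simp
qed

lemma summable_gauss_term:
  assumes "c \<ge> 2" shows "summable (\<lambda>i. \<bar>\<tau> c i\<bar>)"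
proof -
  have "summable (\<lambda>i. \<bar>\<tau> c (i + 2)\<bar>)"
  proof (rule summable_comparison_test')
    show "summable (\<lambda>i. 2 * (1 / (real (Suc i))^2))"
      using inverse_squares_sums by (intro summable_mult) (auto simp: sums_iff)
    fix i :: nat
    have "\<bar>\<tau> c (i + 2)\<bar> \<le> 2 / (real (i + 1) * real (i + 2) * real (i + 3))"
      by (rule abs_gauss_term[OF assms])
    also have "\<dots> \<le> 2 / (real (i + 1) * real (i + 1) * 1)"
      by (intro divide_left_mono mult_mono) auto
    finally show "norm \<bar>\<tau> c (i + 2)\<bar> \<le> 2 * (1 / (real (Suc i))^2)"
      by (simp add: power2_eq_square)
  qed
  then show ?thesis by (subst (asm) summable_iff_shift)
qed

lemma gauss_step:
  assumes "c \<ge> 2"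
  shows "c * (c + 1 + 2 * s) * suminf (\<tau> c) = (c + s) * (c + 1 + s) * suminf (\<tau> (c + 1))"
proof -
  have sm: "summable (\<tau> c')" if "c' \<ge> 2" for c'
    using summable_gauss_term[OF that] by (rule summable_rabs_cancel)
  have lim: "(\<lambda>i. c * real i * \<tau> c i) \<longlonglongrightarrow> 0"
  proof (rule LIMSEQ_offset[of _ 2])
    have "(\<lambda>i. c * 2 * (1 / real (Suc i))) \<longlonglongrightarrow> c * 2 * 0"
      by (intro tendsto_intros LIMSEQ_Suc[OF lim_1_over_n])
    then have z: "(\<lambda>i. c * 2 * (1 / real (Suc i))) \<longlonglongrightarrow> 0" by simp
    show "(\<lambda>i. c * real (i + 2) * \<tau> c (i + 2)) \<longlonglongrightarrow> 0"
    proof (rule Lim_null_comparison[OF _ z], intro always_eventually allI)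
      fix i
      have "norm (c * real (i + 2) * \<tau> c (i + 2)) = c * real (i + 2) * \<bar>\<tau> c (i + 2)\<bar>"
        using assms by (simp add: abs_mult)
      also have "\<dots> \<le> c * real (i + 2) * (2 / (real (i + 1) * real (i + 2) * real (i + 3)))"
        using assms by (intro mult_left_mono abs_gauss_term) auto
      also have "\<dots> = c * 2 * (1 / (real (i + 1) * real (i + 3)))"
        by (simp add: field_simps del: of_nat_add of_nat_Suc)
      also have "\<dots> \<le> c * 2 * (1 / (real (i + 1) * 1))"
        using assms by (intro mult_left_mono divide_left_mono) auto
      finally show "norm (c * real (i + 2) * \<tau> c (i + 2)) \<le> c * 2 * (1 / real (Suc i))" by simp
    qed
  qed
  have "(\<lambda>i. c * real i * \<tau> c i - c * real (Suc i) * \<tau> c (Suc i)) sums (c * real 0 * \<tau> c 0 - 0)"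
    by (rule telescope_sums'[OF lim])
  then have "(\<lambda>i. c * (c - - s - (-1 - s)) * \<tau> c i - (c - - s) * (c - (-1 - s)) * \<tau> (c + 1) i) sums 0"
    using assms by (subst gauss_term_telescope) auto
  moreover have "(\<lambda>i. c * (c - - s - (-1 - s)) * \<tau> c i - (c - - s) * (c - (-1 - s)) * \<tau> (c + 1) i) sums
      (c * (c - - s - (-1 - s)) * suminf (\<tau> c) - (c - - s) * (c - (-1 - s)) * suminf (\<tau> (c + 1)))"
    using assms by (intro sums_diff sums_mult summable_sums sm) auto
  ultimately have "c * (c - - s - (-1 - s)) * suminf (\<tau> c) - (c - - s) * (c - (-1 - s)) * suminf (\<tau> (c + 1)) = 0"
    using sums_unique2 by blast
  then show ?thesis by (simp add: algebra_simps)
qed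

text \<open>Compared with c = 2, every term after the first shrinks at least by the factor 2 / c:
  the leading factor of the Pochhammer symbol is c instead of 2, and the others only grow.\<close>

lemma gauss_limit: "(\<lambda>n. suminf (\<tau> (2 + real n))) \<longlonglongrightarrow> 1"
proof -
  define T where "T = (\<Sum>i. \<bar>\<tau> 2 i\<bar>)"
  have bd: "\<bar>suminf (\<tau> c) - 1\<bar> \<le> 2 / c * T" if c: "c \<ge> 2" for c
  proof -
    have ge: "pochhammer c (Suc i) \<ge> c / 2 * pochhammer 2 (Suc i)" for i
    proof (induction i)
      case (Suc i)
      have "(c / 2 * pochhammer 2 (Suc i)) * (2 + real (Suc i)) \<le> pochhammer c (Suc i) * (c + real (Suc i))"
        using Suc c by (intro mult_mono pochhammer_nonneg) auto
      then show ?case by (simp add: pochhammer_Suc mult_ac)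
    qed simp
    have le: "\<bar>\<tau> c (Suc i)\<bar> \<le> 2 / c * \<bar>\<tau> 2 (Suc i)\<bar>" for i
    proof -
      have p: "pochhammer 2 (Suc i) > (0::real)" "pochhammer c (Suc i) > 0"
        using c by (auto intro!: pochhammer_pos)
      have "\<bar>\<tau> c (Suc i)\<bar> = \<bar>pochhammer (- s) (Suc i) * pochhammer (- 1 - s) (Suc i)\<bar> / (pochhammer c (Suc i) * fact (Suc i))"
        using p unfolding gauss_term_def by (simp add: abs_mult del: fact_Suc)
      also have "\<dots> \<le> \<bar>pochhammer (- s) (Suc i) * pochhammer (- 1 - s) (Suc i)\<bar> / (c / 2 * pochhammer 2 (Suc i) * fact (Suc i))"
        using p c ge[of i] by (intro divide_left_mono mult_right_mono mult_pos_pos) auto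
      also have "\<dots> = 2 / c * \<bar>\<tau> 2 (Suc i)\<bar>"
        using p unfolding gauss_term_def by (simp add: abs_mult mult_ac del: fact_Suc)
      finally show ?thesis .
    qed
    have S: "summable (\<lambda>i. \<bar>\<tau> c (Suc i)\<bar>)" "summable (\<lambda>i. \<bar>\<tau> 2 (Suc i)\<bar>)"
      using summable_gauss_term[OF c] summable_gauss_term[of 2]
        summable_Suc_iff[of "\<lambda>i. \<bar>\<tau> c i\<bar>"] summable_Suc_iff[of "\<lambda>i. \<bar>\<tau> 2 i\<bar>"] by blast+
    have "suminf (\<tau> c) = \<tau> c 0 + (\<Sum>i. \<tau> c (Suc i))"
      using summable_rabs_cancel[OF summable_gauss_term[OF c]] by (subst suminf_split_head) auto
    then have "\<bar>suminf (\<tau> c) - 1\<bar> = \<bar>\<Sum>i. \<tau> c (Suc i)\<bar>" by (simp add: gauss_term_def)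
    also have "\<dots> \<le> (\<Sum>i. \<bar>\<tau> c (Suc i)\<bar>)" by (rule summable_rabs[OF S(1)])
    also have "\<dots> \<le> (\<Sum>i. 2 / c * \<bar>\<tau> 2 (Suc i)\<bar>)"
      by (intro suminf_le le S summable_mult)
    also have "\<dots> = 2 / c * (\<Sum>i. \<bar>\<tau> 2 (Suc i)\<bar>)" by (intro suminf_mult S)
    also have "\<dots> \<le> 2 / c * T"
      unfolding T_def using c suminf_split_head[OF summable_gauss_term[of 2]]
      by (intro mult_left_mono) auto
    finally show ?thesis .
  qed
  have "(\<lambda>n. 2 / (2 + real n) * T) \<longlonglongrightarrow> 0"
    by real_asymp
  then have "(\<lambda>n. suminf (\<tau> (2 + real n)) - 1) \<longlonglongrightarrow> 0"
  proof (rule Lim_null_comparison[rotated], intro always_eventually allI)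
    fix n show "norm (suminf (\<tau> (2 + real n)) - 1) \<le> 2 / (2 + real n) * T"
      using bd[of "2 + real n"] by (simp del: times_divide_eq_left)
  qed
  then show ?thesis by (simp add: LIM_zero_iff)
qed

lemma rGamma_series_powr:
  "n > 0 \<Longrightarrow> rGamma_series z n = pochhammer z (n + 1) / (fact n * real n powr z)"
  by (simp add: rGamma_series_def powr_def)

text \<open>Iterating \<open>gauss_step\<close> pushes c to infinity, where the series tends to 1.
  What remains is a quotient of Pochhammer symbols, hence of \<open>rGamma_series\<close>; the
  powers of n cancel because (2 + s) + (3 + s) = 2 + (3 + 2 * s).\<close>

theorem gauss_sum: "suminf (\<tau> 2) = Gamma (3 + 2 * s) / (Gamma (2 + s) * Gamma (3 + s))"
proof -
  have P: "suminf (\<tau> 2) = pochhammer (2 + s) n * pochhammer (3 + s) n / (pochhammer 2 n * pochhammer (3 + 2 * s) n)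
      * suminf (\<tau> (2 + real n))" for n
  proof (induction n)
    case (Suc n)
    have p: "pochhammer 2 n > (0::real)" "pochhammer (3 + 2 * s) n > 0"
      using s by (auto intro!: pochhammer_pos)
    have q: "2 + real n > 0" "3 + 2 * s + real n > 0" using s by auto
    have st: "suminf (\<tau> (2 + real n)) = (2 + real n + s) * (3 + real n + s) / ((2 + real n) * (3 + real n + 2 * s)) * suminf (\<tau> (2 + real (Suc n)))"
    proof -
      have e: "((2 + real n) * (3 + real n + 2 * s)) * suminf (\<tau> (2 + real n))
        = (2 + real n + s) * (3 + real n + s) * suminf (\<tau> (2 + real (Suc n)))"
        using gauss_step[of "2 + real n"] by (simp add: add_ac)
      have "(2 + real n) * (3 + real n + 2 * s) \<noteq> 0" using q by simp
      then have "suminf (\<tau> (2 + real n)) = ((2 + real n) * (3 + real n + 2 * s)) * suminf (\<tau> (2 + real n)) / ((2 + real n) * (3 + real n + 2 * s))"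
        by (rule nonzero_mult_div_cancel_left[symmetric])
      then show ?thesis unfolding e times_divide_eq_left .
    qed
    show ?case
      by (subst Suc, subst st) (simp add: pochhammer_Suc ac_simps)
  qed simp
  have S: "suminf (\<tau> 2) = rGamma_series (2 + s) n * rGamma_series (3 + s) n / (rGamma_series 2 n * rGamma_series (3 + 2 * s) n)
      * suminf (\<tau> (2 + real (n + 1)))" if "n > 0" for n
  proof -
    have n: "real n > 0" using that by simp
    have p: "pochhammer 2 (n + 1) > (0::real)" "pochhammer (3 + 2 * s) (n + 1) > 0"
      using s by (auto intro!: pochhammer_pos)
    have e: "real n powr (2 + s) * real n powr (3 + s) = real n powr 2 * real n powr (3 + 2 * s)"
      unfolding powr_add[symmetric] by (rule arg_cong[where f = "\<lambda>z. real n powr z"]) simp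
    have quot: "(A / (f * x)) * (B / (f * y)) / ((C / (f * z)) * (D / (f * w))) = A * B / (C * D)"
      if "f \<noteq> 0" "x * y = z * w" "x * y \<noteq> 0" "C \<noteq> 0" "D \<noteq> 0" for A B C D f x y z w :: real
    proof -
      have "(A / (f * x)) * (B / (f * y)) / ((C / (f * z)) * (D / (f * w))) = (A * B * (z * w)) / (C * D * (x * y))"
        using that by (simp add: field_simps)
      then show ?thesis using that by simp
    qed
    have E: "rGamma_series (2 + s) n * rGamma_series (3 + s) n / (rGamma_series 2 n * rGamma_series (3 + 2 * s) n)
        = pochhammer (2 + s) (n + 1) * pochhammer (3 + s) (n + 1) / (pochhammer 2 (n + 1) * pochhammer (3 + 2 * s) (n + 1))"
      unfolding rGamma_series_powr[OF that]
    proof (rule quot[OF fact_nonzero e])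
      show "real n powr (2 + s) * real n powr (3 + s) \<noteq> 0" using n by simp
    qed (rule p[THEN less_imp_neq[THEN not_sym]])+
    show ?thesis unfolding E by (rule P)
  qed
  have ev: "\<forall>\<^sub>F n in sequentially. rGamma_series (2 + s) n * rGamma_series (3 + s) n / (rGamma_series 2 n * rGamma_series (3 + 2 * s) n)
      * suminf (\<tau> (2 + real (n + 1))) = suminf (\<tau> 2)"
    by (rule eventually_mono[OF eventually_gt_at_top[of 0]]) (rule S[symmetric])
  have "(\<lambda>n. rGamma_series (2 + s) n * rGamma_series (3 + s) n / (rGamma_series 2 n * rGamma_series (3 + 2 * s) n)
      * suminf (\<tau> (2 + real (n + 1)))) \<longlonglongrightarrow> rGamma (2 + s) * rGamma (3 + s) / (rGamma 2 * rGamma (3 + 2 * s)) * 1"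
    using s by (intro tendsto_intros LIMSEQ_ignore_initial_segment[OF gauss_limit])
       (auto simp: rGamma_eq_zero_iff nonpos_Ints_def)
  then have "(\<lambda>n. suminf (\<tau> 2)) \<longlonglongrightarrow> rGamma (2 + s) * rGamma (3 + s) / (rGamma 2 * rGamma (3 + 2 * s)) * 1"
    using ev by (rule Lim_transform_eventually)
  then have "suminf (\<tau> 2) = rGamma (2 + s) * rGamma (3 + s) / (rGamma 2 * rGamma (3 + 2 * s))"
    using LIMSEQ_unique[OF tendsto_const] by (metis mult.right_neutral)
  also have "rGamma 2 = (1::real)" using Gamma_fact[of 1, where 'a = real] by (simp add: rGamma_inverse_Gamma)
  finally show ?thesis by (simp add: rGamma_inverse_Gamma field_simps)
qed

end

section \<open>The alternating sum behind the total integral\<close>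

lemma pochhammer_minus_of_nat:
  "pochhammer (- real n) i = fact i * ((- 1) ^ i * real (n choose i))"
proof -
  have "real (n choose i) = (- 1) ^ i * pochhammer (- real n) i / fact i"
    by (simp add: binomial_gbinomial gbinomial_pochhammer)
  then show ?thesis by (simp add: mult.assoc[symmetric] power_mult_distrib[symmetric])
qed

text \<open>For s = \<open>beta_star\<close> this is the integral over [0, 1] of the k-th crossing
  polynomial (\<open>dprim_1\<close>). Consecutive values have the ratio (s - k) * (s + 3 + k) / ((k
  + 1) * (k + 2)).\<close>

definition av_coeff :: "real \<Rightarrow> nat \<Rightarrow> real" where
  "av_coeff s k = (- 1) ^ k * pochhammer (- s) k * pochhammer (s + 3) k / (fact k * pochhammer 2 k)"

text \<open>Two applications of the Chu--Vandermonde identity turn the alternating sum into a convolution.\<close>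

lemma binomial_sum_av_coeff:
  "(\<Sum>k\<le>n. real (n choose k) * av_coeff s k)
    = (\<Sum>i\<le>n. gauss_term (- s) (- 1 - s) 2 i * (pochhammer (1 + s) (n - i) / fact (n - i)))"
proof -
  define w where "w k = (- 1) ^ k * pochhammer (- s) k / fact k" for k
  define v where "v i = (- 1) ^ i * pochhammer (- 1 - s) i / pochhammer 2 i" for i
  \<comment> \<open>First use of Chu--Vandermonde: pochhammer (s + 3) k / pochhammer 2 k becomes a
    binomial sum over i, so that the sum over k can be carried out after an exchange of
    summations.\<close>
  have av: "av_coeff s k = w k * (\<Sum>i\<le>k. real (k choose i) * v i)" for k
  proof -
    have "(\<Sum>i\<le>k. real (k choose i) * v i)
        = (\<Sum>i=0..k. pochhammer (- 1 - s) i * pochhammer (- real k) i / (fact i * pochhammer 2 i))"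
      unfolding v_def atMost_atLeast0
      by (intro sum.cong refl) (simp add: pochhammer_minus_of_nat)
    also have "\<dots> = pochhammer (2 - (- 1 - s)) k / pochhammer 2 k"
      using Vandermonde_pochhammer[of k "2::real" "- 1 - s"] by simp
    also have "2 - (- 1 - s) = s + 3" by simp
    finally show ?thesis by (simp add: av_coeff_def w_def)
  qed
  \<comment> \<open>Second use, after the shift k = i + l: the alternating sum over k collapses to a
    single quotient, and the cancellation between large terms is gone.\<close>
  have inner: "(\<Sum>k\<in>{i..n}. real (n choose k) * real (k choose i) * w k)
      = real (n choose i) * w i * (pochhammer (1 + s) (n - i) / pochhammer (real i + 1) (n - i))" if "i \<le> n" for i
  proof -
    have "(\<Sum>k\<in>{i..n}. real (n choose k) * real (k choose i) * w k)
        = (\<Sum>l=0..n-i. real (n choose (i + l)) * real ((i + l) choose i) * w (i + l))"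
      by (rule sum.reindex_bij_witness[of _ "\<lambda>l. i + l" "\<lambda>k. k - i"]) (use that in auto)
    also have "\<dots> = (\<Sum>l=0..n-i. real (n choose i) * w i *
        (pochhammer (real i - s) l * pochhammer (- real (n - i)) l / (fact l * pochhammer (real i + 1) l)))"
    proof (intro sum.cong refl)
      fix l assume l: "l \<in> {0..n - i}"
      have "real (n choose (i + l)) * real ((i + l) choose i) = real (n choose i) * real ((n - i) choose l)"
        using choose_mult[of i "i + l" n] l that
        by (metis add_diff_cancel_left' atLeastAtMost_iff le_add1 le_diff_conv2 add.commute of_nat_mult)
      moreover have "fact (i + l) = fact i * pochhammer (real i + 1) l"
        using pochhammer_product'[of "1::real" i l] by (simp add: pochhammer_fact add.commute)
      moreover have "pochhammer (- s) (i + l) = pochhammer (- s) i * pochhammer (real i - s) l"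
        using pochhammer_product'[of "- s" i l] by simp
      ultimately show "real (n choose (i + l)) * real ((i + l) choose i) * w (i + l) =
         real (n choose i) * w i * (pochhammer (real i - s) l * pochhammer (- real (n - i)) l / (fact l * pochhammer (real i + 1) l))"
        unfolding w_def pochhammer_minus_of_nat by (simp add: power_add mult_ac)
    qed
    also have "\<dots> = real (n choose i) * w i * (pochhammer (real i + 1 - (real i - s)) (n - i) / pochhammer (real i + 1) (n - i))"
      unfolding sum_distrib_left[symmetric]
      by (subst Vandermonde_pochhammer[symmetric]) (auto simp: eq_neg_iff_add_eq_0 add_eq_0_iff)
    finally show ?thesis by (simp add: add.commute)
  qed
  have "(\<Sum>k\<le>n. real (n choose k) * av_coeff s k)
      = (\<Sum>k\<le>n. \<Sum>i\<le>k. v i * (real (n choose k) * real (k choose i) * w k))"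
    unfolding av sum_distrib_left by (simp add: mult_ac)
  also have "\<dots> = (\<Sum>i\<le>n. \<Sum>k\<in>{i..n}. v i * (real (n choose k) * real (k choose i) * w k))"
  proof -
    have "(\<Sum>k\<le>n. \<Sum>i\<le>k. v i * (real (n choose k) * real (k choose i) * w k))
        = (\<Sum>k\<le>n. \<Sum>i\<le>n. v i * (real (n choose k) * real (k choose i) * w k))"
      by (intro sum.cong refl sum.mono_neutral_left) (auto simp: binomial_eq_0)
    also have "\<dots> = (\<Sum>i\<le>n. \<Sum>k\<le>n. v i * (real (n choose k) * real (k choose i) * w k))"
      by (rule sum.swap)
    also have "\<dots> = (\<Sum>i\<le>n. \<Sum>k\<in>{i..n}. v i * (real (n choose k) * real (k choose i) * w k))"
      by (intro sum.cong refl sum.mono_neutral_right) (auto simp: binomial_eq_0)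
    finally show ?thesis .
  qed
  also have "\<dots> = (\<Sum>i\<le>n. v i * (real (n choose i) * w i * (pochhammer (1 + s) (n - i) / pochhammer (real i + 1) (n - i))))"
    unfolding sum_distrib_left[symmetric] by (intro sum.cong refl arg_cong2[where f = "(*)"] inner) auto
  also have "\<dots> = (\<Sum>i\<le>n. gauss_term (- s) (- 1 - s) 2 i * (pochhammer (1 + s) (n - i) / fact (n - i)))"
  proof (intro sum.cong refl)
    fix i assume "i \<in> {..n}"
    then have i: "i \<le> n" by simp
    have f: "fact i * pochhammer (real i + 1) (n - i) = (fact n :: real)"
      using pochhammer_product[of i n "1::real"] i by (simp add: pochhammer_fact add.commute)
    have p: "pochhammer (real i + 1) (n - i) > 0" by (intro pochhammer_pos) auto
    have c: "real (n choose i) = fact n / (fact i * fact (n - i))"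
      using i by (rule binomial_fact)
    have c': "real (n choose i) = pochhammer (real i + 1) (n - i) / fact (n - i)"
      unfolding c f[symmetric] by simp
    have sg: "(- 1) ^ i * ((- 1) ^ i * z) = (z::real)" for z
      by (simp add: mult.assoc[symmetric] power_mult_distrib[symmetric])
    show "v i * (real (n choose i) * w i * (pochhammer (1 + s) (n - i) / pochhammer (real i + 1) (n - i)))
        = gauss_term (- s) (- 1 - s) 2 i * (pochhammer (1 + s) (n - i) / fact (n - i))"
      unfolding c' v_def w_def gauss_term_def using p by (simp add: mult_ac sg)
  qed
  finally show ?thesis .
qed

lemma pochhammer_fact_asymp:
  fixes s :: real
  assumes "s > 0"
  shows "(\<lambda>n. pochhammer (1 + s) n / fact n / real n powr s) \<longlonglongrightarrow> 1 / Gamma (s + 1)"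
proof -
  have "(\<lambda>n. rGamma_series s n / s) \<longlonglongrightarrow> rGamma s / s"
    using assms by (intro tendsto_intros) auto
  also have "rGamma s / s = 1 / Gamma (s + 1)"
  proof -
    have "Gamma (s + 1) = s * Gamma s" using assms by (intro Gamma_plus1) (auto simp: nonpos_Ints_def)
    then show ?thesis by (simp add: rGamma_inverse_Gamma inverse_eq_divide)
  qed
  finally show ?thesis
  proof (rule Lim_transform_eventually)
    show "\<forall>\<^sub>F n in sequentially. rGamma_series s n / s = pochhammer (1 + s) n / fact n / real n powr s"
      using eventually_gt_at_top[of 0]
    proof eventually_elim
      case (elim n)
      then show ?case using assms
        by (simp add: rGamma_series_def powr_def pochhammer_rec add.commute[of s 1])
    qed
  qed
qed

text \<open>A fixed shift i does not affect the growth of g, and as g increases, all shifted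
  quotients are bounded by one constant. Tannery's theorem exchanges limit and sum, and
  \<open>gauss_sum\<close> evaluates the resulting series.\<close>

theorem binomial_sum_av_coeff_asymp:
  fixes s :: real
  assumes s: "0 < s" "s < 1"
  shows "(\<lambda>n. (\<Sum>k\<le>n. real (n choose k) * av_coeff s k) / real n powr s)
    \<longlonglongrightarrow> Gamma (3 + 2 * s) / (Gamma (s + 1) * Gamma (2 + s) * Gamma (3 + s))"
proof -
  define r where "r = gauss_term (- s) (- 1 - s) 2"
  define g where "g n = pochhammer (1 + s) n / fact n" for n
  have g0: "g n > 0" for n unfolding g_def using s by (intro divide_pos_pos pochhammer_pos) auto
  have gS: "g n \<le> g (Suc n)" for n
  proof -
    have "g (Suc n) = g n * ((1 + s + n) / Suc n)" unfolding g_def by (simp add: pochhammer_Suc)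
    moreover have "1 \<le> (1 + s + n) / Suc n" using s by simp
    ultimately show ?thesis using g0[of n] by (metis mult_left_mono mult.right_neutral less_imp_le)
  qed
  have gmono: "g m \<le> g n" if "m \<le> n" for m n by (rule lift_Suc_mono_le[of g, OF gS that])
  have glim: "(\<lambda>n. g n / real n powr s) \<longlonglongrightarrow> 1 / Gamma (s + 1)"
    unfolding g_def by (rule pochhammer_fact_asymp) (use s in auto)
  then have "Bseq (\<lambda>n. g n / real n powr s)" by (intro convergent_imp_Bseq convergentI)
  then obtain B where B: "\<And>n. norm (g n / real n powr s) \<le> B" unfolding Bseq_def by blast
  define a where "a i n = (if i \<le> n then r i * (g (n - i) / real n powr s) else 0)" for i n
  have lim: "(\<lambda>n. a i n) \<longlonglongrightarrow> r i * (1 / Gamma (s + 1))" for i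
  proof -
    have "(\<lambda>n. r i * (g n / real n powr s * ((real n / real (n + i)) powr s))) \<longlonglongrightarrow> r i * (1 / Gamma (s + 1))"
    proof -
      have "(\<lambda>n. real n / real (n + i)) \<longlonglongrightarrow> 1" by real_asymp
      then have "(\<lambda>n. r i * (g n / real n powr s * ((real n / real (n + i)) powr s))) \<longlonglongrightarrow> r i * (1 / Gamma (s + 1) * 1 powr s)"
        by (intro tendsto_mult tendsto_const glim tendsto_powr) auto
      then show ?thesis by simp
    qed
    then have "(\<lambda>n. a i (n + i)) \<longlonglongrightarrow> r i * (1 / Gamma (s + 1))"
    proof (rule Lim_transform_eventually)
      show "\<forall>\<^sub>F n in sequentially. r i * (g n / real n powr s * ((real n / real (n + i)) powr s)) = a i (n + i)"
        using eventually_gt_at_top[of 0] by eventually_elim (simp add: a_def powr_divide)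
    qed
    then show ?thesis by (rule LIMSEQ_offset)
  qed
  have B0: "B \<ge> 0" using B[of 0] by simp
  have bnd: "norm (a i n) \<le> \<bar>r i\<bar> * B" for i n
  proof (cases "i \<le> n")
    case True
    have "g (n - i) / real n powr s \<le> g n / real n powr s" by (intro divide_right_mono gmono) auto
    also have "\<dots> \<le> B" using B[of n] g0[of n] by simp
    finally have "\<bar>g (n - i) / real n powr s\<bar> \<le> B" using g0[of "n - i"] by simp
    then have "\<bar>r i\<bar> * \<bar>g (n - i) / real n powr s\<bar> \<le> \<bar>r i\<bar> * B" by (intro mult_left_mono) auto
    moreover have "norm (a i n) = \<bar>r i\<bar> * \<bar>g (n - i) / real n powr s\<bar>"
      using True unfolding a_def by (simp add: abs_mult)
    ultimately show ?thesis by simp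
  qed (use B0 in \<open>simp add: a_def\<close>)
  have "(\<lambda>n. suminf (\<lambda>i. a i n)) \<longlonglongrightarrow> suminf (\<lambda>i. r i * (1 / Gamma (s + 1)))"
    using tannerys_theorem[of a "\<lambda>i. r i * (1 / Gamma (s + 1))" sequentially "\<lambda>i. \<bar>r i\<bar> * B", OF lim]
      summable_mult2[OF summable_gauss_term[OF s, of 2], of B] bnd
    unfolding r_def by (auto intro!: always_eventually)
  moreover have "suminf (\<lambda>i. a i n) = (\<Sum>k\<le>n. real (n choose k) * av_coeff s k) / real n powr s" for n
  proof -
    have "suminf (\<lambda>i. a i n) = (\<Sum>i\<le>n. a i n)" by (rule suminf_finite) (auto simp: a_def)
    then show ?thesis
      unfolding binomial_sum_av_coeff sum_divide_distrib by (simp add: a_def r_def g_def)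
  qed
  moreover have "suminf (\<lambda>i. r i * (1 / Gamma (s + 1))) = Gamma (3 + 2 * s) / (Gamma (s + 1) * Gamma (2 + s) * Gamma (3 + s))"
    using gauss_sum[OF s] summable_rabs_cancel[OF summable_gauss_term[OF s, of 2]]
    unfolding r_def by (subst suminf_mult2[symmetric]) auto
  ultimately show ?thesis by simp
qed

section \<open>Expected number of crossings\<close>

text \<open>
  If \<open>q\<close> has degree at most \<open>k\<close>, then \<open>scaling_poly k q x = \<integral>\<^sub>x\<^sup>1 t\<^sup>k q (x / t) dt\<close>, by integration of
  monomials.
\<close>

definition scaling_poly :: "nat \<Rightarrow> real poly \<Rightarrow> real poly" where
  "scaling_poly k q = (\<Sum>j\<le>k. smult (coeff q j / real (k + 1 - j)) (monom 1 j - monom 1 (k + 1)))"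

text \<open>By Pascal's rule, raising n by one in a binomial sum replaces the coefficient c k by c k
  + c (Suc k); the subtraction solves for the new coefficient. Composition with [:1, -1:] accounts
  for the pieces on the other side of the cut.\<close>

fun crossed_poly :: "nat \<Rightarrow> real poly" where
  "crossed_poly 0 = 1"
| "crossed_poly (Suc k) = smult (2 / real (k + 1))
     (scaling_poly k (crossed_poly k) + pcompose (scaling_poly k (crossed_poly k)) [:1, -1:]) - crossed_poly k"

lemma poly_scaling_poly:
  "poly (scaling_poly k q) x = (\<Sum>j\<le>k. coeff q j / real (k + 1 - j) * (x ^ j - x ^ (k + 1)))"
  unfolding scaling_poly_def by (simp add: poly_sum poly_monom)

lemma degree_scaling_poly: "degree (scaling_poly k q) \<le> k + 1"
  unfolding scaling_poly_def
  by (intro degree_sum_le order.trans[OF degree_smult_le] degree_diff_le)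
     (auto intro: order.trans[OF degree_monom_le])

lemma degree_crossed_poly: "degree (crossed_poly k) \<le> k"
proof (induction k)
  case (Suc k)
  have "degree (pcompose (scaling_poly k (crossed_poly k)) [:1, -1:]) \<le> Suc k"
    using degree_scaling_poly[of k "crossed_poly k"] by (simp add: degree_pcompose)
  then show ?case using Suc degree_scaling_poly[of k "crossed_poly k"]
    by (auto intro!: degree_diff_le order.trans[OF degree_smult_le] degree_add_le)
qed simp

lemma poly_crossed_poly_Suc:
  "poly (crossed_poly (Suc k)) y = 2 / real (k + 1) *
     (poly (scaling_poly k (crossed_poly k)) y + poly (scaling_poly k (crossed_poly k)) (1 - y)) - poly (crossed_poly k) y"
  by (simp add: poly_pcompose)

lemma poly_crossed_poly_reflect: "poly (crossed_poly k) (1 - x) = poly (crossed_poly k) x"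
  by (induction k arbitrary: x) (auto simp: poly_pcompose)

lemma poly_eq_sum_atMost:
  fixes q :: "real poly"
  assumes "degree q \<le> k"
  shows "poly q x = (\<Sum>j\<le>k. coeff q j * x ^ j)"
proof -
  have "poly q x = (\<Sum>j\<le>degree q. coeff q j * x ^ j)" by (rule poly_altdef)
  also have "\<dots> = (\<Sum>j\<le>k. coeff q j * x ^ j)"
    by (rule sum.mono_neutral_left) (use assms in \<open>auto simp: coeff_eq_0\<close>)
  finally show ?thesis .
qed

text \<open>Here u is the abscissa of the cut, and the left piece [a, u] is crossed when x <= u.
  Homogeneity of degree k + 1 lets one polynomial in the relative position serve all
  rectangles.\<close>

lemma has_bochner_integral_scaling_poly:
  assumes q: "degree q \<le> k" and x: "a \<le> x" "x \<le> b" "a < b"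
  shows "has_bochner_integral lborel
    (\<lambda>u. (u - a) ^ k * poly q ((x - a) / (u - a)) * indicator {x..b} u)
    ((b - a) ^ (k + 1) * poly (scaling_poly k q) ((x - a) / (b - a)))"
proof -
  define f where "f u = (\<Sum>j\<le>k. coeff q j * (x - a) ^ j * (u - a) ^ (k - j))" for u
  define F where "F u = (\<Sum>j\<le>k. coeff q j * (x - a) ^ j * ((u - a) ^ (k + 1 - j) / real (k + 1 - j)))" for u
  have "has_bochner_integral lborel (\<lambda>u. f u * indicator {x..b} u) (F b - F x)"
  proof (rule has_bochner_integral_FTC_Icc_real)
    fix u :: real
    show "(F has_real_derivative f u) (at u)"
      unfolding F_def f_def
    proof (intro DERIV_sum DERIV_cmult)
      fix j assume "j \<in> {..k}"
      then have k: "k + 1 - j = Suc (k - j)" by auto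
      have "((\<lambda>u. (u - a) ^ Suc (k - j) / real (Suc (k - j))) has_real_derivative
          (real (Suc (k - j)) * (1 * (u - a) ^ (Suc (k - j) - Suc 0))) / real (Suc (k - j))) (at u)"
        using DERIV_power[of "\<lambda>u. u - a" 1 u UNIV "Suc (k - j)"]
        by (intro DERIV_cdivide) (auto intro!: derivative_eq_intros simp del: of_nat_Suc power_Suc)
      then show "((\<lambda>u. (u - a) ^ (k + 1 - j) / real (k + 1 - j)) has_real_derivative (u - a) ^ (k - j)) (at u)"
        unfolding k by simp
    qed
    show "isCont f u" unfolding f_def by (intro continuous_intros)
  qed (use x in auto)
  moreover have "f u * indicator {x..b} u = (u - a) ^ k * poly q ((x - a) / (u - a)) * indicator {x..b} u" for u
  proof (cases "u \<in> {x..b}")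
    case True
    have "(u - a) ^ k * ((x - a) / (u - a)) ^ j = (x - a) ^ j * (u - a) ^ (k - j)" if "j \<le> k" for j
    \<comment> \<open>If u = a then also x = a, and both sides agree because 0 / 0 = 0 and 0 ^ 0 =
      1.\<close>
    proof (cases "u = a")
      case eq: True
      then have "x = a" using True x by auto
      then show ?thesis using eq that by (cases "k = 0") (auto simp: power_add[symmetric] zero_power)
    next
      case False
      have "(u - a) ^ k = (u - a) ^ j * (u - a) ^ (k - j)" using that by (simp add: power_add[symmetric])
      then show ?thesis using False by (simp add: power_divide)
    qed
    then have "(u - a) ^ k * poly q ((x - a) / (u - a)) = f u"
      unfolding f_def poly_eq_sum_atMost[OF q] sum_distrib_left
      by (intro sum.cong refl) (simp add: mult_ac)
    then show ?thesis by simp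
  qed auto
  moreover have "F b - F x = (b - a) ^ (k + 1) * poly (scaling_poly k q) ((x - a) / (b - a))"
  proof -
    have "(x - a) ^ j * ((b - a) ^ (k + 1 - j) - (x - a) ^ (k + 1 - j))
      = (b - a) ^ (k + 1) * (((x - a) / (b - a)) ^ j - ((x - a) / (b - a)) ^ (k + 1))" if "j \<le> k" for j
    proof -
      have e: "z ^ (k + 1) = z ^ j * z ^ (k + 1 - j)" for z :: real using that by (simp only: power_add[symmetric]) simp
      have "(b - a) ^ (k + 1) * ((x - a) / (b - a)) ^ (k + 1) = (x - a) ^ (k + 1)"
        using x by (simp add: power_divide)
      moreover have "(b - a) ^ (k + 1) * ((x - a) / (b - a)) ^ j = (x - a) ^ j * (b - a) ^ (k + 1 - j)"
        unfolding e[of "b - a"] using x by (simp add: power_divide)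
      ultimately show ?thesis using e[of "x - a"] by (simp add: algebra_simps)
    qed
    then show ?thesis
      unfolding F_def poly_scaling_poly sum_subtractf[symmetric] sum_distrib_left
      by (intro sum.cong refl) (simp add: diff_divide_distrib[symmetric] right_diff_distrib[symmetric] mult_ac)
  qed
  ultimately show ?thesis by simp
qed

text \<open>The right piece [u, b] is the mirror image of a left piece under u to -u. The symmetry
  of q turns the distance from b back into the position relative to u.\<close>

lemma has_bochner_integral_scaling_poly_reflect:
  assumes k: "degree q \<le> k" and sym: "\<And>z. poly q (1 - z) = poly q z" and x: "a \<le> x" "x \<le> b" "a < b"
  shows "has_bochner_integral lborel
    (\<lambda>u. (b - u) ^ k * poly q ((x - u) / (b - u)) * indicator {a..x} u)
    ((b - a) ^ (k + 1) * poly (scaling_poly k q) (1 - (x - a) / (b - a)))"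
proof -
  have "has_bochner_integral lborel
    (\<lambda>u. (u + b) ^ k * poly q ((b - x) / (u + b)) * indicator {-x..-a} u)
    ((b - a) ^ (k + 1) * poly (scaling_poly k q) ((b - x) / (b - a)))"
    using has_bochner_integral_scaling_poly[OF k, of "-b" "-x" "-a"] x by (simp add: algebra_simps)
  then have "has_bochner_integral lborel
    (\<lambda>u. (b - u) ^ k * poly q ((b - x) / (b - u)) * indicator {-x..-a} (- u))
    ((b - a) ^ (k + 1) * poly (scaling_poly k q) ((b - x) / (b - a)))"
    by (subst (asm) lborel_has_bochner_integral_real_affine_iff[of "-1" _ _ 0]) (auto simp: add.commute)
  moreover have "(b - u) ^ k * poly q ((b - x) / (b - u)) * indicator {-x..-a} (- u)
    = (b - u) ^ k * poly q ((x - u) / (b - u)) * indicator {a..x} u" for u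
  proof (cases "u = b")
    case True
    then show ?thesis using x by (auto simp: indicator_def)
  next
    case False
    then have "(b - x) / (b - u) = 1 - (x - u) / (b - u)" by (simp add: field_simps)
    then show ?thesis using sym by (auto simp: indicator_def)
  qed
  moreover have "(b - x) / (b - a) = 1 - (x - a) / (b - a)" using x by (simp add: field_simps)
  ultimately show ?thesis by simp
qed

lemma scaling_poly_1: "poly (scaling_poly k q) 1 = 0"
  by (simp add: poly_scaling_poly)

lemma scaling_poly_0: "poly (scaling_poly k q) 0 = poly q 0 / real (k + 1)"
proof -
  have "poly (scaling_poly k q) 0 = (\<Sum>j\<in>{0}. coeff q j / real (k + 1 - j) * (0 ^ j - 0 ^ (k + 1)))"
    unfolding poly_scaling_poly by (rule sum.mono_neutral_right) auto
  then show ?thesis by (simp add: poly_0_coeff_0)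
qed

text \<open>Checked on monomials. The scaling lemmas know h and f only through this equation and the
  value of h at 1, so they become applicable to the crossing polynomials.\<close>

lemma has_real_derivative_scaling_poly:
  assumes q: "degree q \<le> k" and z: "z \<noteq> 0"
  shows "(poly (scaling_poly k q) has_real_derivative
    (((real k + 1) * poly (scaling_poly k q) z - poly q z) / z)) (at z)"
proof -
  have "(poly (scaling_poly k q) has_real_derivative
      (\<Sum>j\<le>k. coeff q j / real (k + 1 - j) * (real j * z ^ (j - Suc 0) - real (k + 1) * z ^ (k + 1 - Suc 0)))) (at z)"
    unfolding poly_scaling_poly[abs_def]
    by (intro DERIV_sum DERIV_cmult DERIV_diff DERIV_pow)
  moreover have "(\<Sum>j\<le>k. coeff q j / real (k + 1 - j) * (real j * z ^ (j - Suc 0) - real (k + 1) * z ^ (k + 1 - Suc 0)))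
    = ((real k + 1) * poly (scaling_poly k q) z - poly q z) / z"
    unfolding poly_scaling_poly poly_eq_sum_atMost[OF q] sum_distrib_left sum_subtractf[symmetric] sum_divide_distrib
  proof (intro sum.cong refl)
    fix j assume "j \<in> {..k}"
    then have j: "real (k + 1 - j) = real k + 1 - real j" "real k + 1 - real j > 0" by auto
    have 1: "real j * z ^ (j - Suc 0) = real j * z ^ j / z" using z by (cases j) auto
    have 2: "real (k + 1) * z ^ (k + 1 - Suc 0) = (real k + 1) * z ^ (k + 1) / z" using z by simp
    have "coeff q j / (real k + 1 - real j) * (real j * z ^ j / z - (real k + 1) * z ^ (k + 1) / z)
      = (coeff q j / (real k + 1 - real j)) * ((real k + 1) * (z ^ j - z ^ (k + 1)) - (real k + 1 - real j) * z ^ j) / z"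
      using z by (simp add: field_simps)
    also have "\<dots> = ((real k + 1) * (coeff q j / (real k + 1 - real j) * (z ^ j - z ^ (k + 1))) - coeff q j * z ^ j) / z"
    proof -
      have "c / r * (K * P - r * w) = K * (c / r * P) - c * w" if "r > 0" for c r K P w :: real
        using that by (simp add: field_simps)
      then show ?thesis using j(2) by simp
    qed
    finally show "coeff q j / real (k + 1 - j) * (real j * z ^ (j - Suc 0) - real (k + 1) * z ^ (k + 1 - Suc 0))
      = ((real k + 1) * (coeff q j / real (k + 1 - j) * (z ^ j - z ^ (k + 1))) - coeff q j * z ^ j) / z"
      unfolding 1 2 j(1) .
  qed
  ultimately show ?thesis by simp
qed

text \<open>
  Counts the crossed rectangles that arise from \<open>R\<close> by inserting \<open>p (m + 1), \<dots>, p (m + n)\<close>.  In contrast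
  to \<open>Quad\<close>, the recursion peels off the point inserted first, so that the remaining points are
  independent of the rectangles in which they are placed.
\<close>

fun descendants_crossed :: "real \<Rightarrow> nat \<Rightarrow> nat \<Rightarrow> (real \<times> real) set \<Rightarrow> (nat \<Rightarrow> real \<times> real) \<Rightarrow> real" where
  "descendants_crossed x 0 m R p = (if R \<inter> vsegment x \<noteq> {} then 1 else 0)"
| "descendants_crossed x (Suc n) m R p =
     (if p (Suc m) \<in> interior R
      then \<Sum>R'\<in>quadrants (p (Suc m)) R. descendants_crossed x n (Suc m) R' p
      else descendants_crossed x n (Suc m) R p)"

text \<open>Describing a piece by its sides instead of as a set makes the count a piecewise function
  of real coordinates, which is accessible to measurability and integration.\<close>

fun rect_crossed :: "real \<Rightarrow> nat \<Rightarrow> nat \<Rightarrow> real \<Rightarrow> real \<Rightarrow> real \<Rightarrow> real \<Rightarrow> (nat \<Rightarrow> real \<times> real) \<Rightarrow> real" where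
  "rect_crossed x 0 m a b c d p = (if a \<le> x \<and> x \<le> b then 1 else 0)"
| "rect_crossed x (Suc n) m a b c d p =
     (if a < fst (p (Suc m)) \<and> fst (p (Suc m)) < b \<and> c < snd (p (Suc m)) \<and> snd (p (Suc m)) < d
      then rect_crossed x n (Suc m) a (fst (p (Suc m))) c (snd (p (Suc m))) p
         + rect_crossed x n (Suc m) (fst (p (Suc m))) b c (snd (p (Suc m))) p
         + rect_crossed x n (Suc m) a (fst (p (Suc m))) (snd (p (Suc m))) d p
         + rect_crossed x n (Suc m) (fst (p (Suc m))) b (snd (p (Suc m))) d p
      else rect_crossed x n (Suc m) a b c d p)"

section \<open>Coverings as families of rectangles with disjoint interiors\<close>

lemma vsegment_eq: "vsegment x = {x} \<times> {0..1}"
proof -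
  have "z \<in> vsegment x \<longleftrightarrow> z \<in> {x} \<times> {0..1}" for z
    by (cases z) (auto simp: vsegment_def in_segment algebra_simps)
  then show ?thesis by blast
qed

lemma quadrants_rect:
  assumes "a < u" "u < b" "c < v" "v < d"
  shows "quadrants (u, v) ({a..b} \<times> {c..d}) = {{a..u} \<times> {c..v}, {u..b} \<times> {c..v}, {a..u} \<times> {v..d}, {u..b} \<times> {v..d}}"
proof -
  have "{a..b} \<times> {c..d} \<inter> {z. fst z \<le> u \<and> snd z \<le> v} = {a..u} \<times> {c..v}"
    "{a..b} \<times> {c..d} \<inter> {z. u \<le> fst z \<and> snd z \<le> v} = {u..b} \<times> {c..v}"
    "{a..b} \<times> {c..d} \<inter> {z. fst z \<le> u \<and> v \<le> snd z} = {a..u} \<times> {v..d}"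
    "{a..b} \<times> {c..d} \<inter> {z. u \<le> fst z \<and> v \<le> snd z} = {u..b} \<times> {v..d}"
    using assms by auto
  then show ?thesis unfolding quadrants_def by simp
qed

lemma rect_eq_iff:
  fixes a b c d :: real
  assumes "a < b" "c < d" "a' < b'" "c' < d'"
  shows "{a..b} \<times> {c..d} = {a'..b'} \<times> {c'..d'} \<longleftrightarrow> a = a' \<and> b = b' \<and> c = c' \<and> d = d'"
  using assms by (auto simp: times_eq_iff Icc_eq_Icc)

text \<open>For a nondegenerate rectangle the four quadrants are distinct sets, so the sum over the
  set \<open>quadrants\<close> really has four terms. The bounds on c and d reduce meeting the
  segment to a condition on x alone.\<close>

lemma descendants_crossed_rect:
  assumes "a < b" "c < d" "0 \<le> c" "d \<le> 1"
  shows "descendants_crossed x n m ({a..b} \<times> {c..d}) p = rect_crossed x n m a b c d p"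
  using assms
proof (induction n arbitrary: m a b c d)
  case 0
  have "({a..b} \<times> {c..d} \<inter> vsegment x \<noteq> {}) \<longleftrightarrow> a \<le> x \<and> x \<le> b"
  proof
    assume "a \<le> x \<and> x \<le> b"
    then have "(x, c) \<in> {a..b} \<times> {c..d} \<inter> vsegment x" using 0 by (auto simp: vsegment_eq)
    then show "{a..b} \<times> {c..d} \<inter> vsegment x \<noteq> {}" by blast
  qed (auto simp: vsegment_eq)
  then show ?case by simp
next
  case (Suc n)
  obtain u v where uv: "p (Suc m) = (u, v)" by (cases "p (Suc m)")
  have int: "interior ({a..b} \<times> {c..d}) = {a<..<b} \<times> {c<..<d}"
    by (simp add: interior_Times)
  show ?case
  proof (cases "a < u \<and> u < b \<and> c < v \<and> v < d")
    case True
    then have "a < u" "u < b" "c < v" "v < d" by auto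
    then show ?thesis using Suc.prems
      by (simp add: uv int quadrants_rect rect_eq_iff Suc.IH)
  next
    case False
    then show ?thesis using Suc by (auto simp: uv int)
  qed
qed

text \<open>The invariant that makes counting additive: interiors are nonempty and disjoint, so
  pieces of different rectangles can never coincide as sets.\<close>

definition rect_family :: "(real \<times> real) set set \<Rightarrow> bool" where
  "rect_family \<R> \<longleftrightarrow> finite \<R> \<and>
     (\<forall>R\<in>\<R>. \<exists>a b c d. a < b \<and> c < d \<and> R = {a..b} \<times> {c..d}) \<and>
     (\<forall>R\<in>\<R>. \<forall>R'\<in>\<R>. R \<noteq> R' \<longrightarrow> interior R \<inter> interior R' = {})"

lemma rect_family_quadrants:
  assumes R: "R = {a..b} \<times> {c..d}" and q: "q \<in> interior R"
  shows "rect_family (quadrants q R)" "\<And>R'. R' \<in> quadrants q R \<Longrightarrow> R' \<subseteq> R"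
proof -
  obtain u v where uv: "q = (u, v)" by (cases q)
  have q': "a < u" "u < b" "c < v" "v < d" using q by (auto simp: R uv interior_Times)
  show "R' \<subseteq> R" if "R' \<in> quadrants q R" for R'
    using that by (auto simp: quadrants_def)
  have disj: "{l<..<r} \<inter> {l'<..<r'} = {}" if "r \<le> l' \<or> r' \<le> l" for l r l' r' :: real
    using that by auto
  have T: "A \<times> B \<inter> A' \<times> B' = {}" if "A \<inter> A' = {} \<or> B \<inter> B' = {}" for A A' B B' :: "real set"
    using that by auto
  show "rect_family (quadrants q R)"
    unfolding rect_family_def
  proof (intro conjI ballI impI)
    show "finite (quadrants q R)" by (simp add: quadrants_def)
    show "\<exists>a b c d. a < b \<and> c < d \<and> R' = {a..b} \<times> {c..d}" if "R' \<in> quadrants q R" for R'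
      using that q' unfolding R uv quadrants_rect[OF q'] by blast
    show "interior R1 \<inter> interior R2 = {}" if "R1 \<in> quadrants q R" "R2 \<in> quadrants q R" "R1 \<noteq> R2" for R1 R2
      using that unfolding R uv quadrants_rect[OF q']
      by (elim insertE emptyE) (simp_all add: interior_Times T disj)
  qed
qed

lemma rect_interior_nonempty:
  assumes "rect_family \<R>" "R \<in> \<R>" shows "interior R \<noteq> {}"
proof -
  obtain a b c d where "a < b" "c < d" "R = {a..b} \<times> {c..d}" using assms by (auto simp: rect_family_def)
  then show ?thesis by (simp add: interior_Times)
qed

lemma rect_family_split:
  assumes "rect_family \<R>"
  shows "rect_family (\<Union>R\<in>\<R>. if q \<in> interior R then quadrants q R else {R})"
    and "(\<Sum>R\<in>(\<Union>R\<in>\<R>. if q \<in> interior R then quadrants q R else {R}). g R)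
       = (\<Sum>R\<in>\<R>. if q \<in> interior R then \<Sum>R'\<in>quadrants q R. g R' else (g R :: real))"
proof -
  define s where "s R = (if q \<in> interior R then quadrants q R else {R})" for R
  have fam: "rect_family (s R)" and sub: "\<And>R'. R' \<in> s R \<Longrightarrow> R' \<subseteq> R" if R: "R \<in> \<R>" for R
  proof -
    obtain a b c d where r: "a < b" "c < d" "R = {a..b} \<times> {c..d}" using assms R by (auto simp: rect_family_def)
    have "rect_family {R}" using r unfolding rect_family_def by auto
    then show "rect_family (s R)" "\<And>R'. R' \<in> s R \<Longrightarrow> R' \<subseteq> R"
      unfolding s_def using rect_family_quadrants[OF r(3)] by (auto split: if_splits)
  qed
  have fin: "finite \<R>" using assms by (simp add: rect_family_def)
  have disj: "interior R1' \<inter> interior R2' = {}"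
    if "R1 \<in> \<R>" "R2 \<in> \<R>" "R1 \<noteq> R2" "R1' \<in> s R1" "R2' \<in> s R2" for R1 R2 R1' R2'
  proof -
    have "interior R1 \<inter> interior R2 = {}" using that assms by (auto simp: rect_family_def)
    moreover have "interior R1' \<subseteq> interior R1" "interior R2' \<subseteq> interior R2"
      using that sub by (auto intro!: interior_mono)
    ultimately show ?thesis by blast
  qed
  have "rect_family (\<Union>R\<in>\<R>. s R)"
    unfolding rect_family_def
  proof (intro conjI ballI impI)
    show "finite (\<Union>R\<in>\<R>. s R)" using fin fam by (auto simp: rect_family_def)
    show "\<exists>a b c d. a < b \<and> c < d \<and> R' = {a..b} \<times> {c..d}" if "R' \<in> (\<Union>R\<in>\<R>. s R)" for R'
      using that fam unfolding rect_family_def by blast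
    show "interior R1' \<inter> interior R2' = {}"
      if h: "R1' \<in> (\<Union>R\<in>\<R>. s R)" "R2' \<in> (\<Union>R\<in>\<R>. s R)" "R1' \<noteq> R2'" for R1' R2'
    proof -
      obtain R1 R2 where r: "R1 \<in> \<R>" "R2 \<in> \<R>" "R1' \<in> s R1" "R2' \<in> s R2" using h by auto
      show ?thesis
      proof (cases "R1 = R2")
        case True
        then show ?thesis using fam[OF r(1)] r h unfolding rect_family_def by blast
      qed (use disj r in blast)
    qed
  qed
  then show "rect_family (\<Union>R\<in>\<R>. if q \<in> interior R then quadrants q R else {R})"
    unfolding s_def .
  have "(\<Sum>R\<in>(\<Union>R\<in>\<R>. s R). g R) = (\<Sum>R\<in>\<R>. \<Sum>R'\<in>s R. g R')"
  proof (rule sum.UNION_disjoint[OF fin])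
    show "\<forall>R\<in>\<R>. finite (s R)" using fam by (auto simp: rect_family_def)
    show "\<forall>R1\<in>\<R>. \<forall>R2\<in>\<R>. R1 \<noteq> R2 \<longrightarrow> s R1 \<inter> s R2 = {}"
    proof (intro ballI impI)
      fix R1 R2 assume h: "R1 \<in> \<R>" "R2 \<in> \<R>" "R1 \<noteq> R2"
      have False if "R' \<in> s R1" "R' \<in> s R2" for R'
        using disj[OF h that] rect_interior_nonempty[OF fam[OF h(1)] that(1)] by simp
      then show "s R1 \<inter> s R2 = {}" by blast
    qed
  qed
  also have "\<dots> = (\<Sum>R\<in>\<R>. if q \<in> interior R then \<Sum>R'\<in>quadrants q R. g R' else (g R :: real))"
    by (intro sum.cong refl) (simp add: s_def)
  finally show "(\<Sum>R\<in>(\<Union>R\<in>\<R>. if q \<in> interior R then quadrants q R else {R}). g R)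
       = (\<Sum>R\<in>\<R>. if q \<in> interior R then \<Sum>R'\<in>quadrants q R. g R' else (g R :: real))"
    unfolding s_def .
qed

lemma rect_family_Quad: "rect_family (Quad p n)"
proof (induction n)
  case 0
  have "\<exists>a b c d::real. a < b \<and> c < d \<and> {0..1::real} \<times> {0..1::real} = {a..b} \<times> {c..d}"
    by (intro exI[of _ 0] exI[of _ 1]) auto
  then show ?case by (auto simp: rect_family_def)
next
  case (Suc n)
  show ?case using rect_family_split(1)[OF Suc, of "p (Suc n)"] by (simp only: Quad.simps)
qed

text \<open>Moving the point m + 1 from the descendants into the covering is one step of either
  recursion, so a general m reconciles the two orders. At m = 0 the covering is a single square and
  the sum has one term.\<close>

lemma card_crossed_eq_sum:
  "real (card {R \<in> Quad p (m + n). R \<inter> vsegment x \<noteq> {}}) = (\<Sum>R\<in>Quad p m. descendants_crossed x n m R p)"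
proof (induction n arbitrary: m)
  case 0
  have "finite (Quad p m)" using rect_family_Quad[of p m] by (simp add: rect_family_def)
  then show ?case by (simp add: sum.If_cases Int_def)
next
  case (Suc n)
  show ?case
    using Suc[of "Suc m"]
      rect_family_split(2)[OF rect_family_Quad[of p m], where q = "p (Suc m)" and g = "\<lambda>R. descendants_crossed x n (Suc m) R p"]
    by (simp only: Quad.simps descendants_crossed.simps add_Suc add_Suc_right)
qed

theorem num_crossed_eq: "num_crossed p n x = rect_crossed x n 0 0 1 0 1 p - 1"
  using card_crossed_eq_sum[of p 0 n x] descendants_crossed_rect[of 0 1 0 1 x n 0 p]
  by (simp add: num_crossed_def)

section \<open>Measurability and integrability of the count\<close>

lemma rect_crossed_cong:
  assumes "\<And>i. i \<in> {Suc m..m + n} \<Longrightarrow> p i = q i"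
  shows "rect_crossed x n m a b c d p = rect_crossed x n m a b c d q"
  using assms
proof (induction n arbitrary: m a b c d)
  case (Suc n)
  have "p (Suc m) = q (Suc m)" using Suc.prems by simp
  moreover have "rect_crossed x n (Suc m) a b c d p = rect_crossed x n (Suc m) a b c d q" for a b c d
    using Suc.prems by (intro Suc.IH) auto
  ultimately show ?case by simp
qed simp

lemma rect_crossed_bounds: "0 \<le> rect_crossed x n m a b c d p \<and> rect_crossed x n m a b c d p \<le> 4 ^ n"
proof (induction n arbitrary: m a b c d)
  case (Suc n)
  have a: "s1 + s2 + s3 + s4 \<le> 4 * z \<and> 0 \<le> s1 + s2 + s3 + s4"
    if "0 \<le> s1 \<and> s1 \<le> z" "0 \<le> s2 \<and> s2 \<le> z" "0 \<le> s3 \<and> s3 \<le> z" "0 \<le> s4 \<and> s4 \<le> z" for s1 s2 s3 s4 z :: real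
    using that by auto
  have b: "0 \<le> s \<and> s \<le> 4 * z" if "0 \<le> s \<and> s \<le> z" for s z :: real using that by auto
  show ?case
    using a[OF Suc Suc Suc Suc] b[OF Suc] by (simp add: conj_commute)
qed simp

lemma norm_rect_crossed: "norm (rect_crossed x n m a b c d p) \<le> 4 ^ n"
  using rect_crossed_bounds[of x n m a b c d p] by (simp only: real_norm_def abs_of_nonneg)

text \<open>The sides must be allowed to vary with z, because the recursion replaces them by
  coordinates of the random points.\<close>

lemma measurable_rect_crossed:
  assumes "a \<in> borel_measurable N" "b \<in> borel_measurable N" "c \<in> borel_measurable N" "d \<in> borel_measurable N"
    and "\<And>i. i \<in> {Suc m..m + n} \<Longrightarrow> (\<lambda>z. p z i) \<in> N \<rightarrow>\<^sub>M borel"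
  shows "(\<lambda>z. rect_crossed x n m (a z) (b z) (c z) (d z) (p z)) \<in> borel_measurable N"
  using assms
proof (induction n arbitrary: m a b c d)
  case 0
  note [measurable] = 0(1-4)
  show ?case by simp
next
  case (Suc n)
  note [measurable] = Suc.prems(1-4)
  have [measurable]: "(\<lambda>z. p z (Suc m)) \<in> N \<rightarrow>\<^sub>M borel" using Suc.prems(5)[of "Suc m"] by simp
  have u[measurable]: "(\<lambda>z. fst (p z (Suc m))) \<in> borel_measurable N"
    by (rule measurable_compose[OF _ borel_measurable_continuous_onI[OF continuous_on_fst[OF continuous_on_id]]]) measurable
  have v[measurable]: "(\<lambda>z. snd (p z (Suc m))) \<in> borel_measurable N"
    by (rule measurable_compose[OF _ borel_measurable_continuous_onI[OF continuous_on_snd[OF continuous_on_id]]]) measurable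
  have [measurable]: "(\<lambda>z. rect_crossed x n (Suc m) (a z) (b z) (c z) (d z) (p z)) \<in> borel_measurable N"
    if "a \<in> borel_measurable N" "b \<in> borel_measurable N" "c \<in> borel_measurable N" "d \<in> borel_measurable N" for a b c d
    using that Suc.prems(5) by (intro Suc.IH) auto
  show ?case by simp
qed

lemma borel_measurable_poly [measurable]:
  fixes q :: "real poly"
  assumes "f \<in> borel_measurable M"
  shows "(\<lambda>x. poly q (f x)) \<in> borel_measurable M"
  using assms by (rule measurable_compose) (intro borel_measurable_continuous_onI continuous_intros)

section \<open>Averaging over the point inserted first\<close>

abbreviation unit_square_measure :: "(real \<times> real) measure" where
  "unit_square_measure \<equiv> uniform_measure lborel ({0<..<1} \<times> {0<..<1})"

lemma has_bochner_integral_lborel_times: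
  fixes f g :: "real \<Rightarrow> real"
  assumes f: "has_bochner_integral lborel f I" and g: "has_bochner_integral lborel g J"
  shows "has_bochner_integral lborel (\<lambda>z. f (fst z) * g (snd z)) (I * J)"
proof -
  have i: "integrable lborel f" "integrable lborel g" and e: "integral\<^sup>L lborel f = I" "integral\<^sup>L lborel g = J"
    using f g by (auto simp: has_bochner_integral_iff)
  have [measurable]: "f \<in> borel_measurable borel" "g \<in> borel_measurable borel"
    using i by (auto dest: borel_measurable_integrable)
  have int: "integrable (lborel \<Otimes>\<^sub>M lborel) (\<lambda>z. f (fst z) * g (snd z))"
  proof (rule lborel_pair.Fubini_integrable)
    show "integrable lborel (\<lambda>x. \<integral>y. norm (f (fst (x, y)) * g (snd (x, y))) \<partial>lborel)"
      using i by (simp add: abs_mult)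
    show "AE x in lborel. integrable lborel (\<lambda>y. f (fst (x, y)) * g (snd (x, y)))"
      using i by simp
  qed measurable
  have "integral\<^sup>L (lborel \<Otimes>\<^sub>M lborel) (\<lambda>z. f (fst z) * g (snd z)) = (\<integral>x. (\<integral>y. f x * g y \<partial>lborel) \<partial>lborel)"
    using lborel_pair.integral_fst[of "\<lambda>x y. f x * g y"] int by (simp add: case_prod_unfold)
  also have "\<dots> = I * J" using e by simp
  finally show ?thesis using int by (simp add: has_bochner_integral_iff lborel_prod)
qed

lemma has_bochner_integral_Ioo: 
  fixes l r :: real
  assumes "l \<le> r"
  shows "has_bochner_integral lborel (indicator {l<..<r} :: real \<Rightarrow> real) (r - l)"
  using assms by (simp add: has_bochner_integral_iff)

lemma emeasure_unit_square: "emeasure lborel ({0<..<1::real} \<times> {0<..<1::real}) = 1"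
  by (simp add: lborel_prod[symmetric] lborel.emeasure_pair_measure_Times)

lemma prob_space_unit_square_measure: "prob_space unit_square_measure"
  by (rule prob_space_uniform_measure) (auto simp: emeasure_unit_square)

lemma integral_unit_square_measure:
  fixes f :: "real \<times> real \<Rightarrow> real"
  assumes "f \<in> borel_measurable borel"
  shows "(\<integral>z. f z \<partial>unit_square_measure) = (\<integral>z. indicator ({0<..<1} \<times> {0<..<1}) z * f z \<partial>lborel)"
proof -
  have A: "({0<..<1} \<times> {0<..<1} :: (real \<times> real) set) \<in> sets borel"
    by (intro borel_open open_Times) auto
  have "unit_square_measure = density lborel (\<lambda>z. ennreal (indicator ({0<..<1} \<times> {0<..<1}) z))"
    unfolding uniform_measure_def emeasure_unit_square
  proof (intro density_cong AE_I2)
    show "(\<lambda>z. indicator ({0<..<1} \<times> {0<..<1}) z / 1 :: ennreal) \<in> borel_measurable (lborel :: (real \<times> real) measure)"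
      "(\<lambda>z. ennreal (indicator ({0<..<1} \<times> {0<..<1}) z)) \<in> borel_measurable (lborel :: (real \<times> real) measure)"
      using A by measurable
  qed (auto split: split_indicator)
  then have "(\<integral>z. f z \<partial>unit_square_measure) = (\<integral>z. indicator ({0<..<1} \<times> {0<..<1}) z *\<^sub>R f z \<partial>lborel)"
    using assms borel_measurable_indicator[OF A] by (simp only:) (rule integral_density, auto)
  then show ?thesis by simp
qed

text \<open>Collects the crossed left and right pieces over all cuts u. The closed intervals of the
  previous integrals and the open one here differ only in the null set {a, b}.\<close>

lemma has_bochner_integral_cut_width:
  assumes k: "degree q \<le> k" and sym: "\<And>z. poly q (1 - z) = poly q z" and x: "a \<le> x" "x \<le> b" "a < b"
  shows "has_bochner_integral lborel
    (\<lambda>u. indicator {a<..<b} u * ((if x \<le> u then (u - a) ^ k * poly q ((x - a) / (u - a)) else 0) +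
                                (if u \<le> x then (b - u) ^ k * poly q ((x - u) / (b - u)) else 0)))
    ((b - a) ^ (k + 1) * (poly (scaling_poly k q) ((x - a) / (b - a)) + poly (scaling_poly k q) (1 - (x - a) / (b - a))))"
  using has_bochner_integral_add[OF has_bochner_integral_scaling_poly[OF k x]
      has_bochner_integral_scaling_poly_reflect[OF k sym x]]
  unfolding distrib_left[symmetric]
  by (rule has_bochner_integral_discrete_difference[where X = "{a, b}", THEN iffD1, rotated 4])
     (use x in \<open>auto simp: indicator_def\<close>)

lemma has_bochner_integral_cut_height:
  fixes c d :: real
  assumes "c < d"
  shows "has_bochner_integral lborel (\<lambda>v. indicator {c<..<d} v * ((v - c) ^ k + (d - v) ^ k)) (2 * (d - c) ^ (k + 1) / (k + 1))"
proof -
  define F where "F v = ((v - c) ^ Suc k - (d - v) ^ Suc k) / real (Suc k)" for v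
  have "has_bochner_integral lborel (\<lambda>v. ((v - c) ^ k + (d - v) ^ k) * indicator {c..d} v) (F d - F c)"
  proof (rule has_bochner_integral_FTC_Icc_real)
    fix v :: real
    have "(F has_real_derivative ((real (Suc k) * (1 * (v - c) ^ (Suc k - Suc 0)) - real (Suc k) * (-1 * (d - v) ^ (Suc k - Suc 0))) / real (Suc k))) (at v)"
      unfolding F_def
      by (intro DERIV_cdivide DERIV_diff DERIV_power) (auto intro!: derivative_eq_intros)
    also have "(real (Suc k) * (1 * (v - c) ^ (Suc k - Suc 0)) - real (Suc k) * (-1 * (d - v) ^ (Suc k - Suc 0))) / real (Suc k)
        = (real (Suc k) * ((v - c) ^ k + (d - v) ^ k)) / real (Suc k)" by (simp add: algebra_simps)
    finally show "(F has_real_derivative ((v - c) ^ k + (d - v) ^ k)) (at v)" by (simp del: of_nat_Suc)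
    show "isCont (\<lambda>v. (v - c) ^ k + (d - v) ^ k) v" by (intro continuous_intros)
  qed (use assms in auto)
  also have "F d - F c = 2 * (d - c) ^ (k + 1) / (k + 1)" by (simp add: F_def diff_divide_distrib[symmetric] del: of_nat_Suc)
  finally show ?thesis
    by (rule has_bochner_integral_discrete_difference[where X = "{c, d}", THEN iffD1, rotated 4])
       (use assms in \<open>auto simp: indicator_def\<close>)
qed

lemma binomial_sum_Suc:
  fixes c :: "nat \<Rightarrow> real"
  shows "(\<Sum>k\<le>Suc n. real (Suc n choose k) * c k) = (\<Sum>k\<le>n. real (n choose k) * (c k + c (Suc k)))"
proof -
  have "(\<Sum>k\<le>n. real (n choose k) * c k) = (\<Sum>k\<le>Suc n. real (n choose k) * c k)" by simp
  also have "\<dots> = c 0 + (\<Sum>k\<le>n. real (n choose Suc k) * c (Suc k))"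
    by (subst sum.atMost_Suc_shift) simp
  finally have "(\<Sum>k\<le>n. real (n choose k) * (c k + c (Suc k)))
      = c 0 + (\<Sum>k\<le>n. real (n choose Suc k) * c (Suc k)) + (\<Sum>k\<le>n. real (n choose k) * c (Suc k))"
    by (simp add: ring_distribs sum.distrib)
  then show ?thesis
    by (subst sum.atMost_Suc_shift) (simp add: ring_distribs sum.distrib)
qed

text \<open>The candidate for the expectation of \<open>rect_crossed\<close>. It depends on the
  rectangle only through its area, which is the chance of being hit, and the relative position of
  x.\<close>

definition rect_mean :: "real \<Rightarrow> nat \<Rightarrow> real \<Rightarrow> real \<Rightarrow> real \<Rightarrow> real \<Rightarrow> real" where
  "rect_mean x n a b c d =
     (if a \<le> x \<and> x \<le> b
      then \<Sum>k\<le>n. real (n choose k) * (((b - a) * (d - c)) ^ k * poly (crossed_poly k) ((x - a) / (b - a)))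
      else 0)"

text \<open>The expectation conditional on the first point: if it misses the rectangle nothing
  changes, if it hits, the four pieces take over. Pascal's rule merges both cases into the sum for
  \<open>Suc n\<close>.\<close>

lemma rect_mean_split:
  assumes "0 \<le> a" "a < b" "b \<le> 1" "0 \<le> c" "c < d" "d \<le> 1"
  shows "(\<integral>z. (if a < fst z \<and> fst z < b \<and> c < snd z \<and> snd z < d
            then rect_mean x n a (fst z) c (snd z) + rect_mean x n (fst z) b c (snd z)
               + rect_mean x n a (fst z) (snd z) d + rect_mean x n (fst z) b (snd z) d
            else rect_mean x n a b c d) \<partial>unit_square_measure) = rect_mean x (Suc n) a b c d"
    (is "(\<integral>z. ?h z \<partial>_) = _")
proof (cases "a \<le> x \<and> x \<le> b")
  case False
  then have "?h z = 0" for z unfolding rect_mean_def by auto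
  moreover have "rect_mean x (Suc n) a b c d = 0"
    unfolding rect_mean_def by (rule if_not_P[OF False])
  ultimately show ?thesis by (simp only: integral_zero)
next
  case True
  define e where "e = rect_mean x n a b c d"
  define D where "D k = poly (crossed_poly k) ((x - a) / (b - a))" for k
  define A where "A = (b - a) * (d - c)"
  define f where "f k u = indicator {a<..<b} u * ((if x \<le> u then (u - a) ^ k * poly (crossed_poly k) ((x - a) / (u - a)) else 0) +
                                (if u \<le> x then (b - u) ^ k * poly (crossed_poly k) ((x - u) / (b - u)) else 0))" for k u
  define g where "g k v = indicator {c<..<d} v * ((v - c) ^ k + (d - v) ^ k)" for k v
  have f: "has_bochner_integral lborel (f k) ((b - a) ^ (k + 1) * (real (k + 1) / 2 * (D k + D (Suc k))))" for k
  proof -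
    \<comment> \<open>The recursion of \<open>crossed_poly\<close> read backwards; its factor (k +
      1) / 2 cancels against the height integral 2 / (k + 1).\<close>
    have E: "poly (scaling_poly k (crossed_poly k)) ((x - a) / (b - a)) + poly (scaling_poly k (crossed_poly k)) (1 - (x - a) / (b - a))
        = real (k + 1) / 2 * (D k + D (Suc k))"
    proof -
      have key: "w = K / 2 * (D + (2 / K * w - D))" if "K > 0" for w K D :: real
        using that by (simp add: field_simps)
      show ?thesis unfolding D_def poly_crossed_poly_Suc by (rule key) simp
    qed
    show ?thesis
      unfolding f_def E[symmetric]
      by (rule has_bochner_integral_cut_width[OF degree_crossed_poly poly_crossed_poly_reflect]) (use True assms in auto)
  qed
  have g: "has_bochner_integral lborel (g k) (2 * (d - c) ^ (k + 1) / (k + 1))" for k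
    unfolding g_def using assms by (intro has_bochner_integral_cut_height)
  \<comment> \<open>Every summand is a product of a function of the abscissa and one of the
    ordinate, so the plane integral factorises. The first two summands together describe the
    misses.\<close>
  have h_eq: "indicator ({0<..<1} \<times> {0<..<1}) z * ?h z
      = e * (indicator {0<..<1} (fst z) * indicator {0<..<1} (snd z))
      - e * (indicator {a<..<b} (fst z) * indicator {c<..<d} (snd z))
      + (\<Sum>k\<le>n. real (n choose k) * (f k (fst z) * g k (snd z)))" for z
  proof (cases "a < fst z \<and> fst z < b \<and> c < snd z \<and> snd z < d")
    case out: False
    have i: "(indicator {a<..<b} (fst z) :: real) * indicator {c<..<d} (snd z) = 0"
      using out by (auto simp: indicator_def)
    have "f k (fst z) * g k (snd z) = 0" for k
      using i unfolding f_def g_def by auto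
    moreover have "?h z = e" using out by (simp only: if_False e_def)
    moreover have "(indicator ({0<..<1} \<times> {0<..<1}) z :: real) = indicator {0<..<1} (fst z) * indicator {0<..<1} (snd z)"
      by (auto simp: indicator_def mem_Times_iff)
    ultimately show ?thesis using i by (simp only: sum.neutral_const mult_zero_right) simp
  next
    case inn: True
    obtain u v where z: "z = (u, v)" by (cases z)
    have uv: "a < u" "u < b" "c < v" "v < d" using inn z by auto
    have one: "(indicator {0<..<1} u :: real) = 1" "(indicator {0<..<1} v :: real) = 1"
      "(indicator {a<..<b} u :: real) = 1" "(indicator {c<..<d} v :: real) = 1"
      "(indicator ({0<..<1} \<times> {0<..<1}) (u, v) :: real) = 1"
      using uv assms by auto
    have L: "rect_mean x n a u c' d' = (\<Sum>k\<le>n. real (n choose k) * ((d' - c') ^ k * (if x \<le> u then (u - a) ^ k * poly (crossed_poly k) ((x - a) / (u - a)) else 0)))" for c' d'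
      using True unfolding rect_mean_def by (simp add: power_mult_distrib mult_ac)
    have R: "rect_mean x n u b c' d' = (\<Sum>k\<le>n. real (n choose k) * ((d' - c') ^ k * (if u \<le> x then (b - u) ^ k * poly (crossed_poly k) ((x - u) / (b - u)) else 0)))" for c' d'
      using True unfolding rect_mean_def by (simp add: power_mult_distrib mult_ac)
    have "rect_mean x n a u c v + rect_mean x n u b c v + rect_mean x n a u v d + rect_mean x n u b v d
        = (\<Sum>k\<le>n. real (n choose k) * (f k u * g k v))"
      unfolding L R sum.distrib[symmetric] f_def g_def one
      by (intro sum.cong refl) (simp add: algebra_simps)
    then show ?thesis unfolding z using uv by (simp add: one)
  qed
  have "has_bochner_integral lborel (\<lambda>z. indicator ({0<..<1} \<times> {0<..<1}) z * ?h z)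
     (e * ((1 - 0) * (1 - 0)) - e * ((b - a) * (d - c)) + (\<Sum>k\<le>n. real (n choose k) *
       (((b - a) ^ (k + 1) * (real (k + 1) / 2 * (D k + D (Suc k)))) * (2 * (d - c) ^ (k + 1) / (k + 1)))))"
    unfolding h_eq
    by (intro has_bochner_integral_add has_bochner_integral_diff has_bochner_integral_sum has_bochner_integral_mult_right
        has_bochner_integral_lborel_times has_bochner_integral_Ioo f g) (use assms in auto)
  moreover have "e * ((1 - 0) * (1 - 0)) - e * ((b - a) * (d - c)) + (\<Sum>k\<le>n. real (n choose k) *
       (((b - a) ^ (k + 1) * (real (k + 1) / 2 * (D k + D (Suc k)))) * (2 * (d - c) ^ (k + 1) / (k + 1))))
      = rect_mean x (Suc n) a b c d"
  proof -
    have e: "e = (\<Sum>k\<le>n. real (n choose k) * (A ^ k * D k))"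
      unfolding e_def rect_mean_def A_def D_def using True by simp
    have t: "((b - a) ^ (k + 1) * (real (k + 1) / 2 * (D k + D (Suc k)))) * (2 * (d - c) ^ (k + 1) / (k + 1))
        = A * (A ^ k * D k) + A ^ Suc k * D (Suc k)" for k
      unfolding A_def power_mult_distrib by (simp add: field_simps)
    have "rect_mean x (Suc n) a b c d = (\<Sum>k\<le>Suc n. real (Suc n choose k) * (A ^ k * D k))"
      unfolding rect_mean_def A_def D_def using True by simp
    also have "\<dots> = e + (\<Sum>k\<le>n. real (n choose k) * (A ^ Suc k * D (Suc k)))"
      unfolding binomial_sum_Suc e by (simp add: ring_distribs sum.distrib)
    finally have "rect_mean x (Suc n) a b c d = e + (\<Sum>k\<le>n. real (n choose k) * (A ^ Suc k * D (Suc k)))" .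
    moreover have "(\<Sum>k\<le>n. real (n choose k) * (A * (A ^ k * D k) + A ^ Suc k * D (Suc k)))
        = A * e + (\<Sum>k\<le>n. real (n choose k) * (A ^ Suc k * D (Suc k)))"
      unfolding e distrib_left sum.distrib sum_distrib_left by (simp add: mult.left_commute)
    ultimately show ?thesis
      unfolding t A_def[symmetric] by simp
  qed
  moreover have "?h \<in> borel_measurable borel"
  proof -
    have [measurable]: "fst \<in> borel_measurable (borel :: (real \<times> real) measure)" "snd \<in> borel_measurable (borel :: (real \<times> real) measure)"
      by (intro borel_measurable_continuous_onI continuous_on_fst continuous_on_snd continuous_on_id)+
    show ?thesis unfolding rect_mean_def by measurable
  qed
  ultimately show ?thesis
    by (simp only: integral_unit_square_measure has_bochner_integral_integral_eq)
qed

text \<open>With the first point held fixed, the remaining ones are integrated out by the induction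
  hypothesis; Fubini puts them into the inner integral. The starting index m is general because each
  step consumes the lowest index.\<close>

lemma integral_rect_crossed:
  assumes "0 \<le> a" "a < b" "b \<le> 1" "0 \<le> c" "c < d" "d \<le> 1"
  shows "(\<integral>p. rect_crossed x n m a b c d p \<partial>PiM {Suc m..m + n} (\<lambda>_. unit_square_measure)) = rect_mean x n a b c d"
  using assms
proof (induction n arbitrary: m a b c d)
  case 0
  interpret prob_space "PiM {} (\<lambda>_::nat. unit_square_measure)" by (intro prob_space_PiM prob_space_unit_square_measure)
  show ?case by (simp add: rect_mean_def prob_space)
next
  case (Suc n)
  interpret U: prob_space unit_square_measure by (rule prob_space_unit_square_measure)
  interpret product_sigma_finite "\<lambda>_::nat. unit_square_measure" by standard
  let ?J = "{Suc (Suc m)..Suc m + n}"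
  have ins: "{Suc m..m + Suc n} = insert (Suc m) ?J" by auto
  interpret J: prob_space "PiM ?J (\<lambda>_. unit_square_measure)"
    by (intro prob_space_PiM prob_space_unit_square_measure)
  interpret I: prob_space "PiM (insert (Suc m) ?J) (\<lambda>_. unit_square_measure)"
    by (intro prob_space_PiM prob_space_unit_square_measure)
  interpret JU: pair_prob_space "PiM ?J (\<lambda>_. unit_square_measure)" unit_square_measure ..
  let ?f = "rect_crossed x (Suc n) m a b c d"
  have coord: "(\<lambda>p. p i) \<in> PiM K (\<lambda>_. unit_square_measure) \<rightarrow>\<^sub>M borel" if "i \<in> K" for i :: nat and K
  proof -
    have "(\<lambda>p. p i) \<in> PiM K (\<lambda>_. unit_square_measure) \<rightarrow>\<^sub>M unit_square_measure"
      using that by (rule measurable_component_singleton)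
    then show ?thesis by (simp cong: measurable_cong_sets)
  qed
  have int: "integrable (PiM (insert (Suc m) ?J) (\<lambda>_. unit_square_measure)) ?f"
    by (intro I.integrable_const_bound[where B = "4 ^ Suc n"] AE_I2 measurable_rect_crossed norm_rect_crossed)
       (auto intro!: coord)
  have meas2: "(\<lambda>z. ?f ((fst z)(Suc m := snd z))) \<in> borel_measurable (PiM ?J (\<lambda>_. unit_square_measure) \<Otimes>\<^sub>M unit_square_measure)"
  proof (rule measurable_rect_crossed)
    fix i assume "i \<in> {Suc m..m + Suc n}"
    then consider "i = Suc m" | "i \<in> ?J" by fastforce
    then show "(\<lambda>z. ((fst z)(Suc m := snd z)) i) \<in> PiM ?J (\<lambda>_. unit_square_measure) \<Otimes>\<^sub>M unit_square_measure \<rightarrow>\<^sub>M borel"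
    proof cases
      case 1
      have "snd \<in> PiM ?J (\<lambda>_. unit_square_measure) \<Otimes>\<^sub>M unit_square_measure \<rightarrow>\<^sub>M unit_square_measure" by simp
      then show ?thesis using 1 by (simp cong: measurable_cong_sets)
    next
      case 2
      then show ?thesis using measurable_compose[OF measurable_fst coord[OF 2]] by simp
    qed
  qed auto
  have int2: "integrable (PiM ?J (\<lambda>_. unit_square_measure) \<Otimes>\<^sub>M unit_square_measure) (\<lambda>(p, z). ?f (p(Suc m := z)))"
    unfolding case_prod_unfold
    by (intro JU.integrable_const_bound[where B = "4 ^ Suc n"] AE_I2 meas2 norm_rect_crossed)
  have inner: "(\<integral>p. ?f (p(Suc m := z)) \<partial>PiM ?J (\<lambda>_. unit_square_measure))
     = (if a < fst z \<and> fst z < b \<and> c < snd z \<and> snd z < d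
            then rect_mean x n a (fst z) c (snd z) + rect_mean x n (fst z) b c (snd z)
               + rect_mean x n a (fst z) (snd z) d + rect_mean x n (fst z) b (snd z) d
            else rect_mean x n a b c d)" for z
  proof -
    have upd: "rect_crossed x n (Suc m) a' b' c' d' (p(Suc m := z)) = rect_crossed x n (Suc m) a' b' c' d' p" for a' b' c' d' p
      by (rule rect_crossed_cong) auto
    have intJ: "integrable (PiM ?J (\<lambda>_. unit_square_measure)) (rect_crossed x n (Suc m) a' b' c' d')" for a' b' c' d'
      by (intro J.integrable_const_bound[where B = "4 ^ n"] AE_I2 measurable_rect_crossed norm_rect_crossed)
         (auto intro!: coord)
    have IH: "(\<integral>p. rect_crossed x n (Suc m) a' b' c' d' p \<partial>PiM ?J (\<lambda>_. unit_square_measure)) = rect_mean x n a' b' c' d'"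
      if "0 \<le> a'" "a' < b'" "b' \<le> 1" "0 \<le> c'" "c' < d'" "d' \<le> 1" for a' b' c' d'
      using that by (rule Suc.IH)
    show ?thesis
    proof (cases "a < fst z \<and> fst z < b \<and> c < snd z \<and> snd z < d")
      case True
      have "(\<integral>p. ?f (p(Suc m := z)) \<partial>PiM ?J (\<lambda>_. unit_square_measure))
        = (\<integral>p. rect_crossed x n (Suc m) a (fst z) c (snd z) p + rect_crossed x n (Suc m) (fst z) b c (snd z) p
           + rect_crossed x n (Suc m) a (fst z) (snd z) d p + rect_crossed x n (Suc m) (fst z) b (snd z) d p
             \<partial>PiM ?J (\<lambda>_. unit_square_measure))"
        by (intro Bochner_Integration.integral_cong refl) (simp add: upd True)
      also have "\<dots> = rect_mean x n a (fst z) c (snd z) + rect_mean x n (fst z) b c (snd z)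
               + rect_mean x n a (fst z) (snd z) d + rect_mean x n (fst z) b (snd z) d"
      proof -
        have "0 \<le> fst z" "fst z \<le> 1" "0 \<le> snd z" "snd z \<le> 1" using Suc.prems True by auto
        then show ?thesis
          using Suc.prems True
          by (simp only: Bochner_Integration.integral_add Bochner_Integration.integrable_add intJ IH)
      qed
      finally show ?thesis using True by simp
    next
      case False
      then have "?f (p(Suc m := z)) = rect_crossed x n (Suc m) a b c d p" for p
        by (simp only: rect_crossed.simps fun_upd_same if_False upd)
      then show ?thesis using False by (simp only: IH[OF Suc.prems] if_False)
    qed
  qed
  have "(\<integral>p. ?f p \<partial>PiM {Suc m..m + Suc n} (\<lambda>_. unit_square_measure))
      = (\<integral>p. (\<integral>z. ?f (p(Suc m := z)) \<partial>unit_square_measure) \<partial>PiM ?J (\<lambda>_. unit_square_measure))"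
    unfolding ins by (rule product_integral_insert[OF _ _ int]) auto
  also have "\<dots> = (\<integral>z. (\<integral>p. ?f (p(Suc m := z)) \<partial>PiM ?J (\<lambda>_. unit_square_measure)) \<partial>unit_square_measure)"
    by (rule JU.Fubini_integral[OF int2, symmetric])
  also have "\<dots> = rect_mean x (Suc n) a b c d"
    unfolding inner by (rule rect_mean_split[OF Suc.prems])
  finally show ?case .
qed

text \<open>Invisible in the formula, whose terms have varying signs; it follows from the meaning as
  an expectation.\<close>

lemma rect_mean_nonneg: "0 \<le> rect_mean x n 0 1 0 1"
proof -
  have "rect_mean x n 0 1 0 1 = (\<integral>p. rect_crossed x n 0 0 1 0 1 p \<partial>PiM {Suc 0..0 + n} (\<lambda>_. unit_square_measure))"
    by (rule integral_rect_crossed[symmetric]) auto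
  also have "\<dots> \<ge> 0" using rect_crossed_bounds[of x n 0 0 1 0 1] by (intro Bochner_Integration.integral_nonneg) auto
  finally show ?thesis .
qed

lemma expectation_num_crossed:
  fixes M :: "'a measure" and P :: "nat \<Rightarrow> 'a \<Rightarrow> real \<times> real"
  assumes M: "prob_space M" and indep: "prob_space.indep_vars M (\<lambda>_. borel) P {1..}"
    and unif: "\<And>k. k \<ge> 1 \<Longrightarrow> distr M borel (P k) = unit_square_measure"
  shows "prob_space.expectation M (\<lambda>\<omega>. num_crossed (\<lambda>k. P k \<omega>) n x) = rect_mean x n 0 1 0 1 - 1"
proof -
  interpret prob_space M by fact
  let ?I = "{Suc 0..0 + n}"
  have rv: "P i \<in> M \<rightarrow>\<^sub>M borel" if "i \<in> ?I" for i
    using indep that by (auto simp: indep_vars_def)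
  have meas: "rect_crossed x n 0 0 1 0 1 \<in> borel_measurable (PiM ?I (\<lambda>_. borel))"
    by (rule measurable_rect_crossed) (auto intro: measurable_component_singleton)
  have restr: "(\<lambda>\<omega>. \<lambda>i\<in>?I. P i \<omega>) \<in> M \<rightarrow>\<^sub>M PiM ?I (\<lambda>_. borel)"
    using rv by (intro measurable_restrict)
  have D: "distr M (PiM ?I (\<lambda>_. borel)) (\<lambda>\<omega>. \<lambda>i\<in>?I. P i \<omega>) = PiM ?I (\<lambda>_. unit_square_measure)" if "n > 0"
  proof -
    have "indep_vars (\<lambda>_. borel) P ?I" by (rule indep_vars_subset[OF indep]) auto
    then have "distr M (PiM ?I (\<lambda>_. borel)) (\<lambda>\<omega>. \<lambda>i\<in>?I. P i \<omega>) = PiM ?I (\<lambda>i. distr M borel (P i))"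
      using that rv by (subst (asm) indep_vars_iff_distr_eq_PiM') auto
    also have "\<dots> = PiM ?I (\<lambda>_. unit_square_measure)"
      by (intro PiM_cong) (auto simp: unif)
    finally show ?thesis .
  qed
  have E: "expectation (\<lambda>\<omega>. rect_crossed x n 0 0 1 0 1 (\<lambda>k. P k \<omega>)) = rect_mean x n 0 1 0 1"
  \<comment> \<open>Independence is characterised through product measures over nonempty index sets,
    so the case without points is separate.\<close>
  proof (cases "n = 0")
    case True
    then show ?thesis by (simp add: rect_mean_def prob_space)
  next
    case False
    have "expectation (\<lambda>\<omega>. rect_crossed x n 0 0 1 0 1 (\<lambda>k. P k \<omega>))
       = expectation (\<lambda>\<omega>. rect_crossed x n 0 0 1 0 1 (\<lambda>i\<in>?I. P i \<omega>))"
      by (intro Bochner_Integration.integral_cong refl rect_crossed_cong) auto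
    also have "\<dots> = (\<integral>p. rect_crossed x n 0 0 1 0 1 p \<partial>distr M (PiM ?I (\<lambda>_. borel)) (\<lambda>\<omega>. \<lambda>i\<in>?I. P i \<omega>))"
      by (rule integral_distr[OF restr meas, symmetric])
    also have "\<dots> = rect_mean x n 0 1 0 1"
      using False by (subst D) (auto intro: integral_rect_crossed[where m = 0, simplified])
    finally show ?thesis .
  qed
  have "integrable M (\<lambda>\<omega>. rect_crossed x n 0 0 1 0 1 (\<lambda>k. P k \<omega>))"
  proof (rule integrable_const_bound[where B = "4 ^ n"])
    show "(\<lambda>\<omega>. rect_crossed x n 0 0 1 0 1 (\<lambda>k. P k \<omega>)) \<in> borel_measurable M"
      by (rule measurable_rect_crossed) (use rv in auto)
  qed (intro AE_I2 norm_rect_crossed)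
  then show ?thesis unfolding num_crossed_eq by (simp add: E prob_space)
qed

section \<open>The recursion and its fixed point\<close>

abbreviation \<beta> :: real where "\<beta> \<equiv> beta_star"

lemma beta_bounds: "1 / 2 < \<beta>" "\<beta> < 1"
proof -
  have "sqrt 17 > 4" by (rule real_less_rsqrt) auto
  then show "1 / 2 < \<beta>" by (simp add: beta_star_def)
  have "sqrt 17 < 5" by (rule real_less_lsqrt) auto
  then show "\<beta> < 1" by (simp add: beta_star_def)
qed

lemma beta_pos [simp]: "\<beta> > 0" "\<beta> \<ge> 0" using beta_bounds by auto

lemma beta_eq: "(\<beta> + 1) * (\<beta> + 2) = 4"
proof -
  have "2 * \<beta> + 3 = sqrt 17" by (simp add: beta_star_def field_simps)
  then have "(2 * \<beta> + 3)\<^sup>2 = 17" by simp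
  then show ?thesis by (simp add: power2_eq_square algebra_simps)
qed

lemma beta_eq': "2 / (\<beta> + 1) * (2 / (\<beta> + 2)) = 1"
  using beta_eq by (simp add: field_simps)

definition hpoly :: "nat \<Rightarrow> real \<Rightarrow> real" where "hpoly k = poly (scaling_poly k (crossed_poly k))"

definition dprim :: "nat \<Rightarrow> real \<Rightarrow> real" where "dprim k y = integral {0..y} (poly (crossed_poly k))"

text \<open>The primitive of \<open>hpoly k\<close>, in the closed form given by \<open>integral_scaling_solution\<close>.\<close>

definition hprim :: "nat \<Rightarrow> real \<Rightarrow> real" where "hprim k y = (y * hpoly k y + dprim k y) / (real k + 2)"

section \<open>Recursion for the primitives\<close>

lemma poly_integrable: "poly q integrable_on {l..r::real}"
  by (intro integrable_continuous_interval continuous_intros)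

lemma dprim_0 [simp]: "dprim k 0 = 0" by (simp add: dprim_def)

lemma hpoly_1 [simp]: "hpoly k 1 = 0" by (simp add: hpoly_def scaling_poly_1)

lemma hprim_0 [simp]: "hprim k 0 = 0" by (simp add: hprim_def)

lemma
  shows continuous_on_dprim: "continuous_on {0..1} (dprim k)"
    and DERIV_dprim: "z \<in> {0<..<1} \<Longrightarrow> (dprim k has_real_derivative poly (crossed_poly k) z) (at z)"
proof -
  have d: "((\<lambda>u. integral {0..u} (poly (crossed_poly k))) has_real_derivative poly (crossed_poly k) z) (at z within {0..1})" if "z \<in> {0..1}" for z
    by (rule integral_has_real_derivative) (use that in \<open>auto intro!: continuous_intros\<close>)
  then show "continuous_on {0..1} (dprim k)"
    unfolding dprim_def[abs_def] by (rule DERIV_continuous_on)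
  show "(dprim k has_real_derivative poly (crossed_poly k) z) (at z)" if "z \<in> {0<..<1}"
    using d[of z] that unfolding dprim_def[abs_def] by (simp add: at_within_Icc_at)
qed

text \<open>The first form exhibits \<open>hprim\<close> as a positive average of
  \<open>dprim\<close> over scales t. This is what later transfers error bounds on primitives from
  one step to the next.\<close>

lemma
  assumes y: "y \<in> {0..1}"
  shows hprim_integral: "((\<lambda>t. t ^ (k + 1) * dprim k (min 1 (y / t))) has_integral hprim k y) {0..1}"
    and hpoly_integral: "(hpoly k has_integral hprim k y) {0..y}"
proof -
  have hyp: "continuous_on {0..1} (hpoly k)" unfolding hpoly_def by (intro continuous_intros)
  have d: "(hpoly k has_real_derivative ((real k + 1) * hpoly k z - poly (crossed_poly k) z) / z) (at z)" if "z \<in> {0<..<1}" for z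
    unfolding hpoly_def using that by (intro has_real_derivative_scaling_poly degree_crossed_poly) auto
  show "(hpoly k has_integral hprim k y) {0..y}"
    unfolding hprim_def
    by (rule integral_scaling_solution[OF _ continuous_on_dprim DERIV_dprim dprim_0 hyp hpoly_1 d y]) auto
  have "((\<lambda>t. t powr (real k + 1) * dprim k (min 1 (y / t))) has_integral hprim k y) {0..1}"
    unfolding hprim_def
    by (rule scaling_integral_primitive[OF _ continuous_on_dprim DERIV_dprim dprim_0 hyp hpoly_1 d y]) auto
  moreover have "t powr (real k + 1) = t ^ (k + 1)" if "t \<in> {0..1}" for t
    using that powr_realpow'[of t "k + 1"] by (simp add: add.commute)
  ultimately show "((\<lambda>t. t ^ (k + 1) * dprim k (min 1 (y / t))) has_integral hprim k y) {0..1}"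
    by (subst has_integral_cong[where g = "\<lambda>t. t powr (real k + 1) * dprim k (min 1 (y / t))"]) auto
qed

lemma has_integral_reflect_01:
  fixes f G :: "real \<Rightarrow> real"
  assumes "\<And>y. y \<in> {0..1} \<Longrightarrow> (f has_integral G y) {0..y}" and y: "y \<in> {0..1}"
  shows "((\<lambda>x. f (1 - x)) has_integral (G 1 - G (1 - y))) {0..y}"
proof -
  have i: "f integrable_on {0..1}" using assms(1)[of 1] by auto
  have "integral {0..1-y} f + integral {1-y..1} f = integral {0..1} f"
    using y by (intro Henstock_Kurzweil_Integration.integral_combine i) auto
  moreover have "integral {0..1-y} f = G (1 - y)" "integral {0..1} f = G 1"
    using assms(1)[of "1 - y"] assms(1)[of 1] y by (auto intro: integral_unique)
  moreover have "f integrable_on {1-y..1}"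
    by (rule integrable_on_subinterval[OF i]) (use y in auto)
  ultimately have "(f has_integral (G 1 - G (1 - y))) {1-y..1}"
    by (auto simp: has_integral_integrable_integral)
  then have "(f has_integral (G 1 - G (1 - y))) (cbox (1-y) 1)" by simp
  from has_integral_affinity[OF this, of "-1" 1] y show ?thesis by simp
qed

lemma dprim_Suc:
  assumes y: "y \<in> {0..1}"
  shows "dprim k y + dprim (Suc k) y = 2 / real (k + 1) * (hprim k y + hprim k 1 - hprim k (1 - y))"
proof -
  have "((\<lambda>x. 2 / real (k + 1) * (hpoly k x + hpoly k (1 - x))) has_integral
      2 / real (k + 1) * (hprim k y + (hprim k 1 - hprim k (1 - y)))) {0..y}"
    using y by (intro has_integral_mult_right has_integral_add hpoly_integral has_integral_reflect_01[where f = "hpoly k"])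
  moreover have "((\<lambda>x. 2 / real (k + 1) * (hpoly k x + hpoly k (1 - x))) has_integral (dprim k y + dprim (Suc k) y)) {0..y}"
  proof -
    have "((\<lambda>x. poly (crossed_poly k) x + poly (crossed_poly (Suc k)) x) has_integral (dprim k y + dprim (Suc k) y)) {0..y}"
      unfolding dprim_def by (intro has_integral_add integrable_integral poly_integrable)
    moreover have "poly (crossed_poly k) x + poly (crossed_poly (Suc k)) x = 2 / real (k + 1) * (hpoly k x + hpoly k (1 - x))" for x
      unfolding poly_crossed_poly_Suc hpoly_def by simp
    ultimately show ?thesis by simp
  qed
  ultimately show ?thesis by (metis has_integral_unique add_diff_eq)
qed

text \<open>At y = 1 the boundary term of \<open>hprim\<close> vanishes, so the integrals satisfy a
  scalar recursion with factor 4 / ((k + 1) * (k + 2)) - 1. As a function of k its numerator has the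
  roots \<beta> and -\<beta> - 3, which produces the Pochhammer symbols.\<close>

lemma dprim_1: "dprim k 1 = av_coeff \<beta> k"
proof (induction k)
  case 0
  have "poly 1 = (\<lambda>x::real. 1)" by auto
  then show ?case by (simp add: dprim_def av_coeff_def)
next
  case (Suc k)
  have "hprim k 1 = dprim k 1 / (real k + 2)" by (simp add: hprim_def)
  then have "dprim (Suc k) 1 = (4 / ((real k + 1) * (real k + 2)) - 1) * dprim k 1"
  proof -
    assume S: "hprim k 1 = dprim k 1 / (real k + 2)"
    have "dprim k 1 + dprim (Suc k) 1 = 4 / (real k + 1) * hprim k 1"
      using dprim_Suc[of 1 k] by (simp add: add.commute)
    then show ?thesis unfolding S by (simp add: left_diff_distrib)
  qed
  also have "4 / ((real k + 1) * (real k + 2)) - 1 = (\<beta> - real k) * (\<beta> + 3 + real k) / ((real k + 1) * (real k + 2))"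
  proof -
    have "4 - (real k + 1) * (real k + 2) = (\<beta> - real k) * (\<beta> + 3 + real k)"
      using beta_eq by (simp add: algebra_simps)
    moreover have "4 / ((real k + 1) * (real k + 2)) - 1 = (4 - (real k + 1) * (real k + 2)) / ((real k + 1) * (real k + 2))"
      by (simp add: diff_divide_distrib)
    ultimately show ?thesis by simp
  qed
  also have "\<dots> * dprim k 1 = av_coeff \<beta> (Suc k)"
    unfolding Suc av_coeff_def pochhammer_Suc by (simp add: field_simps)
  finally show ?case .
qed

definition mean_crossed :: "nat \<Rightarrow> real \<Rightarrow> real" where
  "mean_crossed n x = (\<Sum>k\<le>n. real (n choose k) * poly (crossed_poly k) x)"

lemma mean_crossed: "x \<in> {0..1} \<Longrightarrow> rect_mean x n 0 1 0 1 = mean_crossed n x"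
  by (simp add: rect_mean_def mean_crossed_def)

definition mean_prim :: "nat \<Rightarrow> real \<Rightarrow> real" where "mean_prim n y = (\<Sum>k\<le>n. real (n choose k) * dprim k y)"

text \<open>The divisor k + 1 comes from the uniform height of the cut; it turns
  \<open>bern_mean\<close> into \<open>bern_avg\<close> in the integral representation. The variant
  \<open>mean_hprim\<close> without it arises only from integration by parts.\<close>

definition avg_hprim :: "nat \<Rightarrow> real \<Rightarrow> real" where "avg_hprim n y = (\<Sum>k\<le>n. real (n choose k) * (hprim k y / (real k + 1)))"

definition mean_hprim :: "nat \<Rightarrow> real \<Rightarrow> real" where "mean_hprim n y = (\<Sum>k\<le>n. real (n choose k) * hprim k y)"

lemma mean_prim_Suc: "y \<in> {0..1} \<Longrightarrow> mean_prim (Suc n) y = 2 * (avg_hprim n y + avg_hprim n 1 - avg_hprim n (1 - y))"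
  unfolding mean_prim_def binomial_sum_Suc dprim_Suc avg_hprim_def
  by (simp add: sum_distrib_left sum.distrib[symmetric] sum_subtractf[symmetric] algebra_simps add_divide_distrib diff_divide_distrib)

lemma avg_hprim_integral:
  assumes "y \<in> {0..1}"
  shows "((\<lambda>t. t * bern_avg n t (\<lambda>j. mean_prim j (min 1 (y / t)))) has_integral avg_hprim n y) {0..1}"
proof -
  have "((\<lambda>t. \<Sum>k\<le>n. real (n choose k) / (real k + 1) * (t ^ (k + 1) * dprim k (min 1 (y / t)))) has_integral
      (\<Sum>k\<le>n. real (n choose k) / (real k + 1) * hprim k y)) {0..1}"
    by (intro has_integral_sum has_integral_mult_right hprim_integral assms) auto
  moreover have "t * bern_avg n t (\<lambda>j. mean_prim j (min 1 (y / t))) = (\<Sum>k\<le>n. real (n choose k) / (real k + 1) * (t ^ (k + 1) * dprim k (min 1 (y / t))))" for t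
    unfolding mean_prim_def bern_avg_binomial_sum sum_distrib_left by (intro sum.cong refl) simp
  ultimately show ?thesis by (simp add: avg_hprim_def)
qed

lemma mean_hprim_integral:
  assumes "y \<in> {0..1}"
  shows "((\<lambda>t. t * bern_mean n t (\<lambda>j. mean_prim j (min 1 (y / t)))) has_integral mean_hprim n y) {0..1}"
proof -
  have "((\<lambda>t. \<Sum>k\<le>n. real (n choose k) * (t ^ (k + 1) * dprim k (min 1 (y / t)))) has_integral
      (\<Sum>k\<le>n. real (n choose k) * hprim k y)) {0..1}"
    by (intro has_integral_sum has_integral_mult_right hprim_integral assms) auto
  moreover have "t * bern_mean n t (\<lambda>j. mean_prim j (min 1 (y / t))) = (\<Sum>k\<le>n. real (n choose k) * (t ^ (k + 1) * dprim k (min 1 (y / t))))" for t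
    unfolding mean_prim_def bern_mean_binomial_sum sum_distrib_left by (intro sum.cong refl) simp
  ultimately show ?thesis by (simp add: mean_hprim_def)
qed

lemma mean_crossed_Suc:
  "mean_crossed (Suc n) x = (\<Sum>k\<le>n. real (n choose k) * (2 / (real k + 1) * hpoly k x)) + (\<Sum>k\<le>n. real (n choose k) * (2 / (real k + 1) * hpoly k (1 - x)))"
proof -
  have "poly (crossed_poly k) x + poly (crossed_poly (Suc k)) x = 2 / (real k + 1) * hpoly k x + 2 / (real k + 1) * hpoly k (1 - x)" for k
    unfolding poly_crossed_poly_Suc hpoly_def by (simp add: distrib_left add.commute)
  then show ?thesis
    unfolding mean_crossed_def binomial_sum_Suc by (simp add: sum.distrib distrib_left)
qed

text \<open>Integration by parts recovers values from primitives: x * h = (k + 2) * H - D for the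
  primitives H and D, and (k + 2) / (k + 1) = 1 + 1 / (k + 1). The price is the factor x, which
  excludes the endpoints.\<close>

lemma hpoly_sum_eq:
  "x * (\<Sum>k\<le>n. real (n choose k) * (2 / (real k + 1) * hpoly k x)) = 2 * mean_hprim n x + 2 * avg_hprim n x - 2 * bern_avg n 1 (\<lambda>j. mean_prim j x)"
proof -
  have "x * (2 / (real k + 1) * hpoly k x) = 2 * hprim k x + 2 * (hprim k x / (real k + 1)) - 2 * (dprim k x / (real k + 1))" for k
  proof -
    have xH: "x * hpoly k x = (real k + 2) * hprim k x - dprim k x" by (simp add: hprim_def)
    have e1: "x * (2 / (real k + 1) * hpoly k x) = 2 / (real k + 1) * (x * hpoly k x)" by simp
    have "2 / c * ((c + 1) * S - D) = 2 * S + 2 * (S / c) - 2 * (D / c)" if "c > 0" for c S D :: real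
      using that by (simp add: field_simps)
    from this[of "real k + 1" "hprim k x" "dprim k x"]
    have e2: "2 / (real k + 1) * ((real k + 2) * hprim k x - dprim k x) = 2 * hprim k x + 2 * (hprim k x / (real k + 1)) - 2 * (dprim k x / (real k + 1))"
      by (simp add: add.assoc)
    show ?thesis by (simp only: e1 xH e2)
  qed
  then have "x * (\<Sum>k\<le>n. real (n choose k) * (2 / (real k + 1) * hpoly k x))
     = (\<Sum>k\<le>n. real (n choose k) * (2 * hprim k x + 2 * (hprim k x / (real k + 1)) - 2 * (dprim k x / (real k + 1))))"
    unfolding sum_distrib_left by (intro sum.cong refl) (metis mult.left_commute)
  also have "\<dots> = 2 * mean_hprim n x + 2 * avg_hprim n x - 2 * (\<Sum>k\<le>n. real (n choose k) * 1 ^ k * dprim k x / (real k + 1))"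
    unfolding mean_hprim_def avg_hprim_def by (simp add: distrib_left right_diff_distrib sum.distrib sum_subtractf sum_distrib_left mult_ac)
  finally show ?thesis unfolding mean_prim_def bern_avg_binomial_sum by simp
qed

section \<open>The fixed point and the constant\<close>

definition m\<^sub>\<beta> :: "real \<Rightarrow> real" where "m\<^sub>\<beta> x = (x * (1 - x)) powr (\<beta> / 2)"

definition F\<^sub>\<beta> :: "real \<Rightarrow> real" where "F\<^sub>\<beta> y = integral {0..y} m\<^sub>\<beta>"

text \<open>\<open>h\<^sub>\<beta> x\<close> is the closed form of \<open>\<integral>\<^sub>x\<^sup>1 t powr \<beta> * m\<^sub>\<beta> (x / t) dt\<close>, and \<open>S\<^sub>\<beta>\<close> is its primitive.\<close>

definition h\<^sub>\<beta> :: "real \<Rightarrow> real" where "h\<^sub>\<beta> x = 2 / (\<beta> + 2) * m\<^sub>\<beta> x * (1 - x)"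

definition S\<^sub>\<beta> :: "real \<Rightarrow> real" where "S\<^sub>\<beta> y = (y * h\<^sub>\<beta> y + F\<^sub>\<beta> y) / (\<beta> + 2)"

lemma continuous_on_m: "continuous_on {0..1} m\<^sub>\<beta>"
  unfolding m\<^sub>\<beta>_def by (intro continuous_on_powr' continuous_intros) auto

lemma F_0 [simp]: "F\<^sub>\<beta> 0 = 0" by (simp add: F\<^sub>\<beta>_def)

lemma h_1 [simp]: "h\<^sub>\<beta> 1 = 0" by (simp add: h\<^sub>\<beta>_def)

lemma
  shows continuous_on_F: "continuous_on {0..1} F\<^sub>\<beta>"
    and DERIV_F: "z \<in> {0<..<1} \<Longrightarrow> (F\<^sub>\<beta> has_real_derivative m\<^sub>\<beta> z) (at z)"
proof -
  have d: "((\<lambda>u. integral {0..u} m\<^sub>\<beta>) has_real_derivative m\<^sub>\<beta> z) (at z within {0..1})" if "z \<in> {0..1}" for z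
    by (rule integral_has_real_derivative[OF continuous_on_m that])
  then show "continuous_on {0..1} F\<^sub>\<beta>"
    unfolding F\<^sub>\<beta>_def[abs_def] by (rule DERIV_continuous_on)
  show "(F\<^sub>\<beta> has_real_derivative m\<^sub>\<beta> z) (at z)" if "z \<in> {0<..<1}"
    using d[of z] that unfolding F\<^sub>\<beta>_def[abs_def] by (simp add: at_within_Icc_at)
qed

lemma continuous_on_h: "continuous_on {0..1} h\<^sub>\<beta>"
  unfolding h\<^sub>\<beta>_def by (intro continuous_intros continuous_on_m)

text \<open>Once the derivative of \<open>m\<^sub>\<beta>\<close> is inserted, a common factor
  splits off and the linear identity \<beta> * (1 - 2 * z) - 2 * z = 2 * (\<beta> + 1) * (1 - z) -
  (\<beta> + 2) remains.\<close>

lemma DERIV_h: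
  assumes z: "z \<in> {0<..<1}"
  shows "(h\<^sub>\<beta> has_real_derivative ((\<beta> + 1) * h\<^sub>\<beta> z - m\<^sub>\<beta> z) / z) (at z)"
proof -
  have z': "z > 0" "1 - z > 0" using z by auto
  have p: "(z * (1 - z)) powr (\<beta> / 2 - 1) = m\<^sub>\<beta> z / (z * (1 - z))"
    unfolding m\<^sub>\<beta>_def using z' by (simp add: powr_diff)
  have "((\<lambda>x. x * (1 - x)) has_real_derivative (1 - 2 * z)) (at z)"
    by (auto intro!: derivative_eq_intros)
  from DERIV_chain2[where g = "\<lambda>x. x * (1 - x)", OF has_real_derivative_powr[of "z * (1 - z)" "\<beta> / 2"] this] z'
  have "(m\<^sub>\<beta> has_real_derivative (\<beta> / 2 * (z * (1 - z)) powr (\<beta> / 2 - 1) * (1 - 2 * z))) (at z)"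
    unfolding m\<^sub>\<beta>_def[abs_def] by simp
  then have dm: "(m\<^sub>\<beta> has_real_derivative (\<beta> / 2 * (m\<^sub>\<beta> z / (z * (1 - z))) * (1 - 2 * z))) (at z)"
    unfolding p .
  have d1: "((\<lambda>x. 1 - x) has_real_derivative (-1)) (at z)" by (auto intro!: derivative_eq_intros)
  have "(h\<^sub>\<beta> has_real_derivative
      ((2 / (\<beta> + 2) * (\<beta> / 2 * (m\<^sub>\<beta> z / (z * (1 - z))) * (1 - 2 * z))) * (1 - z) + (-1) * (2 / (\<beta> + 2) * m\<^sub>\<beta> z))) (at z)"
    unfolding h\<^sub>\<beta>_def[abs_def] by (rule DERIV_mult[OF DERIV_cmult[OF dm] d1])
  also have "(2 / (\<beta> + 2) * (\<beta> / 2 * (m\<^sub>\<beta> z / (z * (1 - z))) * (1 - 2 * z))) * (1 - z) + (-1) * (2 / (\<beta> + 2) * m\<^sub>\<beta> z)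
     = ((\<beta> + 1) * h\<^sub>\<beta> z - m\<^sub>\<beta> z) / z"
  proof -
    have b2: "\<beta> + 2 \<noteq> 0" using beta_pos by linarith
    have key: "(2 / B * (b / 2 * (M / (z * w)) * (w - z))) * w + (-1) * (2 / B * M)
        = ((b + 1) * (2 / B * M * w) - M) / z" if "w \<noteq> 0" "B \<noteq> 0" "B = b + 2" "w = 1 - z" for w b B M :: real
    proof -
      have "(2 / B * (b / 2 * (M / (z * w)) * (w - z))) * w + (-1) * (2 / B * M) = (b * (w - z) - 2 * z) * M / (B * z)"
        using that(1,2) z' by (simp add: field_simps)
      moreover have "((b + 1) * (2 / B * M * w) - M) / z = ((b + 1) * 2 * w - B) * M / (B * z)"
        using that(1,2) z' by (simp add: field_simps)
      moreover have "b * (w - z) - 2 * z = (b + 1) * 2 * w - B"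
        unfolding that(3,4) by (simp add: algebra_simps)
      ultimately show ?thesis by simp
    qed
    show ?thesis
      using key[of "1 - z" "\<beta> + 2" \<beta> "m\<^sub>\<beta> z"] z' b2 unfolding h\<^sub>\<beta>_def by simp
  qed
  finally show ?thesis .
qed

lemma
  assumes y: "y \<in> {0..1}"
  shows S_integral: "((\<lambda>t. t powr (\<beta> + 1) * F\<^sub>\<beta> (min 1 (y / t))) has_integral S\<^sub>\<beta> y) {0..1}"
    and h_integral: "(h\<^sub>\<beta> has_integral S\<^sub>\<beta> y) {0..y}"
proof -
  show "(h\<^sub>\<beta> has_integral S\<^sub>\<beta> y) {0..y}"
    unfolding S\<^sub>\<beta>_def
    by (rule integral_scaling_solution[OF _ continuous_on_F DERIV_F F_0 continuous_on_h h_1 DERIV_h y]) auto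
  show "((\<lambda>t. t powr (\<beta> + 1) * F\<^sub>\<beta> (min 1 (y / t))) has_integral S\<^sub>\<beta> y) {0..1}"
    unfolding S\<^sub>\<beta>_def
    by (rule scaling_integral_primitive[OF _ continuous_on_F DERIV_F F_0 continuous_on_h h_1 DERIV_h y]) auto
qed

text \<open>Since \<open>m\<^sub>\<beta>\<close> is symmetric and (1 - x) + x = 1, the functions
  \<open>h\<^sub>\<beta>\<close> at x and 1 - x add up to 2 / (\<beta> + 2) times
  \<open>m\<^sub>\<beta>\<close>. The equation for \<beta> makes the total factor 1, and integration
  gives the claim.\<close>

lemma F_fixed_point:
  assumes y: "y \<in> {0..1}"
  shows "F\<^sub>\<beta> y = 2 / (\<beta> + 1) * (S\<^sub>\<beta> y + S\<^sub>\<beta> 1 - S\<^sub>\<beta> (1 - y))"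
proof -
  have "((\<lambda>x. 2 / (\<beta> + 1) * (h\<^sub>\<beta> x + h\<^sub>\<beta> (1 - x))) has_integral
      2 / (\<beta> + 1) * (S\<^sub>\<beta> y + (S\<^sub>\<beta> 1 - S\<^sub>\<beta> (1 - y)))) {0..y}"
    using y by (intro has_integral_mult_right has_integral_add h_integral has_integral_reflect_01[where f = "h\<^sub>\<beta>"])
  moreover have "2 / (\<beta> + 1) * (h\<^sub>\<beta> x + h\<^sub>\<beta> (1 - x)) = m\<^sub>\<beta> x" for x
  proof -
    have "m\<^sub>\<beta> (1 - x) = m\<^sub>\<beta> x" by (simp add: m\<^sub>\<beta>_def mult.commute)
    then have "h\<^sub>\<beta> x + h\<^sub>\<beta> (1 - x) = 2 / (\<beta> + 2) * m\<^sub>\<beta> x" 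
      unfolding h\<^sub>\<beta>_def by (simp only:) (simp only: distrib_left[symmetric], simp)
    then show ?thesis using beta_eq' by (simp only: mult.assoc[symmetric] mult_1_left)
  qed
  ultimately have "(m\<^sub>\<beta> has_integral 2 / (\<beta> + 1) * (S\<^sub>\<beta> y + (S\<^sub>\<beta> 1 - S\<^sub>\<beta> (1 - y)))) {0..y}" by simp
  then show ?thesis unfolding F\<^sub>\<beta>_def by (simp add: integral_unique add_diff_eq)
qed

lemma F_1: "F\<^sub>\<beta> 1 = Gamma (\<beta> / 2 + 1) ^ 2 / Gamma (\<beta> + 2)"
proof -
  have "((\<lambda>t. t powr (\<beta> / 2 + 1 - 1) * (1 - t) powr (\<beta> / 2 + 1 - 1)) has_integral Beta (\<beta> / 2 + 1) (\<beta> / 2 + 1)) {0..1}"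
    by (rule has_integral_Beta_real) (use beta_pos in linarith)+
  then have "(m\<^sub>\<beta> has_integral Beta (\<beta> / 2 + 1) (\<beta> / 2 + 1)) {0..1}"
    by (rule has_integral_eq[rotated]) (auto simp: m\<^sub>\<beta>_def powr_mult)
  then show ?thesis unfolding F\<^sub>\<beta>_def by (simp add: integral_unique Beta_def power2_eq_square)
qed

lemma Gamma_pos_beta: "Gamma (\<beta> / 2 + 1) > 0" "Gamma (\<beta> + 1) > 0" "Gamma (\<beta> + 2) > 0" "Gamma (2 * \<beta> + 2) > 0"
  using beta_bounds by (auto intro!: Gamma_real_pos)

text \<open>The origin of \<open>K0\<close>: the limit of the rescaled total integral, divided by
  the Beta integral of the profile. The functional equation of Gamma and (\<beta> + 1) * (\<beta> +
  2) = 4 reconcile the two forms.\<close>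

lemma K0_F_1: "K0 * F\<^sub>\<beta> 1 = Gamma (3 + 2 * \<beta>) / (Gamma (\<beta> + 1) * Gamma (2 + \<beta>) * Gamma (3 + \<beta>))"
proof -
  have nn: "\<beta> + 1 \<notin> \<int>\<^sub>\<le>\<^sub>0" "\<beta> + 2 \<notin> \<int>\<^sub>\<le>\<^sub>0" "2 * \<beta> + 2 \<notin> \<int>\<^sub>\<le>\<^sub>0"
    using beta_bounds by (auto dest!: nonpos_Ints_nonpos)
  have g2: "Gamma (2 + \<beta>) = (\<beta> + 1) * Gamma (\<beta> + 1)"
    using Gamma_plus1[OF nn(1)] by (simp add: add_ac)
  have g3: "Gamma (3 + \<beta>) = (\<beta> + 2) * ((\<beta> + 1) * Gamma (\<beta> + 1))"
    using Gamma_plus1[OF nn(2)] g2 by (simp add: add_ac)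
  have g4: "Gamma (3 + 2 * \<beta>) = 2 * (\<beta> + 1) * Gamma (2 * \<beta> + 2)"
    using Gamma_plus1[OF nn(3)] by (simp add: add_ac)
  have "K0 * F\<^sub>\<beta> 1 = Gamma (2 * \<beta> + 2) / (2 * Gamma (\<beta> + 1) ^ 3)"
    unfolding K0_def F_1 using Gamma_pos_beta by (simp add: field_simps)
  also have "\<dots> = Gamma (3 + 2 * \<beta>) / (Gamma (\<beta> + 1) * Gamma (2 + \<beta>) * Gamma (3 + \<beta>))"
  proof -
    have "2 * B * G / (g * (B * g) * (C * (B * g))) = 2 * G / ((B * C) * g ^ 3)"
      if "B > 0" "C > 0" "g > 0" for B C g G :: real
      using that by (simp add: field_simps power3_eq_cube)
    from this[of "\<beta> + 1" "\<beta> + 2" "Gamma (\<beta> + 1)" "Gamma (2 * \<beta> + 2)"] show ?thesis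
      unfolding g2 g3 g4 beta_eq using Gamma_pos_beta beta_bounds by simp
  qed
  finally show ?thesis .
qed

lemma mean_prim_1_asymp: "(\<lambda>n. mean_prim n 1 / real n powr \<beta>) \<longlonglongrightarrow> K0 * F\<^sub>\<beta> 1"
  unfolding mean_prim_def dprim_1 K0_F_1 by (rule binomial_sum_av_coeff_asymp) (use beta_bounds in auto)

section \<open>Convergence\<close>

text \<open>Completing the square absorbs a binomial fluctuation into an arbitrarily small multiple
  of the main order plus a constant.\<close>

lemma powr_half_le:
  assumes "c \<ge> 0" "\<eta> > 0"
  shows "c * real n powr (\<beta> / 2) \<le> \<eta> * real n powr \<beta> + c\<^sup>2 / (4 * \<eta>)"
proof -
  define z where "z = real n powr (\<beta> / 2)"
  have z: "real n powr \<beta> = z\<^sup>2"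
    unfolding z_def power2_eq_square by (simp add: powr_add[symmetric])
  have "0 \<le> (2 * \<eta> * z - c)\<^sup>2 / (4 * \<eta>)" using assms by simp
  also have "(2 * \<eta> * z - c)\<^sup>2 / (4 * \<eta>) = \<eta> * z\<^sup>2 + c\<^sup>2 / (4 * \<eta>) - c * z"
    using assms by (simp add: power2_eq_square field_simps)
  finally show ?thesis unfolding z z_def[symmetric] by simp
qed

text \<open>The additive constant makes the estimate hold for every n. This matters because it will
  be averaged over binomial indices, which may be small.\<close>

lemma limit_imp_error_bound:
  assumes "(\<lambda>n. u n / real n powr \<beta>) \<longlonglongrightarrow> L" "\<epsilon> > 0"
  shows "\<exists>C\<ge>0. \<forall>n. \<bar>u n - L * real n powr \<beta>\<bar> \<le> \<epsilon> * real n powr \<beta> + C"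
proof -
  obtain N where N: "\<And>n. n \<ge> N \<Longrightarrow> \<bar>u n / real n powr \<beta> - L\<bar> < \<epsilon>"
    using LIMSEQ_D[OF assms] by auto
  define C where "C = (\<Sum>n\<le>N. \<bar>u n - L * real n powr \<beta>\<bar>)"
  have C0: "C \<ge> 0" unfolding C_def by (intro sum_nonneg) auto
  have "\<bar>u n - L * real n powr \<beta>\<bar> \<le> \<epsilon> * real n powr \<beta> + C" for n
  proof (cases "n \<le> N")
    case True
    then have "\<bar>u n - L * real n powr \<beta>\<bar> \<le> C" unfolding C_def
      by (intro member_le_sum) auto
    then show ?thesis using assms(2) by (simp add: add_increasing)
  next
    case False
    then have p: "real n powr \<beta> > 0" by auto
    have "u n - L * real n powr \<beta> = (u n / real n powr \<beta> - L) * real n powr \<beta>"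
      using p by (simp add: field_simps)
    then have "\<bar>u n - L * real n powr \<beta>\<bar> = \<bar>u n / real n powr \<beta> - L\<bar> * real n powr \<beta>"
      using p by (simp add: abs_mult)
    also have "\<dots> \<le> \<epsilon> * real n powr \<beta>" using N[of n] False by (intro mult_right_mono) auto
    finally show ?thesis using C0 by simp
  qed
  then show ?thesis using C0 by blast
qed

lemma error_bound_imp_limit:
  assumes "\<And>\<epsilon>. \<epsilon> > 0 \<Longrightarrow> \<exists>C. \<forall>n. \<bar>u n - L * real n powr \<beta>\<bar> \<le> \<epsilon> * real n powr \<beta> + C"
  shows "(\<lambda>n. u n / real n powr \<beta>) \<longlonglongrightarrow> L"
proof (rule LIMSEQ_I)
  fix e :: real assume e: "e > 0"
  obtain C where C: "\<And>n. \<bar>u n - L * real n powr \<beta>\<bar> \<le> e / 2 * real n powr \<beta> + C"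
    using assms[of "e / 2"] e by auto
  have "filterlim (\<lambda>n. real n powr \<beta>) at_top sequentially"
    using beta_pos(1) by real_asymp
  then have "\<forall>\<^sub>F n in sequentially. real n powr \<beta> \<ge> 2 * \<bar>C\<bar> / e + 1"
    by (simp add: filterlim_at_top)
  then obtain N where N: "\<And>n. n \<ge> N \<Longrightarrow> real n powr \<beta> \<ge> 2 * \<bar>C\<bar> / e + 1"
    by (auto simp: eventually_sequentially)
  show "\<exists>no. \<forall>n\<ge>no. norm (u n / real n powr \<beta> - L) < e"
  proof (intro exI[of _ N] allI impI)
    fix n assume "n \<ge> N"
    note N = N[OF this]
    have p: "real n powr \<beta> > 0"
    proof -
      have "2 * \<bar>C\<bar> / e \<ge> 0" using e by simp
      then show ?thesis using N by linarith
    qed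
    have "2 * \<bar>C\<bar> / e < real n powr \<beta>" using N by linarith
    then have c: "C < e / 2 * real n powr \<beta>" using e by (simp add: field_simps abs_if split: if_splits)
    have "norm (u n / real n powr \<beta> - L) = \<bar>u n - L * real n powr \<beta>\<bar> / real n powr \<beta>"
    proof -
      have "u n / real n powr \<beta> - L = (u n - L * real n powr \<beta>) / real n powr \<beta>"
        using p by (simp add: diff_divide_distrib)
      then show ?thesis by (simp only: real_norm_def abs_divide) simp
    qed
    also have "\<dots> < e"
    proof -
      have "\<bar>u n - L * real n powr \<beta>\<bar> < e * real n powr \<beta>" using C[of n] c by linarith
      then show ?thesis using p by (simp add: field_simps)
    qed
    finally show "norm (u n / real n powr \<beta> - L) < e" .
  qed
qed

text \<open>A common argument for \<open>bern_avg\<close> and \<open>bern_mean\<close>, which are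
  positive, linear and preserve constants. Upper and lower bounds on u are affine in the \<beta>-th
  power of j, so monotonicity only requires the image of that power.\<close>

lemma operator_approx:
  fixes T :: "(nat \<Rightarrow> real) \<Rightarrow> real"
  assumes add: "\<And>u w. T (\<lambda>j. u j + w j) = T u + T w" and cm: "\<And>c u. T (\<lambda>j. c * u j) = c * T u"
    and const: "\<And>c. T (\<lambda>_. c) = c" and mono: "\<And>u w. (\<And>j. u j \<le> w j) \<Longrightarrow> T u \<le> T w"
    and p: "\<bar>T (\<lambda>j. real j powr \<beta>) - g\<bar> \<le> d"
    and u: "\<And>j. \<bar>u j - L * real j powr \<beta>\<bar> \<le> D * real j powr \<beta> + C" and D: "D \<ge> 0"
  shows "\<bar>T u - L * g\<bar> \<le> D * g + (C + (D + \<bar>L\<bar>) * d)"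
proof -
  let ?p = "T (\<lambda>j. real j powr \<beta>)"
  have "T u \<le> T (\<lambda>j. (L + D) * real j powr \<beta> + C)"
    by (rule mono) (use u in \<open>simp add: abs_le_iff algebra_simps\<close>)
  then have 1: "T u \<le> (L + D) * ?p + C" by (simp only: add cm const)
  have "T (\<lambda>j. (L - D) * real j powr \<beta> + (- C)) \<le> T u"
  proof (rule mono)
    fix j show "(L - D) * real j powr \<beta> + (- C) \<le> u j"
      using u[of j] by (simp add: abs_le_iff algebra_simps)
  qed
  then have 2: "(L - D) * ?p + (- C) \<le> T u" by (simp only: add cm const)
  have "\<bar>(L + D) * (?p - g)\<bar> \<le> (D + \<bar>L\<bar>) * d" "\<bar>(L - D) * (?p - g)\<bar> \<le> (D + \<bar>L\<bar>) * d"
    unfolding abs_mult using p D by (intro mult_mono; simp)+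
  then have 3: "(L + D) * ?p \<le> (L + D) * g + (D + \<bar>L\<bar>) * d" "(L - D) * ?p \<ge> (L - D) * g - (D + \<bar>L\<bar>) * d"
    by (auto simp: abs_le_iff right_diff_distrib)
  have "T u - L * g \<le> D * g + (C + (D + \<bar>L\<bar>) * d)"
    using 1 3(1) unfolding distrib_right by linarith
  moreover have "- (T u - L * g) \<le> D * g + (C + (D + \<bar>L\<bar>) * d)"
    using 2 3(2) unfolding left_diff_distrib by linarith
  ultimately show ?thesis by (simp add: abs_le_iff)
qed

lemma bern_avg_approx:
  assumes "0 \<le> t" "t \<le> 1" "\<And>j. \<bar>u j - L * real j powr \<beta>\<bar> \<le> D * real j powr \<beta> + C" "D \<ge> 0"
  shows "\<bar>bern_avg n t u - L * ((real n * t) powr \<beta> / (\<beta> + 1))\<bar>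
    \<le> D * ((real n * t) powr \<beta> / (\<beta> + 1)) + (C + (D + \<bar>L\<bar>) * (2 * real n powr (\<beta> / 2)))"
  by (rule operator_approx)
     (use assms beta_bounds in \<open>auto simp: bern_avg_add bern_avg_cmult intro!: bern_avg_mono bern_avg_powr\<close>)

lemma bern_mean_approx:
  assumes "0 \<le> t" "t \<le> 1" "\<And>j. \<bar>u j - L * real j powr \<beta>\<bar> \<le> D * real j powr \<beta> + C" "D \<ge> 0"
  shows "\<bar>bern_mean n t u - L * (real n * t) powr \<beta>\<bar>
    \<le> D * (real n * t) powr \<beta> + (C + (D + \<bar>L\<bar>) * (2 * real n powr (\<beta> / 2)))"
  by (rule operator_approx)
     (use assms beta_bounds in \<open>auto simp: bern_mean_add bern_mean_cmult intro!: bern_mean_mono bern_mean_powr\<close>)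

lemma integral_approx:
  assumes y: "y \<in> {0..1}" and G: "((\<lambda>t. t * G t) has_integral q) {0..1}"
    and I: "((\<lambda>t. t powr (\<beta> + 1) * \<delta> t) has_integral I) {0..1}" and c: "c > 0" and C: "C \<ge> 0"
    and le: "\<And>t. t \<in> {0<..1} \<Longrightarrow> \<bar>G t - L * F\<^sub>\<beta> (min 1 (y / t)) * ((real n * t) powr \<beta> / c)\<bar>
        \<le> \<delta> t * ((real n * t) powr \<beta> / c) + C"
  shows "\<bar>q - L * (real n powr \<beta> / c) * S\<^sub>\<beta> y\<bar> \<le> real n powr \<beta> / c * I + C"
proof -
  let ?N = "real n powr \<beta> / c"
  have d: "((\<lambda>t. t * G t - L * ?N * (t powr (\<beta> + 1) * F\<^sub>\<beta> (min 1 (y / t)))) has_integral (q - L * ?N * S\<^sub>\<beta> y)) {0..1}"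
    by (intro has_integral_diff G has_integral_mult_right S_integral y)
  have b: "((\<lambda>t. ?N * (t powr (\<beta> + 1) * \<delta> t) + C) has_integral (?N * I + C)) {0..1}"
    using has_integral_add[OF has_integral_mult_right[OF I, of ?N] has_integral_const_real[of C 0 1]] by simp
  have "norm (integral {0..1} (\<lambda>t. t * G t - L * ?N * (t powr (\<beta> + 1) * F\<^sub>\<beta> (min 1 (y / t)))))
    \<le> integral {0..1} (\<lambda>t. ?N * (t powr (\<beta> + 1) * \<delta> t) + C)"
  proof (rule integral_norm_bound_integral)
    fix t :: real assume t: "t \<in> {0..1}"
    show "norm (t * G t - L * ?N * (t powr (\<beta> + 1) * F\<^sub>\<beta> (min 1 (y / t)))) \<le> ?N * (t powr (\<beta> + 1) * \<delta> t) + C"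
    proof (cases "t = 0")
      case True
      then show ?thesis using C by simp
    next
      case False
      then have t': "t \<in> {0<..1}" "t > 0" using t by auto
      have e: "t * ((real n * t) powr \<beta> / c) = ?N * t powr (\<beta> + 1)"
        using t' by (simp add: powr_mult powr_add)
      have "t * G t - L * ?N * (t powr (\<beta> + 1) * F\<^sub>\<beta> (min 1 (y / t)))
          = t * G t - L * F\<^sub>\<beta> (min 1 (y / t)) * (?N * t powr (\<beta> + 1))" by (simp add: mult_ac)
      also have "\<dots> = t * (G t - L * F\<^sub>\<beta> (min 1 (y / t)) * ((real n * t) powr \<beta> / c))"
        unfolding e[symmetric] by (simp add: right_diff_distrib mult_ac)
      finally have "norm (t * G t - L * ?N * (t powr (\<beta> + 1) * F\<^sub>\<beta> (min 1 (y / t))))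
          = t * \<bar>G t - L * F\<^sub>\<beta> (min 1 (y / t)) * ((real n * t) powr \<beta> / c)\<bar>"
        using t' by (simp add: abs_mult)
      also have "\<dots> \<le> t * (\<delta> t * ((real n * t) powr \<beta> / c) + C)"
        using le[OF t'(1)] t' by (intro mult_left_mono) auto
      also have "\<dots> = \<delta> t * (t * ((real n * t) powr \<beta> / c)) + t * C" by (simp add: algebra_simps)
      also have "\<dots> \<le> ?N * (t powr (\<beta> + 1) * \<delta> t) + C"
        unfolding e using C t' mult_left_le_one_le[of C t] by (simp add: mult_ac)
      finally show ?thesis .
    qed
  qed (use d b in \<open>auto dest: has_integral_integrable\<close>)
  then show ?thesis using integral_unique[OF d] integral_unique[OF b] by simp
qed

lemma abs_combination_le:
  fixes a b c a' b' c' :: real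
  shows "\<bar>(2 * a + 2 * b - 2 * c) - (2 * a' + 2 * b' - 2 * c')\<bar> \<le> 2 * (\<bar>a - a'\<bar> + \<bar>b - b'\<bar> + \<bar>c - c'\<bar>)"
proof (rule abs_leI)
  note ge = abs_ge_self abs_ge_minus_self
  show "(2 * a + 2 * b - 2 * c) - (2 * a' + 2 * b' - 2 * c') \<le> 2 * (\<bar>a - a'\<bar> + \<bar>b - b'\<bar> + \<bar>c - c'\<bar>)"
    using ge(1)[of "a - a'"] ge(1)[of "b - b'"] ge(2)[of "c - c'"] by argo
  show "- ((2 * a + 2 * b - 2 * c) - (2 * a' + 2 * b' - 2 * c')) \<le> 2 * (\<bar>a - a'\<bar> + \<bar>b - b'\<bar> + \<bar>c - c'\<bar>)"
    using ge(2)[of "a - a'"] ge(2)[of "b - b'"] ge(1)[of "c - c'"] by argo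
qed

section \<open>Uniform convergence of the primitives\<close>

lemma m_nonneg: "m\<^sub>\<beta> x \<ge> 0" by (simp add: m\<^sub>\<beta>_def)

lemma F_bounds:
  assumes "y \<in> {0..1}" shows "0 \<le> F\<^sub>\<beta> y" "F\<^sub>\<beta> y \<le> F\<^sub>\<beta> 1"
proof -
  have i: "m\<^sub>\<beta> integrable_on {0..y}" "m\<^sub>\<beta> integrable_on {0..1}"
    using assms by (auto intro!: integrable_continuous_interval continuous_on_subset[OF continuous_on_m])
  show "0 \<le> F\<^sub>\<beta> y" unfolding F\<^sub>\<beta>_def using i m_nonneg by (intro integral_nonneg) auto
  show "F\<^sub>\<beta> y \<le> F\<^sub>\<beta> 1" unfolding F\<^sub>\<beta>_def
    using i m_nonneg assms by (intro integral_subset_le) auto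
qed

lemma K0_pos: "K0 > 0"
  unfolding K0_def using Gamma_pos_beta by simp

lemma mean_crossed_nonneg: "x \<in> {0..1} \<Longrightarrow> 0 \<le> mean_crossed n x"
  using rect_mean_nonneg[of x n] mean_crossed[of x n] by simp

lemma mean_prim_eq_integral: "mean_prim n y = integral {0..y} (mean_crossed n)"
  unfolding mean_prim_def dprim_def mean_crossed_def[abs_def]
  by (subst integral_sum) (auto intro!: integrable_on_mult_right poly_integrable)

lemma mean_prim_bounds:
  assumes "y \<in> {0..1}" shows "0 \<le> mean_prim n y" "mean_prim n y \<le> mean_prim n 1"
proof -
  have i: "mean_crossed n integrable_on {0..r}" for r
    unfolding mean_crossed_def[abs_def]
    by (intro integrable_continuous_interval continuous_intros)
  show "0 \<le> mean_prim n y" unfolding mean_prim_eq_integral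
    using i assms by (auto intro!: integral_nonneg mean_crossed_nonneg)
  show "mean_prim n y \<le> mean_prim n 1" unfolding mean_prim_eq_integral
    using i assms by (auto intro!: integral_subset_le mean_crossed_nonneg)
qed

lemma mean_prim_0_1: "mean_prim 0 1 = 1"
  by (simp add: mean_prim_def dprim_1 av_coeff_def)

text \<open>D is the error relative to the main order, the quantity that contracts; C takes up small
  n and lower-order terms. Uniformity in y is needed because the recursion evaluates primitives at y
  / t for all t.\<close>

definition mean_prim_error_bound :: "real \<Rightarrow> real \<Rightarrow> bool" where
  "mean_prim_error_bound D C \<longleftrightarrow>
     (\<forall>n. \<forall>y\<in>{0..1}. \<bar>mean_prim n y - K0 * F\<^sub>\<beta> y * real n powr \<beta>\<bar> \<le> D * real n powr \<beta> + C)"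

text \<open>Both primitives are nonnegative and increasing in y, so their values at 1, where the
  asymptotics is known, bound the difference.\<close>

lemma mean_prim_error_bound_initial: "\<exists>D C. 0 \<le> D \<and> 0 \<le> C \<and> mean_prim_error_bound D C"
proof -
  obtain C where C: "C \<ge> 0" "\<And>n. \<bar>mean_prim n 1 - K0 * F\<^sub>\<beta> 1 * real n powr \<beta>\<bar> \<le> 1 * real n powr \<beta> + C"
    using limit_imp_error_bound[OF mean_prim_1_asymp, of 1] by auto
  have K: "K0 * F\<^sub>\<beta> 1 \<ge> 0" using K0_pos F_bounds(1)[of 1] by simp
  have "\<bar>mean_prim n y - K0 * F\<^sub>\<beta> y * real n powr \<beta>\<bar> \<le> (K0 * F\<^sub>\<beta> 1 + 1) * real n powr \<beta> + C"
    if y: "y \<in> {0..1}" for n y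
  proof -
    have "mean_prim n 1 \<le> (K0 * F\<^sub>\<beta> 1 + 1) * real n powr \<beta> + C"
      using C(2)[of n] by (simp add: abs_le_iff algebra_simps)
    moreover have "K0 * F\<^sub>\<beta> y * real n powr \<beta> \<le> (K0 * F\<^sub>\<beta> 1 + 1) * real n powr \<beta>"
      using F_bounds[OF y] K0_pos by (intro mult_right_mono add_increasing2 mult_left_mono) auto
    moreover have "0 \<le> K0 * F\<^sub>\<beta> y * real n powr \<beta>"
      using F_bounds[OF y] K0_pos by simp
    ultimately show ?thesis using mean_prim_bounds[OF y, of n] C(1) by linarith
  qed
  then have "mean_prim_error_bound (K0 * F\<^sub>\<beta> 1 + 1) C" by (auto simp: mean_prim_error_bound_def)
  then show ?thesis using C(1) K by (intro exI[of _ "K0 * F\<^sub>\<beta> 1 + 1"] exI[of _ C]) auto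
qed

lemma powr_sum_ge:
  assumes "y \<in> {0..1}"
  shows "1 / 8 \<le> y powr (\<beta> + 2) + (1 - y) powr (\<beta> + 2)"
proof -
  have le: "1 / 8 \<le> z powr (\<beta> + 2)" if "1 / 2 \<le> z" for z :: real
  proof -
    \<comment> \<open>The exponent \<beta> + 2 is below 3, which is where 1 / 8 comes from.\<close>
    have "(1 / 2) powr 3 \<le> (1 / 2) powr (\<beta> + 2)" using beta_bounds by (intro powr_mono') auto
    also have "\<dots> \<le> z powr (\<beta> + 2)" using that beta_bounds by (intro powr_mono2) auto
    finally show ?thesis by (simp add: power3_eq_cube)
  qed
  show ?thesis
  proof (cases "1 / 2 \<le> y")
    case True
    then show ?thesis using le[of y] by (simp add: add_increasing2)
  next
    case False
    then show ?thesis using le[of "1 - y"] by (simp add: add_increasing)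
  qed
qed

text \<open>
  For \<open>t \<le> y\<close> the primitive is evaluated at \<open>min 1 (y / t) = 1\<close>, where its relative error is at most
  \<open>\<epsilon>\<close>.  As \<open>y\<close> or \<open>1 - y\<close> is at least \<open>1 / 2\<close>, this gains the factor \<open>15 / 16\<close>.
\<close>

lemma mean_prim_error_bound_contract:
  assumes "D \<ge> 0" "C \<ge> 0" and P: "mean_prim_error_bound D C" and \<eta>: "\<eta> > 0"
  shows "\<exists>C'\<ge>0. mean_prim_error_bound (15 / 16 * D + \<eta>) C'"
proof -
  \<comment> \<open>The final error is 15 / 16 * D + 5 / 2 * \<open>\<epsilon>\<close>: the scales
    with known error contribute 3 / 2, the binomial fluctuation contributes 1.\<close>
  define \<epsilon> where "\<epsilon> = \<eta> / 4"
  have \<epsilon>: "\<epsilon> > 0" using \<eta> by (simp add: \<epsilon>_def)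
  obtain C1 where C1: "C1 \<ge> 0" "\<And>n. \<bar>mean_prim n 1 - K0 * F\<^sub>\<beta> 1 * real n powr \<beta>\<bar> \<le> \<epsilon> * real n powr \<beta> + C1"
    using limit_imp_error_bound[OF mean_prim_1_asymp \<epsilon>] by auto
  define K where "K = K0 * F\<^sub>\<beta> 1"
  have K: "K \<ge> 0" using K0_pos F_bounds(1)[of 1] by (simp add: K_def)
  have KF: "0 \<le> K0 * F\<^sub>\<beta> z" "K0 * F\<^sub>\<beta> z \<le> K" if "z \<in> {0..1}" for z
    using F_bounds[OF that] K0_pos by (auto simp: K_def)
  define Cn where "Cn n = C + C1 + (D + \<epsilon> + K) * (2 * real n powr (\<beta> / 2))" for n
  have Cn: "Cn n \<ge> 0" for n unfolding Cn_def using assms C1 \<epsilon> K by simp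
  \<comment> \<open>The integral of t powr (\<beta> + 1) against the weight that is
    \<open>\<epsilon>\<close> on [0, y] and D beyond.\<close>
  define I where "I y = (D - (D - \<epsilon>) * y powr (\<beta> + 2)) / (\<beta> + 2)" for y
  have Q: "\<bar>avg_hprim n y - K0 * (real n powr \<beta> / (\<beta> + 1)) * S\<^sub>\<beta> y\<bar> \<le> real n powr \<beta> / (\<beta> + 1) * I y + Cn n"
    if y: "y \<in> {0..1}" for n y
  proof (rule integral_approx[OF y avg_hprim_integral[OF y], where \<delta> = "\<lambda>t. if t \<in> {0..y} then \<epsilon> else D"])
    have "((\<lambda>t. t powr (\<beta> + 1)) has_integral y powr (\<beta> + 1 + 1) / (\<beta> + 1 + 1)) {0..y}"
      using y beta_bounds by (intro has_integral_powr_01) auto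
    then have "((\<lambda>t. if t \<in> {0..y} then t powr (\<beta> + 1) else 0) has_integral y powr (\<beta> + 1 + 1) / (\<beta> + 1 + 1)) {0..1}"
      using y by (subst has_integral_restrict) auto
    moreover have "((\<lambda>t. t powr (\<beta> + 1)) has_integral 1 powr (\<beta> + 1 + 1) / (\<beta> + 1 + 1)) {0..1}"
      using beta_bounds by (intro has_integral_powr_01) auto
    ultimately have "((\<lambda>t. D * t powr (\<beta> + 1) - (D - \<epsilon>) * (if t \<in> {0..y} then t powr (\<beta> + 1) else 0)) has_integral
        (D * (1 powr (\<beta> + 1 + 1) / (\<beta> + 1 + 1)) - (D - \<epsilon>) * (y powr (\<beta> + 1 + 1) / (\<beta> + 1 + 1)))) {0..1}"
      by (intro has_integral_diff has_integral_mult_right)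
    moreover have "D * (1 powr (\<beta> + 1 + 1) / (\<beta> + 1 + 1)) - (D - \<epsilon>) * (y powr (\<beta> + 1 + 1) / (\<beta> + 1 + 1)) = I y"
      unfolding I_def by (simp add: diff_divide_distrib add.commute)
    moreover have "D * t powr (\<beta> + 1) - (D - \<epsilon>) * (if t \<in> {0..y} then t powr (\<beta> + 1) else 0)
        = t powr (\<beta> + 1) * (if t \<in> {0..y} then \<epsilon> else D)" for t
      by (simp add: algebra_simps)
    ultimately show "((\<lambda>t. t powr (\<beta> + 1) * (if t \<in> {0..y} then \<epsilon> else D)) has_integral I y) {0..1}" by simp
    show "\<beta> + 1 > 0" using beta_bounds by simp
    show "Cn n \<ge> 0" by (rule Cn)
    fix t :: real assume t: "t \<in> {0<..1}"
    define z where "z = min 1 (y / t)"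
    have z: "z \<in> {0..1}" unfolding z_def using t y by auto
    let ?\<delta> = "if t \<in> {0..y} then \<epsilon> else D"
    have "\<bar>mean_prim j z - K0 * F\<^sub>\<beta> z * real j powr \<beta>\<bar> \<le> ?\<delta> * real j powr \<beta> + (C + C1)" for j
    proof (cases "t \<in> {0..y}")
      case True
      then have "z = 1" using t by (simp add: z_def)
      then show ?thesis using C1(2)[of j] True assms(2) by simp
    next
      case False
      have "\<bar>mean_prim j z - K0 * F\<^sub>\<beta> z * real j powr \<beta>\<bar> \<le> D * real j powr \<beta> + C"
        using P z unfolding mean_prim_error_bound_def by blast
      then show ?thesis unfolding if_not_P[OF False] using C1(1) by linarith
    qed
    then have "\<bar>bern_avg n t (\<lambda>j. mean_prim j z) - K0 * F\<^sub>\<beta> z * ((real n * t) powr \<beta> / (\<beta> + 1))\<bar>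
      \<le> ?\<delta> * ((real n * t) powr \<beta> / (\<beta> + 1)) + (C + C1 + (?\<delta> + \<bar>K0 * F\<^sub>\<beta> z\<bar>) * (2 * real n powr (\<beta> / 2)))"
      by (rule bern_avg_approx[rotated 2]) (use t assms \<epsilon> in auto)
    also have "\<dots> \<le> ?\<delta> * ((real n * t) powr \<beta> / (\<beta> + 1)) + Cn n"
      unfolding Cn_def using KF[OF z] assms \<epsilon>
      by (intro add_left_mono mult_right_mono) auto
    finally show "\<bar>bern_avg n t (\<lambda>j. mean_prim j (min 1 (y / t))) - K0 * F\<^sub>\<beta> (min 1 (y / t)) * ((real n * t) powr \<beta> / (\<beta> + 1))\<bar>
       \<le> ?\<delta> * ((real n * t) powr \<beta> / (\<beta> + 1)) + Cn n"
      unfolding z_def .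
  qed
  \<comment> \<open>Three approximated terms enter with coefficient 2, and each carries a
    fluctuation with coefficient 2, hence 12.\<close>
  define B where "B = (12 * (D + \<epsilon> + K))\<^sup>2 / (4 * \<epsilon>)"
  define C' where "C' = 6 * (C + C1) + B + K + 1"
  have B: "B \<ge> 0" unfolding B_def using \<epsilon> by simp
  have C': "C' \<ge> 0" unfolding C'_def using assms C1 B K by simp
  have step: "\<bar>mean_prim (Suc n) y - K0 * F\<^sub>\<beta> y * real n powr \<beta>\<bar> \<le> (15 / 16 * D + \<eta>) * real n powr \<beta> + (6 * (C + C1) + B)"
    if y: "y \<in> {0..1}" for n y
  proof -
    let ?N = "real n powr \<beta>" and ?M = "real n powr \<beta> / (\<beta> + 1)"
    have y': "1 \<in> {0..1::real}" "1 - y \<in> {0..1}" using y by auto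
    have A2: "mean_prim (Suc n) y = 2 * avg_hprim n y + 2 * avg_hprim n 1 - 2 * avg_hprim n (1 - y)"
      unfolding mean_prim_Suc[OF y] by simp
    have KF_eq: "K0 * F\<^sub>\<beta> y * ?N = 2 * (K0 * ?M * S\<^sub>\<beta> y) + 2 * (K0 * ?M * S\<^sub>\<beta> 1) - 2 * (K0 * ?M * S\<^sub>\<beta> (1 - y))"
    proof -
      have "K0 * (2 / c * (a + b - d)) * N = 2 * (K0 * (N / c) * a) + 2 * (K0 * (N / c) * b) - 2 * (K0 * (N / c) * d)"
        if "c > 0" for a b c d N :: real
        using that by (simp add: field_simps)
      then show ?thesis unfolding F_fixed_point[OF y] using beta_bounds by simp
    qed
    have "\<bar>mean_prim (Suc n) y - K0 * F\<^sub>\<beta> y * ?N\<bar> \<le> 2 * (\<bar>avg_hprim n y - K0 * ?M * S\<^sub>\<beta> y\<bar> + \<bar>avg_hprim n 1 - K0 * ?M * S\<^sub>\<beta> 1\<bar>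
        + \<bar>avg_hprim n (1 - y) - K0 * ?M * S\<^sub>\<beta> (1 - y)\<bar>)"
      unfolding A2 KF_eq by (rule abs_combination_le)
    also have "\<dots> \<le> 2 * ((?M * I y + Cn n) + (?M * I 1 + Cn n) + (?M * I (1 - y) + Cn n))"
      by (intro mult_left_mono add_mono Q y y') auto
    also have "\<dots> = 2 * ?M * (I y + I 1 + I (1 - y)) + 6 * Cn n"
    proof -
      have "2 * ((M * a + c) + (M * b + c) + (M * d + c)) = 2 * M * (a + b + d) + 6 * c" for M a b c d :: real
        by (simp add: algebra_simps)
      then show ?thesis .
    qed
    also have "2 * ?M * (I y + I 1 + I (1 - y)) \<le> (15 / 16 * D + 3 / 2 * \<epsilon>) * ?N"
    proof -
      \<comment> \<open>The weights of D at y, 1 and 1 - y add up to 2 - p; at 1 only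
        \<open>\<epsilon>\<close> survives. As (\<beta> + 1) * (\<beta> + 2) = 4, the factor in
        front is 1 / 2, and p >= 1 / 8 yields (2 - 1 / 8) / 2 = 15 / 16.\<close>
      let ?p = "y powr (\<beta> + 2) + (1 - y) powr (\<beta> + 2)"
      have p: "1 / 8 \<le> ?p" "?p \<le> 2"
        using powr_sum_ge[OF y] y powr_le1[of "\<beta> + 2" y] powr_le1[of "\<beta> + 2" "1 - y"] beta_bounds by auto
      have "2 * ?M * (I y + I 1 + I (1 - y)) = 2 * ?N * (D * (2 - ?p) + \<epsilon> * (1 + ?p)) / ((\<beta> + 1) * (\<beta> + 2))"
      proof -
        have "I y + I 1 + I (1 - y) = (D * (2 - ?p) + \<epsilon> * (1 + ?p)) / (\<beta> + 2)"
          unfolding I_def add_divide_distrib[symmetric] by (rule arg_cong2[where f = "(/)"]) (simp_all add: algebra_simps)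
        then show ?thesis by simp
      qed
      also have "\<dots> = ?N * ((D * (2 - ?p) + \<epsilon> * (1 + ?p)) / 2)" unfolding beta_eq by simp
      also have "\<dots> \<le> ?N * ((D * (15 / 8) + \<epsilon> * 3) / 2)"
        using p assms \<epsilon> by (intro mult_left_mono divide_right_mono add_mono) auto
      also have "\<dots> = (15 / 16 * D + 3 / 2 * \<epsilon>) * ?N" by (simp add: algebra_simps)
      finally show ?thesis .
    qed
    also have "6 * Cn n \<le> 6 * (C + C1) + (\<epsilon> * ?N + B)"
    proof -
      have "12 * (D + \<epsilon> + K) * real n powr (\<beta> / 2) \<le> \<epsilon> * ?N + B"
        unfolding B_def using assms \<epsilon> K by (intro powr_half_le) auto
      then show ?thesis unfolding Cn_def by (simp add: algebra_simps)
    qed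
    finally have "\<bar>mean_prim (Suc n) y - K0 * F\<^sub>\<beta> y * ?N\<bar> \<le> (15 / 16 * D + 3 / 2 * \<epsilon>) * ?N + (6 * (C + C1) + (\<epsilon> * ?N + B))" by simp
    also have "\<dots> = (15 / 16 * D + 5 / 2 * \<epsilon>) * ?N + (6 * (C + C1) + B)" by (simp add: algebra_simps)
    also have "\<dots> \<le> (15 / 16 * D + \<eta>) * ?N + (6 * (C + C1) + B)"
      using \<eta> by (intro add_right_mono mult_right_mono) (auto simp: \<epsilon>_def)
    finally show ?thesis .
  qed
  have "\<bar>mean_prim n y - K0 * F\<^sub>\<beta> y * real n powr \<beta>\<bar> \<le> (15 / 16 * D + \<eta>) * real n powr \<beta> + C'" if y: "y \<in> {0..1}" for n y
  proof (cases n)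
    case 0
    then show ?thesis using mean_prim_bounds[OF y, of 0] mean_prim_0_1 assms C1 B K by (simp add: C'_def)
  next
    case (Suc k)
    have le: "real k powr \<beta> \<le> real n powr \<beta>" unfolding Suc by (intro powr_mono2) auto
    \<comment> \<open>The recursion compares step k + 1 with the power of k; as \<beta> < 1, the two
      powers differ by at most 1.\<close>
    have "\<bar>real n powr \<beta> - real k powr \<beta>\<bar> \<le> 1"
      using powr_diff_le[of "real n" "real k" \<beta>] beta_bounds Suc by simp
    then have "\<bar>K0 * F\<^sub>\<beta> y * (real n powr \<beta> - real k powr \<beta>)\<bar> \<le> K * 1"
      unfolding abs_mult[of "K0 * F\<^sub>\<beta> y"] using KF[OF y] K by (intro mult_mono) auto
    moreover have "(15 / 16 * D + \<eta>) * real k powr \<beta> \<le> (15 / 16 * D + \<eta>) * real n powr \<beta>"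
      using le assms \<eta> by (intro mult_left_mono) auto
    moreover have "\<bar>mean_prim n y - K0 * F\<^sub>\<beta> y * real n powr \<beta>\<bar>
        \<le> \<bar>mean_prim n y - K0 * F\<^sub>\<beta> y * real k powr \<beta>\<bar> + \<bar>K0 * F\<^sub>\<beta> y * (real n powr \<beta> - real k powr \<beta>)\<bar>"
      unfolding right_diff_distrib by linarith
    ultimately show ?thesis using step[OF y, of k] unfolding Suc[symmetric] C'_def by linarith
  qed
  then show ?thesis using C' by (auto simp: mean_prim_error_bound_def)
qed

text \<open>Iterates the contraction with a slack of D / 32 in each round, so the factor becomes 15
  / 16 + 1 / 32 = 31 / 32. Starting from D0 + 1 keeps this slack positive.\<close>

lemma mean_prim_error_bound_small:
  assumes "\<epsilon> > 0"
  shows "\<exists>C\<ge>0. mean_prim_error_bound \<epsilon> C"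
proof -
  obtain D0 C0 where D0: "0 \<le> D0" "0 \<le> C0" "mean_prim_error_bound D0 C0" using mean_prim_error_bound_initial by blast
  define D where "D = D0 + 1"
  have D: "D > 0" using D0 by (simp add: D_def)
  have mono: "mean_prim_error_bound E' C" if "mean_prim_error_bound E C" "E \<le> E'" for E E' C
    unfolding mean_prim_error_bound_def
  proof (intro allI ballI)
    fix n y assume "y \<in> {0..1::real}"
    then have "\<bar>mean_prim n y - K0 * F\<^sub>\<beta> y * real n powr \<beta>\<bar> \<le> E * real n powr \<beta> + C"
      using that(1) by (simp add: mean_prim_error_bound_def)
    also have "\<dots> \<le> E' * real n powr \<beta> + C" using that(2) by (intro add_right_mono mult_right_mono) auto
    finally show "\<bar>mean_prim n y - K0 * F\<^sub>\<beta> y * real n powr \<beta>\<bar> \<le> E' * real n powr \<beta> + C" .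
  qed
  have "\<exists>C\<ge>0. mean_prim_error_bound ((31 / 32) ^ m * D) C" for m
  proof (induction m)
    case 0
    show ?case using mono[OF D0(3), of D] D0(2) by (auto simp: D_def)
  next
    case (Suc m)
    then obtain C where C: "C \<ge> 0" "mean_prim_error_bound ((31 / 32) ^ m * D) C" by auto
    have "\<exists>C'\<ge>0. mean_prim_error_bound (15 / 16 * ((31 / 32) ^ m * D) + (31 / 32) ^ m * D / 32) C'"
      using D by (intro mean_prim_error_bound_contract[OF _ C]) auto
    moreover have "15 / 16 * ((31 / 32) ^ m * D) + (31 / 32) ^ m * D / 32 = (31 / 32) ^ Suc m * D" by simp
    ultimately show ?case by (simp only:)
  qed
  moreover obtain m where "(31 / 32 :: real) ^ m < \<epsilon> / D"
    using real_arch_pow_inv[of "\<epsilon> / D" "31 / 32"] assms D by auto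
  ultimately show ?thesis using mono D by (metis less_imp_le pos_less_divide_eq)
qed

text \<open>The contributions of pieces left and right of the cut converge separately, to the
  fractions 1 - x and x of the limit. What \<open>hpoly_sum_eq\<close> controls is z times such a
  contribution, and dividing needs z > 0.\<close>

lemma mean_crossed_asymp:
  assumes x: "x \<in> {0<..<1}"
  shows "(\<lambda>n. mean_crossed n x / real n powr \<beta>) \<longlonglongrightarrow> K0 * m\<^sub>\<beta> x"
proof -
  define X where "X z n = (\<Sum>k\<le>n. real (n choose k) * (2 / (real k + 1) * hpoly k z))" for z n
  have X: "(\<lambda>n. X z n / real n powr \<beta>) \<longlonglongrightarrow> K0 * (m\<^sub>\<beta> z * (1 - z))" if z: "z \<in> {0<..<1}" for z
  proof -
    have z': "z \<in> {0..1}" "z > 0" using z by auto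
    have "\<exists>C. \<forall>n. \<bar>z * X z n - (K0 * (z * (m\<^sub>\<beta> z * (1 - z)))) * real n powr \<beta>\<bar> \<le> \<epsilon> * real n powr \<beta> + C" if \<epsilon>: "\<epsilon> > 0" for \<epsilon>
    proof -
      \<comment> \<open>Three terms with coefficient 2 use six shares, and the binomial fluctuation
        uses the seventh.\<close>
      define \<delta> where "\<delta> = \<epsilon> / 7"
      have \<delta>: "\<delta> > 0" using \<epsilon> by (simp add: \<delta>_def)
      obtain C where C: "C \<ge> 0" "mean_prim_error_bound \<delta> C" using mean_prim_error_bound_small[OF \<delta>] by auto
      have prim_bd: "\<bar>mean_prim j y - K0 * F\<^sub>\<beta> y * real j powr \<beta>\<bar> \<le> \<delta> * real j powr \<beta> + C" if "y \<in> {0..1}" for j y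
        using C(2) that by (auto simp: mean_prim_error_bound_def)
      define K where "K = K0 * F\<^sub>\<beta> 1"
      have KF: "0 \<le> K0 * F\<^sub>\<beta> y" "K0 * F\<^sub>\<beta> y \<le> K" if "y \<in> {0..1}" for y
        using F_bounds[OF that] K0_pos by (auto simp: K_def)
      define Cn where "Cn n = C + (\<delta> + K) * (2 * real n powr (\<beta> / 2))" for n
      have K: "K \<ge> 0" using KF(1)[of 1] by (simp add: K_def)
      have Cn: "Cn n \<ge> 0" for n unfolding Cn_def using C \<delta> K by simp
      have Ile: "1 / (\<beta> + 2) \<le> 1" "1 / (\<beta> + 1) \<le> 1" using beta_bounds by (auto simp: field_simps)
      have I: "((\<lambda>t. t powr (\<beta> + 1) * \<delta>) has_integral 1 / (\<beta> + 2) * \<delta>) {0..1}"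
        using has_integral_mult_left[OF has_integral_powr_01[of "\<beta> + 1" 1], of \<delta>] beta_bounds by (simp add: add.assoc)
      have mn: "min 1 (z / t) \<in> {0..1}" if "t \<in> {0<..1}" for t using that z by auto
      have CnI: "D * g + (C + (\<delta> + \<bar>K0 * F\<^sub>\<beta> y\<bar>) * (2 * real n powr (\<beta> / 2))) \<le> D * g + Cn n" if "y \<in> {0..1}" for D g y n
        unfolding Cn_def using KF[OF that] by (intro add_left_mono mult_right_mono) auto
      have Q: "\<bar>avg_hprim n z - K0 * (real n powr \<beta> / (\<beta> + 1)) * S\<^sub>\<beta> z\<bar> \<le> real n powr \<beta> / (\<beta> + 1) * (1 / (\<beta> + 2) * \<delta>) + Cn n" for n
      proof (rule integral_approx[OF z'(1) avg_hprim_integral[OF z'(1)] I _ Cn])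
        show "\<beta> + 1 > 0" using beta_bounds by simp
        fix t :: real assume t: "t \<in> {0<..1}"
        show "\<bar>bern_avg n t (\<lambda>j. mean_prim j (min 1 (z / t))) - K0 * F\<^sub>\<beta> (min 1 (z / t)) * ((real n * t) powr \<beta> / (\<beta> + 1))\<bar>
            \<le> \<delta> * ((real n * t) powr \<beta> / (\<beta> + 1)) + Cn n"
          by (rule order_trans[OF bern_avg_approx CnI]) (use t mn[OF t] \<delta> prim_bd in auto)
      qed
      have R: "\<bar>mean_hprim n z - K0 * (real n powr \<beta> / 1) * S\<^sub>\<beta> z\<bar> \<le> real n powr \<beta> / 1 * (1 / (\<beta> + 2) * \<delta>) + Cn n" for n
      proof (rule integral_approx[OF z'(1) mean_hprim_integral[OF z'(1)] I _ Cn])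
        fix t :: real assume t: "t \<in> {0<..1}"
        have "\<bar>bern_mean n t (\<lambda>j. mean_prim j (min 1 (z / t))) - K0 * F\<^sub>\<beta> (min 1 (z / t)) * (real n * t) powr \<beta>\<bar>
            \<le> \<delta> * (real n * t) powr \<beta> + Cn n"
          by (rule order_trans[OF bern_mean_approx CnI]) (use t mn[OF t] \<delta> prim_bd in auto)
        then show "\<bar>bern_mean n t (\<lambda>j. mean_prim j (min 1 (z / t))) - K0 * F\<^sub>\<beta> (min 1 (z / t)) * ((real n * t) powr \<beta> / 1)\<bar>
            \<le> \<delta> * ((real n * t) powr \<beta> / 1) + Cn n" by simp
      qed simp
      have E: "\<bar>bern_avg n 1 (\<lambda>j. mean_prim j z) - K0 * F\<^sub>\<beta> z * ((real n * 1) powr \<beta> / (\<beta> + 1))\<bar> \<le> \<delta> * ((real n * 1) powr \<beta> / (\<beta> + 1)) + Cn n" for n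
        by (rule order_trans[OF bern_avg_approx CnI]) (use z' \<delta> prim_bd in auto)
      \<comment> \<open>The same integration by parts for the limit functions, so that the error
        splits into those of the three terms.\<close>
      have lim: "K0 * (z * (m\<^sub>\<beta> z * (1 - z))) * N
          = 2 * (K0 * (N / 1) * S\<^sub>\<beta> z) + 2 * (K0 * (N / (\<beta> + 1)) * S\<^sub>\<beta> z) - 2 * (K0 * F\<^sub>\<beta> z * (N / (\<beta> + 1)))" for N
      proof -
        have "z * h\<^sub>\<beta> z = (\<beta> + 2) * S\<^sub>\<beta> z - F\<^sub>\<beta> z"
        proof -
          have "\<beta> + 2 \<noteq> 0" using beta_bounds by linarith
          then show ?thesis by (simp add: S\<^sub>\<beta>_def)
        qed
        then have zh: "2 / (\<beta> + 1) * (z * h\<^sub>\<beta> z) = 2 / (\<beta> + 1) * ((\<beta> + 2) * S\<^sub>\<beta> z - F\<^sub>\<beta> z)" by simp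
        have "2 / (\<beta> + 1) * (z * h\<^sub>\<beta> z) = (2 / (\<beta> + 1) * (2 / (\<beta> + 2))) * (z * (m\<^sub>\<beta> z * (1 - z)))"
          unfolding h\<^sub>\<beta>_def by (simp add: mult_ac)
        then have "z * (m\<^sub>\<beta> z * (1 - z)) = 2 / (\<beta> + 1) * ((\<beta> + 2) * S\<^sub>\<beta> z - F\<^sub>\<beta> z)"
          unfolding zh beta_eq' by simp
        moreover have "K0 * (2 / c * ((c + 1) * S - F)) * N
            = 2 * (K0 * (N / 1) * S) + 2 * (K0 * (N / c) * S) - 2 * (K0 * F * (N / c))" if "c > 0" for c S F :: real
          using that by (simp add: field_simps)
        from this[of "\<beta> + 1" "S\<^sub>\<beta> z" "F\<^sub>\<beta> z"]
        have "K0 * (2 / (\<beta> + 1) * ((\<beta> + 2) * S\<^sub>\<beta> z - F\<^sub>\<beta> z)) * N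
            = 2 * (K0 * (N / 1) * S\<^sub>\<beta> z) + 2 * (K0 * (N / (\<beta> + 1)) * S\<^sub>\<beta> z) - 2 * (K0 * F\<^sub>\<beta> z * (N / (\<beta> + 1)))"
          using beta_bounds by (simp add: add.assoc)
        ultimately show ?thesis by simp
      qed
      define B where "B = (12 * (\<delta> + K))\<^sup>2 / (4 * \<delta>)"
      have "\<bar>z * X z n - (K0 * (z * (m\<^sub>\<beta> z * (1 - z)))) * real n powr \<beta>\<bar> \<le> \<epsilon> * real n powr \<beta> + (6 * C + B)" for n
      proof -
        let ?N = "real n powr \<beta>"
        have s: "g * (c * \<delta>) \<le> \<delta> * ?N" if "g \<le> ?N" "c \<le> 1" "0 \<le> c" for g c
        proof -
          have "g * (c * \<delta>) \<le> ?N * (1 * \<delta>)" using that \<delta> by (intro mult_mono) auto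
          then show ?thesis by (simp add: mult.commute)
        qed
        have g1: "?N / (\<beta> + 1) \<le> ?N" using mult_left_mono[OF Ile(2), of ?N] by simp
        have i0: "0 \<le> 1 / (\<beta> + 2)" using beta_bounds by simp
        have 1: "?N / (\<beta> + 1) * (1 / (\<beta> + 2) * \<delta>) \<le> \<delta> * ?N" by (rule s[OF g1 Ile(1) i0])
        have 2: "?N / 1 * (1 / (\<beta> + 2) * \<delta>) \<le> \<delta> * ?N" by (rule s[OF _ Ile(1) i0]) simp
        have 3: "\<delta> * ((real n * 1) powr \<beta> / (\<beta> + 1)) \<le> \<delta> * ?N"
          using g1 \<delta> by (intro mult_left_mono) auto
        have "\<bar>z * X z n - (K0 * (z * (m\<^sub>\<beta> z * (1 - z)))) * ?N\<bar>
          \<le> 2 * (\<bar>mean_hprim n z - K0 * (?N / 1) * S\<^sub>\<beta> z\<bar> + \<bar>avg_hprim n z - K0 * (?N / (\<beta> + 1)) * S\<^sub>\<beta> z\<bar>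
            + \<bar>bern_avg n 1 (\<lambda>j. mean_prim j z) - K0 * F\<^sub>\<beta> z * ((real n * 1) powr \<beta> / (\<beta> + 1))\<bar>)"
          unfolding X_def hpoly_sum_eq lim mult_1_right
          by (rule abs_combination_le)
        also have "\<dots> \<le> 2 * ((\<delta> * ?N + Cn n) + (\<delta> * ?N + Cn n) + (\<delta> * ?N + Cn n))"
          by (intro mult_left_mono add_mono order_trans[OF R add_right_mono[OF 2]]
              order_trans[OF Q add_right_mono[OF 1]] order_trans[OF E add_right_mono[OF 3]]) auto
        also have "\<dots> = 6 * (\<delta> * ?N) + 6 * Cn n" by simp
        also have "6 * Cn n \<le> 6 * C + (\<delta> * ?N + B)"
        proof -
          have "12 * (\<delta> + K) * real n powr (\<beta> / 2) \<le> \<delta> * ?N + B"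
            unfolding B_def using \<delta> K by (intro powr_half_le) auto
          then show ?thesis unfolding Cn_def by (simp add: algebra_simps)
        qed
        finally show ?thesis by (simp add: \<delta>_def)
      qed
      then show ?thesis by blast
    qed
    then have "(\<lambda>n. z * X z n / real n powr \<beta>) \<longlonglongrightarrow> K0 * (z * (m\<^sub>\<beta> z * (1 - z)))"
      by (rule error_bound_imp_limit)
    then have "(\<lambda>n. z * X z n / real n powr \<beta> / z) \<longlonglongrightarrow> K0 * (z * (m\<^sub>\<beta> z * (1 - z))) / z"
      using z'(2) by (intro tendsto_divide tendsto_const) auto
    then show ?thesis using z'(2) by simp
  qed
  have "(\<lambda>n. X x n / real n powr \<beta> + X (1 - x) n / real n powr \<beta>) \<longlonglongrightarrow>
      K0 * (m\<^sub>\<beta> x * (1 - x)) + K0 * (m\<^sub>\<beta> (1 - x) * (1 - (1 - x)))"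
    using x by (intro tendsto_add X) auto
  also have "K0 * (m\<^sub>\<beta> x * (1 - x)) + K0 * (m\<^sub>\<beta> (1 - x) * (1 - (1 - x))) = K0 * m\<^sub>\<beta> x"
  proof -
    have "m\<^sub>\<beta> (1 - x) = m\<^sub>\<beta> x" by (simp add: m\<^sub>\<beta>_def mult.commute)
    then show ?thesis by (simp add: algebra_simps)
  qed
  finally have "(\<lambda>n. mean_crossed (Suc n) x / real n powr \<beta>) \<longlonglongrightarrow> K0 * m\<^sub>\<beta> x"
    unfolding mean_crossed_Suc X_def add_divide_distrib .
  moreover have "(\<lambda>n. (real n / real (Suc n)) powr \<beta>) \<longlonglongrightarrow> 1"
    by real_asymp
  ultimately have "(\<lambda>n. mean_crossed (Suc n) x / real n powr \<beta> * (real n / real (Suc n)) powr \<beta>) \<longlonglongrightarrow> K0 * m\<^sub>\<beta> x * 1"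
    by (rule tendsto_mult)
  moreover have "\<forall>\<^sub>F n in sequentially. mean_crossed (Suc n) x / real n powr \<beta> * (real n / real (Suc n)) powr \<beta>
      = mean_crossed (Suc n) x / real (Suc n) powr \<beta>"
    using eventually_gt_at_top[of 0] by eventually_elim (simp add: powr_divide)
  ultimately have "(\<lambda>n. mean_crossed (Suc n) x / real (Suc n) powr \<beta>) \<longlonglongrightarrow> K0 * m\<^sub>\<beta> x"
    using Lim_transform_eventually by fastforce
  then show ?thesis by (simp only: filterlim_sequentially_Suc[of "\<lambda>n. mean_crossed n x / real n powr \<beta>"])
qed

section \<open>Growth at the endpoints\<close>

lemma bern_mean_sqrt:
  assumes "0 \<le> p" "p \<le> 1"
  shows "bern_mean n p (\<lambda>j. sqrt (real j)) \<le> sqrt (real n * p)"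
proof (cases "real n * p = 0")
  case True
  have "sqrt (real j) \<le> real j" for j
  proof (rule real_le_lsqrt)
    show "real j \<le> (real j)\<^sup>2" by (cases j) (auto simp: power2_eq_square)
  qed auto
  then have "bern_mean n p (\<lambda>j. sqrt (real j)) \<le> bern_mean n p real"
    using assms by (intro bern_mean_mono) auto
  then show ?thesis unfolding bern_mean_of_nat True real_sqrt_zero .
next
  case False
  then have s: "real n * p > 0" using assms mult_nonneg_nonneg[of "real n" p] by linarith
  define r where "r = sqrt (real n * p)"
  have r: "r > 0" "r\<^sup>2 = real n * p" using s unfolding r_def by (simp only: real_sqrt_gt_0_iff, simp only: real_sqrt_pow2 less_imp_le)
  \<comment> \<open>Jensen's inequality by way of the tangent to the square root at the mean; it has
    no tangent at 0, hence the separate case above.\<close>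
  have "sqrt (real j) \<le> r / 2 + 1 / (2 * r) * real j" for j
  proof -
    have "0 \<le> (sqrt (real j) - r)\<^sup>2 / (2 * r)" using r by simp
    also have "(sqrt (real j) - r)\<^sup>2 / (2 * r) = r / 2 + 1 / (2 * r) * real j - sqrt (real j)"
      using r(1) by (simp add: power2_diff field_simps power2_eq_square)
    finally show ?thesis by simp
  qed
  then have "bern_mean n p (\<lambda>j. sqrt (real j)) \<le> bern_mean n p (\<lambda>j. r / 2 + 1 / (2 * r) * real j)"
    using assms by (intro bern_mean_mono) auto
  also have "\<dots> = r / 2 + 1 / (2 * r) * r\<^sup>2" unfolding bern_mean_add bern_mean_cmult bern_mean_of_nat r(2) by simp
  also have "\<dots> = r" using r(1) by (simp add: power2_eq_square field_simps)
  finally show ?thesis unfolding r_def .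
qed

lemma bern_avg_sqrt:
  assumes "0 \<le> t" "t \<le> 1"
  shows "bern_avg n t (\<lambda>j. sqrt (real j)) \<le> 2 / 3 * sqrt (real n) * t powr (1 / 2)"
proof -
  have "((\<lambda>v. v powr (1 / 2)) has_integral (2 / 3)) {0..1::real}"
    using has_integral_powr_01[of "1 / 2" 1] by simp
  then have i: "((\<lambda>v. sqrt (real n) * t powr (1 / 2) * v powr (1 / 2)) has_integral sqrt (real n) * t powr (1 / 2) * (2 / 3)) {0..1}"
    by (rule has_integral_mult_right)
  have "bern_avg n t (\<lambda>j. sqrt (real j)) \<le> integral {0..1} (\<lambda>v. sqrt (real n) * t powr (1 / 2) * v powr (1 / 2))"
    unfolding bern_avg_def
  proof (rule integral_le[OF bern_mean_integrable has_integral_integrable[OF i]])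
    fix v :: real assume v: "v \<in> {0..1}"
    have "bern_mean n (t * v) (\<lambda>j. sqrt (real j)) \<le> sqrt (real n * (t * v))"
      using assms v by (intro bern_mean_sqrt) (auto intro: mult_le_one)
    also have "\<dots> = sqrt (real n) * t powr (1 / 2) * v powr (1 / 2)"
      using assms v by (simp add: real_sqrt_mult powr_half_sqrt)
    finally show "bern_mean n (t * v) (\<lambda>j. sqrt (real j)) \<le> sqrt (real n) * t powr (1 / 2) * v powr (1 / 2)" .
  qed
  then show ?thesis unfolding integral_unique[OF i] by (simp add: mult_ac)
qed

text \<open>At \<open>x = 0\<close> growth \<open>n powr r\<close> is contracted by \<open>2 / (r + 1)\<^sup>2\<close>, which is \<open>8 / 9\<close> for \<open>r = 1 / 2\<close>.\<close>

lemma mean_crossed_at_0: "mean_crossed n 0 \<le> 1 + 9 * sqrt (real n)"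
proof (induction n rule: less_induct)
  case (less n)
  show ?case
  proof (cases n)
    case 0
    then show ?thesis by (simp add: mean_crossed_def)
  next
    case (Suc k)
    \<comment> \<open>At x = 0 only left pieces are crossed, and the coefficient of
      \<open>crossed_poly i\<close> at 0 carries 1 / (i + 1) twice: once from the height, hidden in
      \<open>bern_avg\<close>, and once from integrating over the width t.\<close>
    have i: "((\<lambda>t. 2 * bern_avg k t (\<lambda>j. mean_crossed j 0)) has_integral mean_crossed (Suc k) 0) {0..1}"
    proof -
      have p: "((\<lambda>t. t ^ i) has_integral (1 / (real i + 1))) {0..1::real}" for i :: nat
      proof -
        have "((\<lambda>t. t powr real i) has_integral (1 powr (real i + 1) / (real i + 1))) {0..1::real}"
          by (rule has_integral_powr_01) auto
        then have "((\<lambda>t. t powr real i) has_integral (1 / (real i + 1))) {0..1::real}" by simp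
        then show ?thesis
          by (rule has_integral_spike_finite[of "{0}", rotated 2]) (auto simp: powr_realpow)
      qed
      have "((\<lambda>t. \<Sum>i\<le>k. real (k choose i) * poly (crossed_poly i) 0 * (2 / (real i + 1)) * t ^ i) has_integral
         (\<Sum>i\<le>k. real (k choose i) * poly (crossed_poly i) 0 * (2 / (real i + 1)) * (1 / (real i + 1)))) {0..1}"
        by (intro has_integral_sum has_integral_mult_right p) auto
      moreover have "2 * bern_avg k t (\<lambda>j. mean_crossed j 0) = (\<Sum>i\<le>k. real (k choose i) * poly (crossed_poly i) 0 * (2 / (real i + 1)) * t ^ i)" for t
        unfolding mean_crossed_def bern_avg_binomial_sum sum_distrib_left by (intro sum.cong refl) simp
      moreover have "mean_crossed (Suc k) 0 = (\<Sum>i\<le>k. real (k choose i) * poly (crossed_poly i) 0 * (2 / (real i + 1)) * (1 / (real i + 1)))"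
        unfolding mean_crossed_Suc hpoly_def scaling_poly_1 scaling_poly_0 by (simp add: scaling_poly_1 add.commute mult_ac)
      ultimately show ?thesis by simp
    qed
    \<comment> \<open>The constant 9 works because 2 * 9 * (2 / 3) * (2 / 3) = 8, and the spare sqrt
      (k + 1) >= 1 pays for the growth of the additive constant from 1 to 2.\<close>
    have b: "((\<lambda>t. 2 * (1 + 9 * (2 / 3 * sqrt (real k) * t powr (1 / 2)))) has_integral 2 + 8 * sqrt (real k)) {0..1::real}"
    proof -
      have "((\<lambda>t. t powr (1 / 2)) has_integral (2 / 3)) {0..1::real}"
        using has_integral_powr_01[of "1 / 2" 1] by simp
      then have "((\<lambda>t. 2 * (1 + 9 * (2 / 3 * sqrt (real k) * t powr (1 / 2)))) has_integral
          2 * (1 + 9 * (2 / 3 * sqrt (real k) * (2 / 3)))) {0..1::real}"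
        using has_integral_const_real[of 1 0 1]
        by (intro has_integral_mult_right has_integral_add) auto
      then show ?thesis by simp
    qed
    have "mean_crossed (Suc k) 0 \<le> 2 + 8 * sqrt (real k)"
    proof (rule has_integral_le[OF i b])
      fix t :: real assume t: "t \<in> {0..1}"
      have "bern_avg k t (\<lambda>j. mean_crossed j 0) \<le> bern_avg k t (\<lambda>j. 1 + 9 * sqrt (real j))"
        using t less Suc by (intro bern_avg_mono) auto
      also have "\<dots> = 1 + 9 * bern_avg k t (\<lambda>j. sqrt (real j))" unfolding bern_avg_add bern_avg_cmult by simp
      also have "\<dots> \<le> 1 + 9 * (2 / 3 * sqrt (real k) * t powr (1 / 2))"
        using bern_avg_sqrt[of t k] t by simp
      finally show "2 * bern_avg k t (\<lambda>j. mean_crossed j 0) \<le> 2 * (1 + 9 * (2 / 3 * sqrt (real k) * t powr (1 / 2)))" by simp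
    qed
    also have "\<dots> \<le> 1 + 9 * sqrt (real (Suc k))"
    proof -
      have "sqrt (real k) \<le> sqrt (real (Suc k))" "1 \<le> sqrt (real (Suc k))" by auto
      then show ?thesis by linarith
    qed
    finally show ?thesis using Suc by simp
  qed
qed

lemma mean_crossed_endpoint:
  assumes "x = 0 \<or> x = 1"
  shows "(\<lambda>n. mean_crossed n x / real n powr \<beta>) \<longlonglongrightarrow> 0"
proof -
  have "mean_crossed n 1 = mean_crossed n 0" for n
    unfolding mean_crossed_def using poly_crossed_poly_reflect[of _ 0] by simp
  then have bd: "0 \<le> mean_crossed n x" "mean_crossed n x \<le> 1 + 9 * sqrt (real n)" for n
    using assms mean_crossed_at_0[of n] mean_crossed_nonneg[of x n] by auto
  have "(\<lambda>n. (1 + 9 * sqrt (real n)) / real n powr \<beta>) \<longlonglongrightarrow> 0"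
    using beta_bounds by real_asymp
  then show ?thesis
    by (rule Lim_null_comparison[rotated])
       (use bd in \<open>auto intro!: always_eventually divide_right_mono simp: abs_of_nonneg\<close>)
qed

theorem theorem1p1:
  fixes M :: "'a measure" and P :: "nat \<Rightarrow> 'a \<Rightarrow> real \<times> real" and x :: real
  assumes "prob_space M"
    and "prob_space.indep_vars M (\<lambda>_. borel) P {1..}"
    and "\<And>k. k \<ge> 1 \<Longrightarrow>
      distr M borel (P k) = uniform_measure lborel ({0<..<1} \<times> {0<..<1})"
    and "x \<in> {0..1}"
  shows "(\<lambda>n. real n powr (- beta_star) *
            prob_space.expectation M (\<lambda>\<omega>. num_crossed (\<lambda>k. P k \<omega>) n x))
         \<longlonglongrightarrow> K0 * (x * (1 - x)) powr (beta_star / 2)"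
proof -
  have "(\<lambda>n. mean_crossed n x / real n powr \<beta>) \<longlonglongrightarrow> K0 * m\<^sub>\<beta> x"
  proof (cases "x = 0 \<or> x = 1")
    case True
    then have "m\<^sub>\<beta> x = 0" by (auto simp: m\<^sub>\<beta>_def)
    then show ?thesis using mean_crossed_endpoint[OF True] by simp
  next
    case False
    then show ?thesis using assms(4) by (intro mean_crossed_asymp) auto
  qed
  \<comment> \<open>The 1 subtracted in \<open>num_crossed\<close> is negligible at this
    scale.\<close>
  moreover have "(\<lambda>n. 1 / real n powr \<beta>) \<longlonglongrightarrow> 0"
    using beta_bounds by real_asymp
  ultimately have "(\<lambda>n. mean_crossed n x / real n powr \<beta> - 1 / real n powr \<beta>) \<longlonglongrightarrow> K0 * m\<^sub>\<beta> x - 0"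
    by (rule tendsto_diff)
  moreover have "real n powr (- \<beta>) * prob_space.expectation M (\<lambda>\<omega>. num_crossed (\<lambda>k. P k \<omega>) n x)
      = mean_crossed n x / real n powr \<beta> - 1 / real n powr \<beta>" for n
  proof -
    have "prob_space.expectation M (\<lambda>\<omega>. num_crossed (\<lambda>k. P k \<omega>) n x) = rect_mean x n 0 1 0 1 - 1"
      by (rule expectation_num_crossed) (use assms in auto)
    moreover have "real n powr (- \<beta>) * (c - 1) = c / real n powr \<beta> - 1 / real n powr \<beta>" for c
      by (simp add: powr_minus divide_inverse algebra_simps)
    ultimately show ?thesis unfolding mean_crossed[OF assms(4)] by simp
  qed
  ultimately show ?thesis by (simp add: m\<^sub>\<beta>_def)
qed

end
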